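(* For any abelian group $A$, there is an exact sequence $$0\to H_1\big(\Sigma_2^{\varepsilon}, \mathrm{Tor}_1^{\mathbb{Z}}({}_{2^\infty}A,{}_{2^\infty}A)\big)\to \Gamma(A)\xrightarrow{\ \Psi\ } A\otimes_{\mathbb{Z}} A\to H_2(A,\mathbb{Z})\to 0,$$ where $\Psi$ is the homomorphism determined by $\Psi(\gamma(a))=a\otimes a$ for $a\in A$.
   Context: $H_n(-,\mathbb{Z})$ denotes integral group homology. The map $A\otimes_{\mathbb{Z}}A\to H_2(A,\mathbb{Z})$ is the canonical surjection $A\otimes_{\mathbb{Z}} A\to A\wedge A\cong H_2(A,\mathbb{Z})$. Whitehead's quadratic functor $\Gamma$: a function $\psi:A\to B$ of additive abelian groups is a quadratic map if (1) $\psi(a)=\psi(-a)$ for all $a\in A$, and (2) the function $A\times A\to B$, $(a,b)\mapsto \psi(a+b)-\psi(a)-\psi(b)$, is bilinear. $\gamma:A\to\Gamma(A)$ denotes the universal quadratic map: for every quadratic map $\psi:A\to B$ there is a unique group homomorphism $\Gamma(A)\to B$ whose composition with $\gamma$ is $\psi$. The homomorphism $\Psi$ is the one corresponding to the quadratic map $A\to A\otimes_{\mathbb{Z}}A$, $a\mapsto a\otimes a$. ${}_{2^\infty}A$ denotes the subgroup of elements of $A$ of $2$-power order. The action of $\Sigma_2^{\varepsilon}$: for an abelian group $B$ and $n\ge 1$, let ${}_nB=\{b\in B: nb=0\}$ and let $\tau_n:{}_nB\otimes_{\mathbb{Z}}{}_nB\to \mathrm{Tor}_1^{\mathbb{Z}}(B,B)$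 be the standard natural homomorphism, with $\tau_n(a,b)$ the image of $a\otimes b$; the elements $\tau_n(a,b)$, for varying $n$, generate $\mathrm{Tor}_1^{\mathbb{Z}}(B,B)$ and satisfy, for $n=sm$, $\tau_n(a,b)=\tau_s(ma,b)$ if $a\in{}_nB$, $b\in{}_sB$, and $\tau_n(a,b)=\tau_s(a,mb)$ if $a\in{}_sB$, $b\in{}_nB$. $\Sigma_2^{\varepsilon}=\{\mathrm{id},\sigma^{\varepsilon}\}$ is the symmetric group of order $2$ acting on $\mathrm{Tor}_1^{\mathbb{Z}}(B,B)$ by the involution $\sigma^{\varepsilon}$ determined by $\sigma^{\varepsilon}(\tau_n(a,b))=\tau_n(b,a)$. Equivalently $\sigma^{\varepsilon}=-\sigma_1$, where $\sigma_1$ is the interchange map on $\mathrm{Tor}_1^{\mathbb{Z}}(B,B)$ induced by $a\otimes b\mapsto -b\otimes a$. Here this is applied with $B={}_{2^\infty}A$, and $H_1(\Sigma_2^{\varepsilon},-)$ is group homology with coefficients in this module. *)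

theory Defs
  imports "HOL-Algebra.Free_Abelian_Groups" "HOL-Algebra.Sym_Groups"
begin

text \<open>
  Abelian groups are \<^locale>\<open>comm_group\<close> structures in the multiplicative notation of HOL-Algebra:
  \<open>\<otimes>\<^bsub>A\<^esub>\<close> is the addition of \<open>A\<close>, \<open>\<one>\<^bsub>A\<^esub>\<close> its zero and \<open>a [^]\<^bsub>A\<^esub> n\<close> the multiple \<open>n a\<close>.
\<close>

section \<open>Abelian groups given by generators and relations\<close>

definition presented :: "'s set \<Rightarrow> ('s \<Rightarrow>\<^sub>0 int) set \<Rightarrow> ('s \<Rightarrow>\<^sub>0 int) set monoid"
  where "presented S R = free_Abelian_group S Mod generate (free_Abelian_group S) R"

definition presented_gen :: "'s set \<Rightarrow> ('s \<Rightarrow>\<^sub>0 int) set \<Rightarrow> 's \<Rightarrow> ('s \<Rightarrow>\<^sub>0 int) set"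
  where "presented_gen S R s =
           generate (free_Abelian_group S) R #>\<^bsub>free_Abelian_group S\<^esub> frag_of s"

definition free_lift :: "('b, 'm) monoid_scheme \<Rightarrow> ('s \<Rightarrow> 'b) \<Rightarrow> ('s \<Rightarrow>\<^sub>0 int) \<Rightarrow> 'b"
  where "free_lift G f c =
           (\<Otimes>\<^bsub>G\<^esub>s\<in>Poly_Mapping.keys c. f s [^]\<^bsub>G\<^esub> Poly_Mapping.lookup c s)"

text \<open>
  The homomorphism induced by \<open>f\<close> on a presented group. It is meaningful when \<open>free_lift G f\<close>
  kills the relations; then \<open>free_lift G f\<close> is constant on each coset \<open>X\<close>
  (see \<open>presented_lift_hom\<close> and \<open>presented_lift_gen\<close> below).
\<close>

definition presented_lift :: "('b, 'm) monoid_scheme \<Rightarrow> ('s \<Rightarrow> 'b) \<Rightarrow> ('s \<Rightarrow>\<^sub>0 int) set \<Rightarrow> 'b"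
  where "presented_lift G f X = the_elem (free_lift G f ` X)"

lemma free_lift_hom:
  assumes "comm_group G" "f \<in> S \<rightarrow> carrier G"
  shows "free_lift G f \<in> hom (free_Abelian_group S) G"
proof -
  interpret comm_group G by fact
  have widen: "free_lift G f c = (\<Otimes>\<^bsub>G\<^esub>s\<in>T. f s [^]\<^bsub>G\<^esub> Poly_Mapping.lookup c s)"
    if "finite T" "T \<subseteq> S" "Poly_Mapping.keys c \<subseteq> T" for c T
    unfolding free_lift_def
    by (rule finprod_mono_neutral_cong_left) (use assms(2) that in \<open>auto simp: in_keys_iff Pi_iff\<close>)
  show ?thesis
  proof (rule homI)
    fix x y
    assume x: "x \<in> carrier (free_Abelian_group S)" and y: "y \<in> carrier (free_Abelian_group S)"
    define T where "T = Poly_Mapping.keys x \<union> Poly_Mapping.keys y"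
    have T: "finite T" "T \<subseteq> S" "Poly_Mapping.keys x \<subseteq> T" "Poly_Mapping.keys y \<subseteq> T"
      using x y by (auto simp: T_def)
    have fT: "s \<in> T \<Longrightarrow> f s \<in> carrier G" for s
      using assms(2) T by auto
    have xy: "Poly_Mapping.keys (x + y) \<subseteq> T"
      unfolding T_def by (rule keys_add)
    have "free_lift G f (x + y) =
        (\<Otimes>\<^bsub>G\<^esub>s\<in>T. f s [^]\<^bsub>G\<^esub> Poly_Mapping.lookup x s \<otimes>\<^bsub>G\<^esub> f s [^]\<^bsub>G\<^esub> Poly_Mapping.lookup y s)"
      unfolding widen[OF T(1,2) xy]
      by (rule finprod_cong) (auto simp: fT Poly_Mapping.lookup_add int_pow_mult simp_implies_def)
    also have "\<dots> = free_lift G f x \<otimes>\<^bsub>G\<^esub> free_lift G f y"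
      unfolding widen[OF T(1,2,3)] widen[OF T(1,2,4)]
      by (rule finprod_multf) (auto simp: fT)
    finally show "free_lift G f (x \<otimes>\<^bsub>free_Abelian_group S\<^esub> y) = free_lift G f x \<otimes>\<^bsub>G\<^esub> free_lift G f y"
      by simp
  next
    fix x assume "x \<in> carrier (free_Abelian_group S)"
    then show "free_lift G f x \<in> carrier G"
      unfolding free_lift_def using assms(2) by (auto intro!: finprod_closed)
  qed
qed

lemma free_lift_frag_of:
  assumes "comm_group G" "f s \<in> carrier G"
  shows "free_lift G f (frag_of s) = f s"
proof -
  interpret comm_group G by fact
  show ?thesis
    using assms(2) by (simp add: free_lift_def)
qed

lemma free_lift_diff:
  assumes "comm_group G" "f \<in> S \<rightarrow> carrier G" "Poly_Mapping.keys x \<subseteq> S" "Poly_Mapping.keys y \<subseteq> S"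
  shows "free_lift G f (x - y) = free_lift G f x \<otimes>\<^bsub>G\<^esub> inv\<^bsub>G\<^esub> free_lift G f y"
proof -
  interpret G: comm_group G by fact
  interpret group_hom "free_Abelian_group S" G "free_lift G f"
    by (intro group_hom.intro group_hom_axioms.intro free_lift_hom assms) auto
  have "free_lift G f (x \<otimes>\<^bsub>free_Abelian_group S\<^esub> inv\<^bsub>free_Abelian_group S\<^esub> y) =
      free_lift G f x \<otimes>\<^bsub>G\<^esub> inv\<^bsub>G\<^esub> free_lift G f y"
    using assms(3,4)
    by (simp flip: carrier_free_Abelian_group_iff
        del: mult_free_Abelian_group inv_free_Abelian_group carrier_free_Abelian_group_iff)
  then show ?thesis
    using assms(4) by simp
qed

lemma free_lift_unique:
  assumes "comm_group G" "f \<in> S \<rightarrow> carrier G" "h \<in> hom (free_Abelian_group S) G"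
    and eq: "\<And>s. s \<in> S \<Longrightarrow> h (frag_of s) = f s" and "Poly_Mapping.keys x \<subseteq> S"
  shows "h x = free_lift G f x"
proof -
  interpret G: comm_group G by fact
  interpret h: group_hom "free_Abelian_group S" G h
    by (intro group_hom.intro group_hom_axioms.intro assms) auto
  interpret l: group_hom "free_Abelian_group S" G "free_lift G f"
    by (intro group_hom.intro group_hom_axioms.intro free_lift_hom assms) auto
  show ?thesis
  proof (rule free_Abelian_group_induct[OF assms(5), where P = "\<lambda>x. h x = free_lift G f x"])
    show "h 0 = free_lift G f 0"
      using h.hom_one l.hom_one by simp
  next
    fix x y assume xy: "Poly_Mapping.keys x \<subseteq> S" "Poly_Mapping.keys y \<subseteq> S"
      "h x = free_lift G f x" "h y = free_lift G f y"
    have "h (x \<otimes>\<^bsub>free_Abelian_group S\<^esub> inv\<^bsub>free_Abelian_group S\<^esub> y) =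
        free_lift G f (x \<otimes>\<^bsub>free_Abelian_group S\<^esub> inv\<^bsub>free_Abelian_group S\<^esub> y)"
      using xy
      by (simp flip: carrier_free_Abelian_group_iff
          del: mult_free_Abelian_group inv_free_Abelian_group carrier_free_Abelian_group_iff)
    then show "h (x - y) = free_lift G f (x - y)"
      using xy by simp
  next
    fix s assume "s \<in> S"
    then have "f s \<in> carrier G"
      using assms(2) by auto
    then show "h (frag_of s) = free_lift G f (frag_of s)"
      using eq[OF \<open>s \<in> S\<close>] free_lift_frag_of[OF assms(1), of f s] by simp
  qed
qed

lemma subgroup_generate_rels:
  assumes "R \<subseteq> carrier (free_Abelian_group S)"
  shows "subgroup (generate (free_Abelian_group S) R) (free_Abelian_group S)"
  by (rule group.generate_is_subgroup[OF group_free_Abelian_group assms])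

lemma presented_comm_group:
  assumes "R \<subseteq> carrier (free_Abelian_group S)"
  shows "comm_group (presented S R)"
  unfolding presented_def
  by (rule comm_group.abelian_FactGroup[OF abelian_free_Abelian_group subgroup_generate_rels[OF assms]])

lemma presented_proj_hom:
  assumes "R \<subseteq> carrier (free_Abelian_group S)"
  shows "(\<lambda>x. generate (free_Abelian_group S) R #>\<^bsub>free_Abelian_group S\<^esub> x)
           \<in> hom (free_Abelian_group S) (presented S R)"
  unfolding presented_def
  by (intro normal.r_coset_hom_Mod comm_group.subgroup_imp_normal abelian_free_Abelian_group
      subgroup_generate_rels assms)

lemma carrier_presented:
  "carrier (presented S R) =
    (\<lambda>x. generate (free_Abelian_group S) R #>\<^bsub>free_Abelian_group S\<^esub> x) ` carrier (free_Abelian_group S)"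
  by (auto simp: presented_def FactGroup_def RCOSETS_def)

lemma presented_lift_coset:
  assumes G: "comm_group G" and f: "f \<in> S \<rightarrow> carrier G"
    and R: "R \<subseteq> carrier (free_Abelian_group S)" and kill: "\<And>r. r \<in> R \<Longrightarrow> free_lift G f r = \<one>\<^bsub>G\<^esub>"
    and x: "x \<in> carrier (free_Abelian_group S)"
  shows "presented_lift G f (generate (free_Abelian_group S) R #>\<^bsub>free_Abelian_group S\<^esub> x) = free_lift G f x"
proof -
  let ?F = "free_Abelian_group S"
  interpret G: comm_group G by fact
  interpret group_hom ?F G "free_lift G f"
    by (intro group_hom.intro group_hom_axioms.intro free_lift_hom assms) auto
  have K: "generate ?F R \<subseteq> kernel ?F G (free_lift G f)"
    by (rule group.generate_subgroup_incl[OF group_free_Abelian_group _ subgroup_kernel])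
      (use R kill in \<open>auto simp: kernel_def simp del: carrier_free_Abelian_group_iff\<close>)
  have "free_lift G f (k \<otimes>\<^bsub>?F\<^esub> x) = free_lift G f x" if "k \<in> generate ?F R" for k
  proof -
    have k: "k \<in> carrier ?F" "free_lift G f k = \<one>\<^bsub>G\<^esub>"
      using K that by (auto simp: kernel_def simp del: carrier_free_Abelian_group_iff)
    show ?thesis
      using hom_mult[OF k(1) x] k(2) hom_closed[OF x] by simp
  qed
  moreover have "generate ?F R \<noteq> {}"
    using generate.one by blast
  ultimately have "free_lift G f ` (generate ?F R #>\<^bsub>?F\<^esub> x) = {free_lift G f x}"
    unfolding r_coset_def image_UN image_insert image_empty by simp
  then show ?thesis
    by (simp add: presented_lift_def)
qed

lemma presented_lift_hom:
  assumes G: "comm_group G" and f: "f \<in> S \<rightarrow> carrier G"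
    and R: "R \<subseteq> carrier (free_Abelian_group S)" and kill: "\<And>r. r \<in> R \<Longrightarrow> free_lift G f r = \<one>\<^bsub>G\<^esub>"
  shows "presented_lift G f \<in> hom (presented S R) G"
proof (rule homI)
  let ?F = "free_Abelian_group S"
  let ?q = "\<lambda>x. generate ?F R #>\<^bsub>?F\<^esub> x"
  note co = presented_lift_coset[OF G f R kill]
  note lift = free_lift_hom[OF G f]
  fix X Y
  assume "X \<in> carrier (presented S R)"
  then obtain x where x: "x \<in> carrier ?F" "X = ?q x"
    unfolding carrier_presented by blast
  show "presented_lift G f X \<in> carrier G"
    using co[OF _ x(1)] hom_in_carrier[OF lift x(1)] x(2) by simp
  assume "Y \<in> carrier (presented S R)"
  then obtain y where y: "y \<in> carrier ?F" "Y = ?q y"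
    unfolding carrier_presented by blast
  have xy: "x \<otimes>\<^bsub>?F\<^esub> y \<in> carrier ?F"
    using x(1) y(1) by (meson group.is_monoid group_free_Abelian_group monoid.m_closed)
  have "X \<otimes>\<^bsub>presented S R\<^esub> Y = ?q (x \<otimes>\<^bsub>?F\<^esub> y)"
    unfolding x y using hom_mult[OF presented_proj_hom[OF R] x(1) y(1)] by simp
  then have "presented_lift G f (X \<otimes>\<^bsub>presented S R\<^esub> Y) = free_lift G f (x \<otimes>\<^bsub>?F\<^esub> y)"
    using co[OF _ xy] by simp
  then show "presented_lift G f (X \<otimes>\<^bsub>presented S R\<^esub> Y) = presented_lift G f X \<otimes>\<^bsub>G\<^esub> presented_lift G f Y"
    using hom_mult[OF lift x(1) y(1)] co[OF _ x(1)] co[OF _ y(1)] x(2) y(2) by simp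
qed

lemma presented_lift_gen:
  assumes G: "comm_group G" and f: "f \<in> S \<rightarrow> carrier G"
    and R: "R \<subseteq> carrier (free_Abelian_group S)" and kill: "\<And>r. r \<in> R \<Longrightarrow> free_lift G f r = \<one>\<^bsub>G\<^esub>"
    and s: "s \<in> S"
  shows "presented_lift G f (presented_gen S R s) = f s"
  unfolding presented_gen_def
  using presented_lift_coset[OF G f R kill, of "frag_of s"] free_lift_frag_of[OF G, of f s] f s
  by auto

lemma presented_gen_closed:
  assumes "R \<subseteq> carrier (free_Abelian_group S)" "s \<in> S"
  shows "presented_gen S R s \<in> carrier (presented S R)"
  using assms(2) unfolding carrier_presented presented_gen_def by auto

lemma presented_proj_eq:
  assumes R: "R \<subseteq> carrier (free_Abelian_group S)" and x: "x \<in> carrier (free_Abelian_group S)"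
  shows "generate (free_Abelian_group S) R #>\<^bsub>free_Abelian_group S\<^esub> x
           = free_lift (presented S R) (presented_gen S R) x"
  by (rule free_lift_unique[OF presented_comm_group[OF R] _ presented_proj_hom[OF R]])
    (use x presented_gen_closed[OF R] in \<open>auto simp: presented_gen_def\<close>)

lemma presented_gen_kills:
  assumes R: "R \<subseteq> carrier (free_Abelian_group S)" and r: "r \<in> R"
  shows "free_lift (presented S R) (presented_gen S R) r = \<one>\<^bsub>presented S R\<^esub>"
proof -
  have "r \<in> carrier (free_Abelian_group S)"
    using R r by blast
  then have "free_lift (presented S R) (presented_gen S R) r
      = generate (free_Abelian_group S) R #>\<^bsub>free_Abelian_group S\<^esub> r"
    by (rule presented_proj_eq[OF R, symmetric])
  also have "\<dots> = generate (free_Abelian_group S) R"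
    by (rule group.coset_join2[OF group_free_Abelian_group])
      (use \<open>r \<in> carrier _\<close> subgroup_generate_rels[OF R] r in \<open>auto intro: generate.incl\<close>)
  also have "\<dots> = \<one>\<^bsub>presented S R\<^esub>"
    by (simp add: presented_def FactGroup_def)
  finally show ?thesis .
qed

lemma presented_hom_eqI:
  assumes H: "comm_group H" and R: "R \<subseteq> carrier (free_Abelian_group S)"
    and h: "h \<in> hom (presented S R) H" and k: "k \<in> hom (presented S R) H"
    and eq: "\<And>s. s \<in> S \<Longrightarrow> h (presented_gen S R s) = k (presented_gen S R s)"
    and X: "X \<in> carrier (presented S R)"
  shows "h X = k X"
proof -
  let ?F = "free_Abelian_group S"
  let ?q = "\<lambda>x. generate ?F R #>\<^bsub>?F\<^esub> x"
  obtain x where x: "x \<in> carrier ?F" "X = ?q x"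
    using X unfolding carrier_presented by blast
  have f: "(\<lambda>s. k (presented_gen S R s)) \<in> S \<rightarrow> carrier H"
    using presented_gen_closed[OF R] hom_in_carrier[OF k] by auto
  have "(h \<circ> ?q) x = free_lift H (\<lambda>s. k (presented_gen S R s)) x"
    by (rule free_lift_unique[OF H f hom_compose[OF presented_proj_hom[OF R] h]])
      (use x eq in \<open>auto simp: presented_gen_def\<close>)
  moreover have "(k \<circ> ?q) x = free_lift H (\<lambda>s. k (presented_gen S R s)) x"
    by (rule free_lift_unique[OF H f hom_compose[OF presented_proj_hom[OF R] k]])
      (use x in \<open>auto simp: presented_gen_def\<close>)
  ultimately show ?thesis
    using x(2) by simp
qed


section \<open>Tensor product over the integers\<close>

definition tensor_rels ::
    "('a, 'm) monoid_scheme \<Rightarrow> ('b, 'n) monoid_scheme \<Rightarrow> ('a \<times> 'b \<Rightarrow>\<^sub>0 int) set"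
  where "tensor_rels A B =
    {frag_of (a \<otimes>\<^bsub>A\<^esub> a', b) - frag_of (a, b) - frag_of (a', b) | a a' b.
       a \<in> carrier A \<and> a' \<in> carrier A \<and> b \<in> carrier B} \<union>
    {frag_of (a, b \<otimes>\<^bsub>B\<^esub> b') - frag_of (a, b) - frag_of (a, b') | a b b'.
       a \<in> carrier A \<and> b \<in> carrier B \<and> b' \<in> carrier B}"

definition tensor ::
    "('a, 'm) monoid_scheme \<Rightarrow> ('b, 'n) monoid_scheme \<Rightarrow> ('a \<times> 'b \<Rightarrow>\<^sub>0 int) set monoid"
  where "tensor A B = presented (carrier A \<times> carrier B) (tensor_rels A B)"

definition tensor_elem ::
    "('a, 'm) monoid_scheme \<Rightarrow> ('b, 'n) monoid_scheme \<Rightarrow> 'a \<Rightarrow> 'b \<Rightarrow> ('a \<times> 'b \<Rightarrow>\<^sub>0 int) set"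
  where "tensor_elem A B a b = presented_gen (carrier A \<times> carrier B) (tensor_rels A B) (a, b)"

text \<open>The homomorphism on the tensor product induced by a bilinear map \<open>f\<close> into \<open>G\<close>.\<close>

definition tensor_lift :: "('c, 'k) monoid_scheme \<Rightarrow> ('a \<Rightarrow> 'b \<Rightarrow> 'c) \<Rightarrow> ('a \<times> 'b \<Rightarrow>\<^sub>0 int) set \<Rightarrow> 'c"
  where "tensor_lift G f = presented_lift G (\<lambda>(a, b). f a b)"

definition bilinear_map ::
    "('a, 'm) monoid_scheme \<Rightarrow> ('b, 'n) monoid_scheme \<Rightarrow> ('c, 'k) monoid_scheme \<Rightarrow> ('a \<Rightarrow> 'b \<Rightarrow> 'c) \<Rightarrow> bool"
  where "bilinear_map A B G f \<longleftrightarrow>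
    (\<forall>a\<in>carrier A. f a \<in> hom B G) \<and> (\<forall>b\<in>carrier B. (\<lambda>a. f a b) \<in> hom A G)"


lemma tensor_rels_subset:
  assumes "comm_group A" "comm_group B"
  shows "tensor_rels A B \<subseteq> carrier (free_Abelian_group (carrier A \<times> carrier B))"
proof -
  interpret A: comm_group A by fact
  interpret B: comm_group B by fact
  show ?thesis
    by (auto simp: tensor_rels_def dest!: subsetD[OF keys_diff])
qed

lemma comm_group_diff_eq_iff:
  assumes "comm_group G" "x \<in> carrier G" "y \<in> carrier G" "z \<in> carrier G"
  shows "x \<otimes>\<^bsub>G\<^esub> inv\<^bsub>G\<^esub> y \<otimes>\<^bsub>G\<^esub> inv\<^bsub>G\<^esub> z = \<one>\<^bsub>G\<^esub> \<longleftrightarrow> x = y \<otimes>\<^bsub>G\<^esub> z"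
proof -
  interpret comm_group G by fact
  have "x \<otimes>\<^bsub>G\<^esub> inv\<^bsub>G\<^esub> y \<otimes>\<^bsub>G\<^esub> inv\<^bsub>G\<^esub> z = x \<otimes>\<^bsub>G\<^esub> inv\<^bsub>G\<^esub> (y \<otimes>\<^bsub>G\<^esub> z)"
    using assms by (simp add: inv_mult m_assoc)
  moreover have "x \<otimes>\<^bsub>G\<^esub> inv\<^bsub>G\<^esub> w = \<one>\<^bsub>G\<^esub> \<longleftrightarrow> x = w" if "w \<in> carrier G" for w
    using assms(2) that by (metis inv_closed inv_inv inv_equality r_inv)
  ultimately show ?thesis
    using assms by simp
qed

lemma free_lift_diff3:
  assumes "comm_group G" "f \<in> S \<rightarrow> carrier G"
    "Poly_Mapping.keys x \<subseteq> S" "Poly_Mapping.keys y \<subseteq> S" "Poly_Mapping.keys z \<subseteq> S"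
  shows "free_lift G f (x - y - z) =
    free_lift G f x \<otimes>\<^bsub>G\<^esub> inv\<^bsub>G\<^esub> free_lift G f y \<otimes>\<^bsub>G\<^esub> inv\<^bsub>G\<^esub> free_lift G f z"
proof -
  have "Poly_Mapping.keys (x - y) \<subseteq> S"
    using assms(3,4) keys_diff[of x y] by blast
  then show ?thesis
    using assms by (simp add: free_lift_diff[where S = S])
qed

lemma free_lift_kills_diff3:
  assumes "comm_group G" "f \<in> S \<rightarrow> carrier G"
    "Poly_Mapping.keys x \<subseteq> S" "Poly_Mapping.keys y \<subseteq> S" "Poly_Mapping.keys z \<subseteq> S"
  shows "free_lift G f (x - y - z) = \<one>\<^bsub>G\<^esub> \<longleftrightarrow>
    free_lift G f x = free_lift G f y \<otimes>\<^bsub>G\<^esub> free_lift G f z"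
  unfolding free_lift_diff3[OF assms]
  by (rule comm_group_diff_eq_iff[OF assms(1)])
    (use hom_in_carrier[OF free_lift_hom[OF assms(1,2)]] assms(3-5) in auto)

lemma tensor_rels_killed_iff:
  assumes A: "comm_group A" and B: "comm_group B" and G: "comm_group G"
    and f: "\<And>a b. \<lbrakk>a \<in> carrier A; b \<in> carrier B\<rbrakk> \<Longrightarrow> f a b \<in> carrier G"
  shows "(\<forall>r\<in>tensor_rels A B. free_lift G (\<lambda>(a, b). f a b) r = \<one>\<^bsub>G\<^esub>) \<longleftrightarrow> bilinear_map A B G f"
proof -
  interpret A: comm_group A by fact
  interpret B: comm_group B by fact
  let ?f = "\<lambda>(a, b). f a b"
  have f': "?f \<in> carrier A \<times> carrier B \<rightarrow> carrier G"
    using f by auto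
  have gen: "free_lift G ?f (frag_of (a, b)) = f a b" if "a \<in> carrier A" "b \<in> carrier B" for a b
    using free_lift_frag_of[OF G, of ?f "(a, b)"] f that by simp
  have rel1: "free_lift G ?f (frag_of (a \<otimes>\<^bsub>A\<^esub> a', b) - frag_of (a, b) - frag_of (a', b)) = \<one>\<^bsub>G\<^esub>
      \<longleftrightarrow> f (a \<otimes>\<^bsub>A\<^esub> a') b = f a b \<otimes>\<^bsub>G\<^esub> f a' b"
    if "a \<in> carrier A" "a' \<in> carrier A" "b \<in> carrier B" for a a' b
    using that by (subst free_lift_kills_diff3[OF G f']) (auto simp: gen)
  have rel2: "free_lift G ?f (frag_of (a, b \<otimes>\<^bsub>B\<^esub> b') - frag_of (a, b) - frag_of (a, b')) = \<one>\<^bsub>G\<^esub>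
      \<longleftrightarrow> f a (b \<otimes>\<^bsub>B\<^esub> b') = f a b \<otimes>\<^bsub>G\<^esub> f a b'"
    if "a \<in> carrier A" "b \<in> carrier B" "b' \<in> carrier B" for a b b'
    using that by (subst free_lift_kills_diff3[OF G f']) (auto simp: gen)
  have "bilinear_map A B G f \<longleftrightarrow>
      (\<forall>a\<in>carrier A. \<forall>a'\<in>carrier A. \<forall>b\<in>carrier B. f (a \<otimes>\<^bsub>A\<^esub> a') b = f a b \<otimes>\<^bsub>G\<^esub> f a' b) \<and>
      (\<forall>a\<in>carrier A. \<forall>b\<in>carrier B. \<forall>b'\<in>carrier B. f a (b \<otimes>\<^bsub>B\<^esub> b') = f a b \<otimes>\<^bsub>G\<^esub> f a b')"
    using f by (auto simp: bilinear_map_def hom_def Pi_iff)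
  also have "\<dots> \<longleftrightarrow> (\<forall>r\<in>tensor_rels A B. free_lift G ?f r = \<one>\<^bsub>G\<^esub>)"
    unfolding tensor_rels_def ball_Un
    by (intro arg_cong2[where f = conj]) (use rel1 rel2 in \<open>blast\<close>)+
  finally show ?thesis ..
qed

lemma tensor_comm_group:
  assumes "comm_group A" "comm_group B"
  shows "comm_group (tensor A B)"
  unfolding tensor_def by (rule presented_comm_group[OF tensor_rels_subset[OF assms]])

lemma tensor_elem_closed:
  assumes "comm_group A" "comm_group B" "a \<in> carrier A" "b \<in> carrier B"
  shows "tensor_elem A B a b \<in> carrier (tensor A B)"
  unfolding tensor_def tensor_elem_def
  by (rule presented_gen_closed[OF tensor_rels_subset[OF assms(1,2)]]) (use assms(3,4) in auto)

lemma bilinear_tensor_elem: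
  assumes "comm_group A" "comm_group B"
  shows "bilinear_map A B (tensor A B) (tensor_elem A B)"
proof -
  have eq: "(\<lambda>(a, b). tensor_elem A B a b) = presented_gen (carrier A \<times> carrier B) (tensor_rels A B)"
    by (auto simp: tensor_elem_def)
  show ?thesis
    using presented_gen_kills[OF tensor_rels_subset[OF assms]]
    by (subst tensor_rels_killed_iff[symmetric])
      (auto simp: assms tensor_comm_group tensor_elem_closed eq simp flip: tensor_def)
qed

lemma tensor_lift:
  assumes "comm_group A" "comm_group B" "comm_group G" and f: "bilinear_map A B G f"
  shows tensor_lift_hom: "tensor_lift G f \<in> hom (tensor A B) G"
    and tensor_lift_elem: "\<lbrakk>a \<in> carrier A; b \<in> carrier B\<rbrakk> \<Longrightarrow> tensor_lift G f (tensor_elem A B a b) = f a b"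
proof -
  have fc: "f a b \<in> carrier G" if "a \<in> carrier A" "b \<in> carrier B" for a b
    using f that by (auto simp: bilinear_map_def hom_def)
  then have f': "(\<lambda>(a, b). f a b) \<in> carrier A \<times> carrier B \<rightarrow> carrier G"
    by auto
  have kill: "free_lift G (\<lambda>(a, b). f a b) r = \<one>\<^bsub>G\<^esub>" if "r \<in> tensor_rels A B" for r
    using tensor_rels_killed_iff[where f = f, OF assms(1-3) fc] f that by blast
  show "tensor_lift G f \<in> hom (tensor A B) G"
    unfolding tensor_lift_def tensor_def
    by (rule presented_lift_hom[OF assms(3) f' tensor_rels_subset[OF assms(1,2)] kill])
  show "tensor_lift G f (tensor_elem A B a b) = f a b" if "a \<in> carrier A" "b \<in> carrier B"
    using presented_lift_gen[OF assms(3) f' tensor_rels_subset[OF assms(1,2)] kill, of "(a, b)"] that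
    by (simp add: tensor_lift_def tensor_elem_def)
qed


section \<open>Whitehead's quadratic functor\<close>

definition quadratic_map ::
    "('a, 'm) monoid_scheme \<Rightarrow> ('b, 'n) monoid_scheme \<Rightarrow> ('a \<Rightarrow> 'b) \<Rightarrow> bool"
  where "quadratic_map A B \<psi> \<longleftrightarrow>
    \<psi> \<in> carrier A \<rightarrow> carrier B \<and>
    (\<forall>a\<in>carrier A. \<psi> a = \<psi> (inv\<^bsub>A\<^esub> a)) \<and>
    bilinear_map A A B (\<lambda>a b. \<psi> (a \<otimes>\<^bsub>A\<^esub> b) \<otimes>\<^bsub>B\<^esub> inv\<^bsub>B\<^esub> \<psi> a \<otimes>\<^bsub>B\<^esub> inv\<^bsub>B\<^esub> \<psi> b)"

definition polarization :: "('a, 'm) monoid_scheme \<Rightarrow> 'a \<Rightarrow> 'a \<Rightarrow> 'a \<Rightarrow>\<^sub>0 int"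
  where "polarization A a b = frag_of (a \<otimes>\<^bsub>A\<^esub> b) - frag_of a - frag_of b"

definition Gamma_rels :: "('a, 'm) monoid_scheme \<Rightarrow> ('a \<Rightarrow>\<^sub>0 int) set"
  where "Gamma_rels A =
    {frag_of a - frag_of (inv\<^bsub>A\<^esub> a) | a. a \<in> carrier A} \<union>
    {polarization A (a \<otimes>\<^bsub>A\<^esub> a') b - polarization A a b - polarization A a' b | a a' b.
       a \<in> carrier A \<and> a' \<in> carrier A \<and> b \<in> carrier A} \<union>
    {polarization A a (b \<otimes>\<^bsub>A\<^esub> b') - polarization A a b - polarization A a b' | a b b'.
       a \<in> carrier A \<and> b \<in> carrier A \<and> b' \<in> carrier A}"

text \<open>
  \<open>Gamma A\<close> with \<open>gamma A\<close> is the standard construction of the universal quadratic map; its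
  universal property is \<open>quadratic_map_gamma\<close> and \<open>Gamma_universal\<close> below.
\<close>

definition Gamma :: "('a, 'm) monoid_scheme \<Rightarrow> ('a \<Rightarrow>\<^sub>0 int) set monoid"
  where "Gamma A = presented (carrier A) (Gamma_rels A)"

definition gamma :: "('a, 'm) monoid_scheme \<Rightarrow> 'a \<Rightarrow> ('a \<Rightarrow>\<^sub>0 int) set"
  where "gamma A a = presented_gen (carrier A) (Gamma_rels A) a"

definition Psi :: "('a, 'm) monoid_scheme \<Rightarrow> ('a \<Rightarrow>\<^sub>0 int) set \<Rightarrow> ('a \<times> 'a \<Rightarrow>\<^sub>0 int) set"
  where "Psi A = presented_lift (tensor A A) (\<lambda>a. tensor_elem A A a a)"


lemma keys_polarization:
  assumes "comm_group A" "a \<in> carrier A" "b \<in> carrier A"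
  shows "Poly_Mapping.keys (polarization A a b) \<subseteq> carrier A"
proof -
  interpret A: comm_group A by fact
  show ?thesis
    using assms(2,3) by (auto simp: polarization_def dest!: subsetD[OF keys_diff])
qed

lemma Gamma_rels_subset:
  assumes "comm_group A"
  shows "Gamma_rels A \<subseteq> carrier (free_Abelian_group (carrier A))"
proof -
  interpret A: comm_group A by fact
  have diff: "Poly_Mapping.keys (x - y) \<subseteq> S" if "Poly_Mapping.keys x \<subseteq> S" "Poly_Mapping.keys y \<subseteq> S"
    for x y :: "'a \<Rightarrow>\<^sub>0 int" and S
    using that keys_diff[of x y] by blast
  show ?thesis
  proof
    fix r assume "r \<in> Gamma_rels A"
    then have "Poly_Mapping.keys r \<subseteq> carrier A"
      unfolding Gamma_rels_def
      by (elim UnE CollectE exE conjE; hypsubst) (intro diff keys_polarization[OF assms]; simp)+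
    then show "r \<in> carrier (free_Abelian_group (carrier A))"
      by simp
  qed
qed

lemma Gamma_rels_killed_iff:
  assumes A: "comm_group A" and G: "comm_group G" and f: "f \<in> carrier A \<rightarrow> carrier G"
  shows "(\<forall>r\<in>Gamma_rels A. free_lift G f r = \<one>\<^bsub>G\<^esub>) \<longleftrightarrow> quadratic_map A G f"
proof -
  interpret A: comm_group A by fact
  interpret G: comm_group G by fact
  define p where "p = (\<lambda>a b. f (a \<otimes>\<^bsub>A\<^esub> b) \<otimes>\<^bsub>G\<^esub> inv\<^bsub>G\<^esub> f a \<otimes>\<^bsub>G\<^esub> inv\<^bsub>G\<^esub> f b)"
  have fc: "f a \<in> carrier G" if "a \<in> carrier A" for a
    using f that by auto
  have gen: "free_lift G f (frag_of a) = f a" if "a \<in> carrier A" for a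
    using free_lift_frag_of[OF G, of f a] fc that by simp
  have pol: "free_lift G f (polarization A a b) = p a b" if "a \<in> carrier A" "b \<in> carrier A" for a b
    unfolding polarization_def p_def using that by (subst free_lift_diff3[OF G f]) (auto simp: gen)
  have rel0: "free_lift G f (frag_of a - frag_of (inv\<^bsub>A\<^esub> a)) = \<one>\<^bsub>G\<^esub> \<longleftrightarrow> f a = f (inv\<^bsub>A\<^esub> a)"
    if "a \<in> carrier A" for a
  proof -
    have "free_lift G f (frag_of a - frag_of (inv\<^bsub>A\<^esub> a)) = f a \<otimes>\<^bsub>G\<^esub> inv\<^bsub>G\<^esub> f (inv\<^bsub>A\<^esub> a)"
      using that by (subst free_lift_diff[OF G f]) (auto simp: gen)
    also have "\<dots> = f a \<otimes>\<^bsub>G\<^esub> inv\<^bsub>G\<^esub> f (inv\<^bsub>A\<^esub> a) \<otimes>\<^bsub>G\<^esub> inv\<^bsub>G\<^esub> \<one>\<^bsub>G\<^esub>"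
      using that by (simp add: fc)
    finally show ?thesis
      using comm_group_diff_eq_iff[OF G, of "f a" "f (inv\<^bsub>A\<^esub> a)" "\<one>\<^bsub>G\<^esub>"] that by (simp add: fc)
  qed
  have rel1: "free_lift G f (polarization A (a \<otimes>\<^bsub>A\<^esub> a') b - polarization A a b - polarization A a' b)
      = \<one>\<^bsub>G\<^esub> \<longleftrightarrow> p (a \<otimes>\<^bsub>A\<^esub> a') b = p a b \<otimes>\<^bsub>G\<^esub> p a' b"
    if "a \<in> carrier A" "a' \<in> carrier A" "b \<in> carrier A" for a a' b
    using that by (subst free_lift_kills_diff3[OF G f]) (simp_all add: pol keys_polarization[OF A])
  have rel2: "free_lift G f (polarization A a (b \<otimes>\<^bsub>A\<^esub> b') - polarization A a b - polarization A a b')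
      = \<one>\<^bsub>G\<^esub> \<longleftrightarrow> p a (b \<otimes>\<^bsub>A\<^esub> b') = p a b \<otimes>\<^bsub>G\<^esub> p a b'"
    if "a \<in> carrier A" "b \<in> carrier A" "b' \<in> carrier A" for a b b'
    using that by (subst free_lift_kills_diff3[OF G f]) (simp_all add: pol keys_polarization[OF A])
  have "bilinear_map A A G p \<longleftrightarrow>
      (\<forall>a\<in>carrier A. \<forall>a'\<in>carrier A. \<forall>b\<in>carrier A. p (a \<otimes>\<^bsub>A\<^esub> a') b = p a b \<otimes>\<^bsub>G\<^esub> p a' b) \<and>
      (\<forall>a\<in>carrier A. \<forall>b\<in>carrier A. \<forall>b'\<in>carrier A. p a (b \<otimes>\<^bsub>A\<^esub> b') = p a b \<otimes>\<^bsub>G\<^esub> p a b')"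
    using fc by (auto simp: bilinear_map_def hom_def Pi_iff p_def)
  then have "quadratic_map A G f \<longleftrightarrow>
      ((\<forall>a\<in>carrier A. f a = f (inv\<^bsub>A\<^esub> a)) \<and>
       (\<forall>a\<in>carrier A. \<forall>a'\<in>carrier A. \<forall>b\<in>carrier A. p (a \<otimes>\<^bsub>A\<^esub> a') b = p a b \<otimes>\<^bsub>G\<^esub> p a' b)) \<and>
      (\<forall>a\<in>carrier A. \<forall>b\<in>carrier A. \<forall>b'\<in>carrier A. p a (b \<otimes>\<^bsub>A\<^esub> b') = p a b \<otimes>\<^bsub>G\<^esub> p a b')"
    using f unfolding quadratic_map_def p_def[symmetric] by blast
  also have "\<dots> \<longleftrightarrow> (\<forall>r\<in>Gamma_rels A. free_lift G f r = \<one>\<^bsub>G\<^esub>)"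
  proof -
    have split: "(\<forall>r\<in>Gamma_rels A. L r) \<longleftrightarrow>
        ((\<forall>a\<in>carrier A. L (frag_of a - frag_of (inv\<^bsub>A\<^esub> a))) \<and>
         (\<forall>a\<in>carrier A. \<forall>a'\<in>carrier A. \<forall>b\<in>carrier A.
           L (polarization A (a \<otimes>\<^bsub>A\<^esub> a') b - polarization A a b - polarization A a' b))) \<and>
        (\<forall>a\<in>carrier A. \<forall>b\<in>carrier A. \<forall>b'\<in>carrier A.
          L (polarization A a (b \<otimes>\<^bsub>A\<^esub> b') - polarization A a b - polarization A a b'))" for L
      unfolding Gamma_rels_def ball_Un by (intro arg_cong2[where f = conj]) blast+
    show ?thesis
      unfolding split by (intro arg_cong2[where f = conj] ball_cong refl) (simp_all only: rel0 rel1 rel2)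
  qed
  finally show ?thesis ..
qed

lemma Gamma_comm_group:
  assumes "comm_group A"
  shows "comm_group (Gamma A)"
  unfolding Gamma_def by (rule presented_comm_group[OF Gamma_rels_subset[OF assms]])

lemma gamma_closed:
  assumes "comm_group A" "a \<in> carrier A"
  shows "gamma A a \<in> carrier (Gamma A)"
  unfolding Gamma_def gamma_def by (rule presented_gen_closed[OF Gamma_rels_subset[OF assms(1)] assms(2)])

lemma quadratic_map_gamma:
  assumes "comm_group A"
  shows "quadratic_map A (Gamma A) (gamma A)"
proof -
  have "gamma A = presented_gen (carrier A) (Gamma_rels A)"
    by (auto simp: gamma_def)
  then show ?thesis
    using presented_gen_kills[OF Gamma_rels_subset[OF assms]] gamma_closed[OF assms]
    by (subst Gamma_rels_killed_iff[symmetric])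
      (auto simp: assms Gamma_comm_group simp flip: Gamma_def)
qed

lemma quadratic_lift:
  assumes A: "comm_group A" and G: "comm_group G" and q: "quadratic_map A G \<psi>"
  shows quadratic_lift_hom: "presented_lift G \<psi> \<in> hom (Gamma A) G"
    and quadratic_lift_gamma: "a \<in> carrier A \<Longrightarrow> presented_lift G \<psi> (gamma A a) = \<psi> a"
proof -
  have f: "\<psi> \<in> carrier A \<rightarrow> carrier G"
    using q by (simp add: quadratic_map_def)
  have kill: "free_lift G \<psi> r = \<one>\<^bsub>G\<^esub>" if "r \<in> Gamma_rels A" for r
    using Gamma_rels_killed_iff[OF A G f] q that by blast
  show "presented_lift G \<psi> \<in> hom (Gamma A) G"
    unfolding Gamma_def by (rule presented_lift_hom[OF G f Gamma_rels_subset[OF A] kill])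
  show "presented_lift G \<psi> (gamma A a) = \<psi> a" if "a \<in> carrier A"
    unfolding gamma_def by (rule presented_lift_gen[OF G f Gamma_rels_subset[OF A] kill that])
qed

lemma Gamma_universal:
  assumes A: "comm_group A" and G: "comm_group G" and q: "quadratic_map A G \<psi>"
  shows "\<exists>!h. h \<in> hom (Gamma A) G \<and> h \<in> extensional (carrier (Gamma A)) \<and>
    (\<forall>a\<in>carrier A. h (gamma A a) = \<psi> a)"
proof (rule ex1I)
  interpret Gam: comm_group "Gamma A" by (rule Gamma_comm_group[OF A])
  let ?h = "restrict (presented_lift G \<psi>) (carrier (Gamma A))"
  show h: "?h \<in> hom (Gamma A) G \<and> ?h \<in> extensional (carrier (Gamma A)) \<and>
      (\<forall>a\<in>carrier A. ?h (gamma A a) = \<psi> a)"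
    using quadratic_lift_hom[OF A G q] quadratic_lift_gamma[OF A G q] gamma_closed[OF A]
    by (auto simp: hom_def Pi_iff)
  fix k assume k: "k \<in> hom (Gamma A) G \<and> k \<in> extensional (carrier (Gamma A)) \<and>
      (\<forall>a\<in>carrier A. k (gamma A a) = \<psi> a)"
  show "k = ?h"
  proof (rule extensionalityI[of _ "carrier (Gamma A)"])
    fix X assume "X \<in> carrier (Gamma A)"
    then have X: "X \<in> carrier (presented (carrier A) (Gamma_rels A))"
      by (simp add: Gamma_def)
    have hk: "k \<in> hom (presented (carrier A) (Gamma_rels A)) G"
      "?h \<in> hom (presented (carrier A) (Gamma_rels A)) G"
      using h k by (simp_all add: Gamma_def)
    have "k (presented_gen (carrier A) (Gamma_rels A) a) = ?h (presented_gen (carrier A) (Gamma_rels A) a)"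
      if "a \<in> carrier A" for a
      using h k that unfolding gamma_def[symmetric] by metis
    then show "k X = ?h X"
      by (rule presented_hom_eqI[OF G Gamma_rels_subset[OF A] hk _ X])
  qed (use k in auto)
qed

lemma quadratic_map_diagonal:
  assumes A: "comm_group A"
  shows "quadratic_map A (tensor A A) (\<lambda>a. tensor_elem A A a a)"
proof -
  interpret A: comm_group A by fact
  interpret T: comm_group "tensor A A" by (rule tensor_comm_group[OF A A])
  let ?t = "tensor_elem A A"
  let ?s = "\<lambda>a b. ?t (a \<otimes>\<^bsub>A\<^esub> b) (a \<otimes>\<^bsub>A\<^esub> b) \<otimes>\<^bsub>tensor A A\<^esub> inv\<^bsub>tensor A A\<^esub> ?t a a
    \<otimes>\<^bsub>tensor A A\<^esub> inv\<^bsub>tensor A A\<^esub> ?t b b"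
  note closed = tensor_elem_closed[OF A A]
  have l: "?t (a \<otimes>\<^bsub>A\<^esub> b) c = ?t a c \<otimes>\<^bsub>tensor A A\<^esub> ?t b c"
    and r: "?t c (a \<otimes>\<^bsub>A\<^esub> b) = ?t c a \<otimes>\<^bsub>tensor A A\<^esub> ?t c b"
    if "a \<in> carrier A" "b \<in> carrier A" "c \<in> carrier A" for a b c
    using bilinear_tensor_elem[OF A A] that by (auto simp: bilinear_map_def hom_def)
  have hl: "group_hom A (tensor A A) (\<lambda>a. ?t a c)" and hr: "group_hom A (tensor A A) (?t c)"
    if "c \<in> carrier A" for c
    using bilinear_tensor_elem[OF A A] that
    by (auto simp: bilinear_map_def group_hom_def group_hom_axioms_def)
  have inv: "?t (inv\<^bsub>A\<^esub> a) (inv\<^bsub>A\<^esub> a) = ?t a a" if "a \<in> carrier A" for a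
    using group_hom.hom_inv[OF hl] group_hom.hom_inv[OF hr] that by (simp add: closed)
  have pol: "?t (a \<otimes>\<^bsub>A\<^esub> b) (a \<otimes>\<^bsub>A\<^esub> b) \<otimes>\<^bsub>tensor A A\<^esub> inv\<^bsub>tensor A A\<^esub> ?t a a
      \<otimes>\<^bsub>tensor A A\<^esub> inv\<^bsub>tensor A A\<^esub> ?t b b = ?t a b \<otimes>\<^bsub>tensor A A\<^esub> ?t b a"
    if "a \<in> carrier A" "b \<in> carrier A" for a b
  proof -
    note c = closed[OF that(1) that(1)] closed[OF that(1) that(2)]
      closed[OF that(2) that(1)] closed[OF that(2) that(2)]
    have 1: "?t (a \<otimes>\<^bsub>A\<^esub> b) (a \<otimes>\<^bsub>A\<^esub> b) =
        ?t a b \<otimes>\<^bsub>tensor A A\<^esub> ?t b a \<otimes>\<^bsub>tensor A A\<^esub> (?t a a \<otimes>\<^bsub>tensor A A\<^esub> ?t b b)"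
      using that c by (simp add: l r T.m_ac)
    have cancel: "x \<otimes>\<^bsub>tensor A A\<^esub> (y \<otimes>\<^bsub>tensor A A\<^esub> z) \<otimes>\<^bsub>tensor A A\<^esub> inv\<^bsub>tensor A A\<^esub> y
        \<otimes>\<^bsub>tensor A A\<^esub> inv\<^bsub>tensor A A\<^esub> z = x"
      if "x \<in> carrier (tensor A A)" "y \<in> carrier (tensor A A)" "z \<in> carrier (tensor A A)" for x y z
    proof -
      have "x \<otimes>\<^bsub>tensor A A\<^esub> (y \<otimes>\<^bsub>tensor A A\<^esub> z) = x \<otimes>\<^bsub>tensor A A\<^esub> z \<otimes>\<^bsub>tensor A A\<^esub> y"
        using that by (simp add: T.m_ac)
      then show ?thesis
        using that by (simp add: T.m_assoc)
    qed
    show ?thesis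
      unfolding 1 by (rule cancel) (use c in simp_all)
  qed
  show ?thesis
    unfolding quadratic_map_def bilinear_map_def
  proof (intro conjI ballI homI)
    fix a b b' assume abb: "a \<in> carrier A" "b \<in> carrier A" "b' \<in> carrier A"
    then have bb: "b \<otimes>\<^bsub>A\<^esub> b' \<in> carrier A"
      by simp
    note c = closed[OF abb(1,2)] closed[OF abb(1,3)] closed[OF abb(2,1)] closed[OF abb(3,1)]
    show "?s a (b \<otimes>\<^bsub>A\<^esub> b') = ?s a b \<otimes>\<^bsub>tensor A A\<^esub> ?s a b'"
      unfolding pol[OF abb(1) bb] pol[OF abb(1,2)] pol[OF abb(1,3)] r[OF abb(2,3,1)] l[OF abb(2,3,1)]
      using c by (simp add: T.m_ac)
    show "?s (b \<otimes>\<^bsub>A\<^esub> b') a = ?s b a \<otimes>\<^bsub>tensor A A\<^esub> ?s b' a"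
      unfolding pol[OF bb abb(1)] pol[OF abb(2,1)] pol[OF abb(3,1)] r[OF abb(2,3,1)] l[OF abb(2,3,1)]
      using c by (simp add: T.m_ac)
  qed (simp_all add: closed inv)
qed

lemma Psi_hom: "comm_group A \<Longrightarrow> Psi A \<in> hom (Gamma A) (tensor A A)"
  unfolding Psi_def by (intro quadratic_lift_hom tensor_comm_group quadratic_map_diagonal)

lemma Psi_gamma:
  "\<lbrakk>comm_group A; a \<in> carrier A\<rbrakk> \<Longrightarrow> Psi A (gamma A a) = tensor_elem A A a a"
  unfolding Psi_def by (intro quadratic_lift_gamma tensor_comm_group quadratic_map_diagonal)


section \<open>Tor\<close>

text \<open>
  \<open>Tor\<^sub>1(A, B)\<close> is the first left derived functor of \<open>- \<otimes> B\<close> at \<open>A\<close>, computed with the standard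
  free resolution \<open>0 \<rightarrow> R \<rightarrow> F \<rightarrow> A \<rightarrow> 0\<close>, where \<open>F\<close> is the free abelian group on the set \<open>A\<close>:
  it is the kernel of \<open>R \<otimes> B \<rightarrow> F \<otimes> B\<close>.
\<close>

definition res_F :: "('a, 'm) monoid_scheme \<Rightarrow> ('a \<Rightarrow>\<^sub>0 int) monoid"
  where "res_F A = free_Abelian_group (carrier A)"

definition res_R :: "('a, 'm) monoid_scheme \<Rightarrow> ('a \<Rightarrow>\<^sub>0 int) monoid"
  where "res_R A = (res_F A)\<lparr>carrier := kernel (res_F A) A (free_lift A (\<lambda>a. a))\<rparr>"

definition Tor1_map ::
    "('a, 'm) monoid_scheme \<Rightarrow> ('b, 'n) monoid_scheme \<Rightarrow>
     (('a \<Rightarrow>\<^sub>0 int) \<times> 'b \<Rightarrow>\<^sub>0 int) set \<Rightarrow> (('a \<Rightarrow>\<^sub>0 int) \<times> 'b \<Rightarrow>\<^sub>0 int) set"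
  where "Tor1_map A B = tensor_lift (tensor (res_F A) B) (tensor_elem (res_F A) B)"

definition Tor1 ::
    "('a, 'm) monoid_scheme \<Rightarrow> ('b, 'n) monoid_scheme \<Rightarrow> (('a \<Rightarrow>\<^sub>0 int) \<times> 'b \<Rightarrow>\<^sub>0 int) set monoid"
  where "Tor1 A B =
    (tensor (res_R A) B)\<lparr>carrier := kernel (tensor (res_R A) B) (tensor (res_F A) B) (Tor1_map A B)\<rparr>"

definition n_torsion :: "('a, 'm) monoid_scheme \<Rightarrow> nat \<Rightarrow> 'a set"
  where "n_torsion A n = {a \<in> carrier A. a [^]\<^bsub>A\<^esub> n = \<one>\<^bsub>A\<^esub>}"

text \<open>
  For \<open>a\<close> and \<open>b\<close> killed by \<open>n\<close>: lift \<open>a\<close> to the basis element \<open>[a]\<close> of \<open>F\<close>; then \<open>n [a]\<close> lies in \<open>R\<close>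
  and \<open>n [a] \<otimes> b\<close> becomes \<open>[a] \<otimes> n b = 0\<close> in \<open>F \<otimes> B\<close>. Another choice of the lift changes \<open>n [a]\<close> by
  an element of \<open>n R\<close>, hence does not change \<open>n [a] \<otimes> b\<close>.
\<close>

definition tau ::
    "('a, 'm) monoid_scheme \<Rightarrow> ('b, 'n) monoid_scheme \<Rightarrow> nat \<Rightarrow> 'a \<Rightarrow> 'b \<Rightarrow>
     (('a \<Rightarrow>\<^sub>0 int) \<times> 'b \<Rightarrow>\<^sub>0 int) set"
  where "tau A B n a b = tensor_elem (res_R A) B (frag_cmul (int n) (frag_of a)) b"

lemma res_F_comm_group: "comm_group (res_F A)"
  by (simp add: res_F_def abelian_free_Abelian_group)

lemma res_proj_hom:
  assumes "comm_group A"
  shows "free_lift A (\<lambda>a. a) \<in> hom (res_F A) A"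
  unfolding res_F_def by (rule free_lift_hom[OF assms]) auto

lemma res_R_comm_group:
  assumes "comm_group A"
  shows "comm_group (res_R A)"
proof -
  interpret A: comm_group A by fact
  interpret F: comm_group "res_F A" by (rule res_F_comm_group)
  interpret group_hom "res_F A" A "free_lift A (\<lambda>a. a)"
    by (intro group_hom.intro group_hom_axioms.intro res_proj_hom assms) unfold_locales
  show ?thesis
    unfolding res_R_def
    by (rule group.group_comm_groupI[OF F.subgroup_imp_group[OF subgroup_kernel]])
      (auto simp: kernel_def F.m_comm)
qed

lemma bilinear_res:
  assumes "comm_group A" "comm_group B"
  shows "bilinear_map (res_R A) B (tensor (res_F A) B) (tensor_elem (res_F A) B)"
  using bilinear_tensor_elem[OF res_F_comm_group[of A] assms(2)]
  by (auto simp: bilinear_map_def res_R_def hom_def kernel_def)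

lemma tau_in_Tor1:
  assumes A: "comm_group A" and B: "comm_group B"
    and a: "a \<in> n_torsion A n" and b: "b \<in> n_torsion B n"
  shows "tau A B n a b \<in> carrier (Tor1 A B)"
proof -
  interpret A: comm_group A by fact
  interpret B: comm_group B by fact
  let ?F = "res_F A" and ?T = "tensor (res_F A) B"
  have F: "comm_group ?F" by (rule res_F_comm_group)
  interpret T: comm_group ?T by (rule tensor_comm_group[OF F B])
  interpret FF: comm_group ?F by (rule F)
  note lift = res_proj_hom[OF A]
  interpret p: group_hom ?F A "free_lift A (\<lambda>a. a)"
    by (intro group_hom.intro group_hom_axioms.intro lift) unfold_locales
  have a': "a \<in> carrier A" "a [^]\<^bsub>A\<^esub> n = \<one>\<^bsub>A\<^esub>" and b': "b \<in> carrier B" "b [^]\<^bsub>B\<^esub> n = \<one>\<^bsub>B\<^esub>"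
    using a b by (auto simp: n_torsion_def)
  have x: "frag_of a \<in> carrier ?F"
    using a' by (simp add: res_F_def)
  have na: "frag_cmul (int n) (frag_of a) = frag_of a [^]\<^bsub>?F\<^esub> n"
    by (simp add: res_F_def)
  have R: "frag_of a [^]\<^bsub>?F\<^esub> n \<in> carrier (res_R A)"
    unfolding res_R_def kernel_def
    using x p.hom_nat_pow[OF x, of n] free_lift_frag_of[OF A, of "\<lambda>a. a" a] a' by simp
  have hl: "group_hom ?F ?T (\<lambda>x. tensor_elem ?F B x b)" and hr: "group_hom B ?T (tensor_elem ?F B (frag_of a))"
    using bilinear_tensor_elem[OF F B] b'(1) x
    by (auto simp: bilinear_map_def group_hom_def group_hom_axioms_def)
  have "Tor1_map A B (tau A B n a b) = tensor_elem ?F B (frag_of a [^]\<^bsub>?F\<^esub> n) b"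
    unfolding Tor1_map_def tau_def na
    by (rule tensor_lift_elem[OF res_R_comm_group[OF A] B T.comm_group_axioms bilinear_res[OF A B] R b'(1)])
  also have "\<dots> = tensor_elem ?F B (frag_of a) (b [^]\<^bsub>B\<^esub> n)"
    using group_hom.hom_nat_pow[OF hl x, of n] group_hom.hom_nat_pow[OF hr b'(1), of n] by simp
  also have "\<dots> = \<one>\<^bsub>?T\<^esub>"
    using group_hom.hom_one[OF hr] b'(2) by simp
  finally show ?thesis
    using tensor_elem_closed[OF res_R_comm_group[OF A] B R b'(1)]
    by (simp add: Tor1_def kernel_def tau_def na)
qed

text \<open>
  The involution \<open>\<sigma>\<^sup>\<epsilon>\<close>. Membership in \<^const>\<open>extensional\<close> fixes its values outside the carrier, so
  that it is a unique HOL function.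
\<close>

definition sigma_eps ::
    "('b, 'n) monoid_scheme \<Rightarrow> (('b \<Rightarrow>\<^sub>0 int) \<times> 'b \<Rightarrow>\<^sub>0 int) set \<Rightarrow> (('b \<Rightarrow>\<^sub>0 int) \<times> 'b \<Rightarrow>\<^sub>0 int) set"
  where "sigma_eps B = (THE \<sigma>.
    \<sigma> \<in> hom (Tor1 B B) (Tor1 B B) \<and> \<sigma> \<in> extensional (carrier (Tor1 B B)) \<and>
    (\<forall>n\<ge>1. \<forall>a\<in>n_torsion B n. \<forall>b\<in>n_torsion B n. \<sigma> (tau B B n a b) = tau B B n b a))"

text \<open>The action of \<^term>\<open>sym_group 2\<close> on \<^term>\<open>Tor1 B B\<close> by \<open>\<sigma>\<^sup>\<epsilon>\<close>.\<close>

definition Sigma2_eps ::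
    "('b, 'n) monoid_scheme \<Rightarrow> (nat \<Rightarrow> nat) \<Rightarrow>
     (('b \<Rightarrow>\<^sub>0 int) \<times> 'b \<Rightarrow>\<^sub>0 int) set \<Rightarrow> (('b \<Rightarrow>\<^sub>0 int) \<times> 'b \<Rightarrow>\<^sub>0 int) set"
  where "Sigma2_eps B p = (if p = id then (\<lambda>x. x) else sigma_eps B)"


section \<open>Group homology\<close>

text \<open>
  The (inhomogeneous) bar complex of a group \<open>G\<close> with coefficients in an abelian group \<open>M\<close> with left
  action \<open>act\<close> of \<open>G\<close>. The \<open>n\<close>-chains are the finitely supported functions from \<open>G\<^sup>n\<close> to \<open>M\<close>, the
  function with the single value \<open>m\<close> at \<open>[g\<^sub>1, \<dots>, g\<^sub>n]\<close> being \<open>[g\<^sub>1|\<dots>|g\<^sub>n] \<otimes> m\<close>, and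
  \<open>d([g\<^sub>1|\<dots>|g\<^sub>n] \<otimes> m) = [g\<^sub>2|\<dots>|g\<^sub>n] \<otimes> g\<^sub>1\<^sup>-\<^sup>1 m
     + (\<Sum>0<i<n. (-1)\<^sup>i [g\<^sub>1|\<dots>|g\<^sub>i g\<^sub>i\<^sub>+\<^sub>1|\<dots>|g\<^sub>n] \<otimes> m) + (-1)\<^sup>n [g\<^sub>1|\<dots>|g\<^sub>n\<^sub>-\<^sub>1] \<otimes> m\<close>.
\<close>

definition bar_basis :: "('g, 'l) monoid_scheme \<Rightarrow> nat \<Rightarrow> 'g list set"
  where "bar_basis G n = {gs. length gs = n \<and> set gs \<subseteq> carrier G}"

definition bar_chain ::
    "('g, 'l) monoid_scheme \<Rightarrow> ('m, 'k) monoid_scheme \<Rightarrow> nat \<Rightarrow> ('g list \<Rightarrow> 'm) monoid"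
  where "bar_chain G M n = sum_group (bar_basis G n) (\<lambda>_. M)"

definition bar_single ::
    "('g, 'l) monoid_scheme \<Rightarrow> ('m, 'k) monoid_scheme \<Rightarrow> 'g list \<Rightarrow> 'm \<Rightarrow> 'g list \<Rightarrow> 'm"
  where "bar_single G M gs m =
           (\<lambda>hs\<in>bar_basis G (length gs). if hs = gs then m else \<one>\<^bsub>M\<^esub>)"

definition bar_face ::
    "('g, 'l) monoid_scheme \<Rightarrow> ('m, 'k) monoid_scheme \<Rightarrow> ('g \<Rightarrow> 'm \<Rightarrow> 'm) \<Rightarrow> nat \<Rightarrow>
     'g list \<Rightarrow> 'm \<Rightarrow> 'g list \<Rightarrow> 'm"
  where "bar_face G M act i gs m =
    (if i = 0 then bar_single G M (tl gs) (act (inv\<^bsub>G\<^esub> (hd gs)) m)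
     else if i < length gs
       then bar_single G M (take (i - 1) gs @ [gs ! (i - 1) \<otimes>\<^bsub>G\<^esub> gs ! i] @ drop (i + 1) gs) m
     else bar_single G M (butlast gs) m)"

text \<open>\<open>bar_boundary G M act n\<close> is the differential from \<open>(n+1)\<close>-chains to \<open>n\<close>-chains.\<close>

definition bar_boundary ::
    "('g, 'l) monoid_scheme \<Rightarrow> ('m, 'k) monoid_scheme \<Rightarrow> ('g \<Rightarrow> 'm \<Rightarrow> 'm) \<Rightarrow> nat \<Rightarrow>
     ('g list \<Rightarrow> 'm) \<Rightarrow> ('g list \<Rightarrow> 'm)"
  where "bar_boundary G M act n x =
    (\<Otimes>\<^bsub>bar_chain G M n\<^esub>gs\<in>{gs \<in> bar_basis G (n + 1). x gs \<noteq> \<one>\<^bsub>M\<^esub>}.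
       \<Otimes>\<^bsub>bar_chain G M n\<^esub>i\<in>{0..n + 1}.
         bar_face G M act i gs (x gs) [^]\<^bsub>bar_chain G M n\<^esub> ((- 1) ^ i :: int))"

definition bar_cycles ::
    "('g, 'l) monoid_scheme \<Rightarrow> ('m, 'k) monoid_scheme \<Rightarrow> ('g \<Rightarrow> 'm \<Rightarrow> 'm) \<Rightarrow> nat \<Rightarrow>
     ('g list \<Rightarrow> 'm) monoid"
  where "bar_cycles G M act n =
    (bar_chain G M n)\<lparr>carrier :=
       (case n of 0 \<Rightarrow> carrier (bar_chain G M 0)
        | Suc k \<Rightarrow> kernel (bar_chain G M n) (bar_chain G M k) (bar_boundary G M act k))\<rparr>"

definition bar_boundaries ::
    "('g, 'l) monoid_scheme \<Rightarrow> ('m, 'k) monoid_scheme \<Rightarrow> ('g \<Rightarrow> 'm \<Rightarrow> 'm) \<Rightarrow> nat \<Rightarrow>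
     ('g list \<Rightarrow> 'm) set"
  where "bar_boundaries G M act n = bar_boundary G M act n ` carrier (bar_chain G M (n + 1))"

definition group_homology ::
    "nat \<Rightarrow> ('g, 'l) monoid_scheme \<Rightarrow> ('m, 'k) monoid_scheme \<Rightarrow> ('g \<Rightarrow> 'm \<Rightarrow> 'm) \<Rightarrow>
     ('g list \<Rightarrow> 'm) set monoid"
  where "group_homology n G M act = bar_cycles G M act n Mod bar_boundaries G M act n"

text \<open>Integral homology: coefficients in the integers with trivial action.\<close>

definition integral_homology :: "nat \<Rightarrow> ('g, 'l) monoid_scheme \<Rightarrow> ('g list \<Rightarrow> int) set monoid"
  where "integral_homology n G = group_homology n G integer_group (\<lambda>_ m. m)"

text \<open>
  For an abelian group \<open>A\<close>, the class of the 2-cycle \<open>[a|b] - [b|a]\<close>. It is the image of \<open>a \<and> b\<close> under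
  the standard isomorphism (Pontryagin product) from the exterior square of \<open>A\<close> to \<open>H\<^sub>2(A, \<int>)\<close>.
\<close>

definition wedge_class :: "('a, 'm) monoid_scheme \<Rightarrow> 'a \<Rightarrow> 'a \<Rightarrow> ('a list \<Rightarrow> int) set"
  where "wedge_class A a b =
    bar_boundaries A integer_group (\<lambda>_ m. m) 2
      #>\<^bsub>bar_cycles A integer_group (\<lambda>_ m. m) 2\<^esub>
    (bar_single A integer_group [a, b] 1 \<otimes>\<^bsub>bar_chain A integer_group 2\<^esub>
     inv\<^bsub>bar_chain A integer_group 2\<^esub> bar_single A integer_group [b, a] 1)"

definition tensor_to_H2 :: "('a, 'm) monoid_scheme \<Rightarrow> ('a \<times> 'a \<Rightarrow>\<^sub>0 int) set \<Rightarrow> ('a list \<Rightarrow> int) set"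
  where "tensor_to_H2 A = tensor_lift (integral_homology 2 A) (wedge_class A)"


section \<open>The 2-primary torsion subgroup\<close>

definition two_primary :: "('a, 'm) monoid_scheme \<Rightarrow> ('a, 'm) monoid_scheme"
  where "two_primary A = A\<lparr>carrier := {a \<in> carrier A. \<exists>k::nat. a [^]\<^bsub>A\<^esub> (2 ^ k :: nat) = \<one>\<^bsub>A\<^esub>}\<rparr>"

end

theory Submission
  imports Defs "HOL.Modules"
begin

text \<open>
  Write \<open>A = F/R\<close> with \<open>F\<close> the free abelian group on the set \<open>A\<close>, and let \<open>flip\<close> (or \<open>\<sigma>\<close>) be the interchange map of
  \<open>F \<otimes> F\<close>. Then \<open>A \<otimes> A = (F \<otimes> F)/J\<close> with \<open>J = RF + FR\<close>, and \<open>\<Gamma>(A)\<close> is the group of symmetric elements of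
  \<open>F \<otimes> F\<close> modulo the span \<open>N\<close> of all \<open>r \<otimes> f + f \<otimes> r\<close> and \<open>r \<otimes> r\<close>. So the kernel of \<open>\<Psi>\<close> is \<open>J\<^sup>\<sigma>/N\<close>. With
  \<open>K = RF \<inter> FR\<close> one has \<open>J\<^sup>\<sigma> = K\<^sup>\<sigma> + N\<close>, while \<open>Tor(A, A) = K/RR\<close>, with \<open>\<sigma>\<^sup>\<epsilon>\<close> induced by \<open>flip\<close>; comparing
  the two gives \<open>Tor(A, A)\<^sup>\<sigma>/(1 + \<sigma>) = H\<^sub>1(\<Sigma>\<^sub>2, Tor(A, A))\<close>. On a finitely generated subgroup a stacked
  basis turns \<open>RF\<close>, \<open>FR\<close> and \<open>RR\<close> into divisibility conditions on coefficients, and yields a retraction onto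
  the 2-primary part, which reduces \<open>A\<close> to \<open>\<^sub>2\<^sub>\<infinity>A\<close>.

  For \<open>H\<^sub>2\<close>: modulo boundaries and the classes \<open>[a|b] - [b|a]\<close> the generators \<open>[a|b]\<close> form a symmetric
  cocycle, and the abelian extension it defines shows that every 2-cycle vanishes there. Conversely a
  stacked basis gives, on finitely generated subgroups, a bilinear cocycle \<open>f\<close> with values in the
  exterior square and \<open>f(a, b) - f(b, a) = a \<and> b\<close>, so the wedge classes satisfy no further relation.
\<close>

section \<open>Subgroups of free abelian groups\<close>

text \<open>A stacked basis of \<open>R\<close> in \<open>F\<close> would make \<open>A\<close> a
  direct sum of cyclic groups, so for general \<open>A\<close> there is none, nor need the 2-primary
  part be a direct summand. Both are at hand on finitely generated subgroups only. Hence the maps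
  \<open>mu\<close>, \<open>Lam\<close>, \<open>theta\<close> and \<open>wedge\<close> are defined
  globally, while memberships in \<open>RF\<close>, \<open>FR\<close>, \<open>RR\<close>,
  \<open>N\<close> or \<open>B2\<close>, each of which involves finitely many elements of
  \<open>A\<close>, are tested over a finite \<open>T\<close> with non-canonical coordinates. The
  model case is a cyclic group of order e with generator y. There K/RR is generated by the class of
  e (y \<otimes> y); \<open>flip\<close> fixes it and 1 + \<open>flip\<close> doubles it, so the
  homology is of order 2 for even e and trivial for odd e. In \<Gamma> the relations 2e \<gamma>(y)
  = 0 and e^2 \<gamma>(y) = 0 come from the two kinds of generators of \<open>N\<close>, and e
  \<gamma>(y), which \<Psi> kills, is nonzero exactly for even e. Off the diagonal
  \<open>flip\<close> exchanges summands freely, and these contribute nothing.\<close>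

global_interpretation frag: module "frag_cmul :: int \<Rightarrow> ('a \<Rightarrow>\<^sub>0 int) \<Rightarrow> ('a \<Rightarrow>\<^sub>0 int)"
  by standard (simp_all add: frag_cmul_distrib frag_cmul_distrib2)

text \<open>Scalar multiples by integers are iterated sums and differences, so submodules are just
  subgroups. Spans of the module library therefore serve as generated subgroups throughout.\<close>

lemma frag_subspaceI:
  assumes "0 \<in> V" "\<And>x y. \<lbrakk>x \<in> V; y \<in> V\<rbrakk> \<Longrightarrow> x - y \<in> V"
  shows "frag.subspace V"
proof (rule frag.subspaceI)
  fix x y assume "x \<in> V" "y \<in> V"
  then have "x - (0 - y) \<in> V"
    using assms by blast
  then show "x + y \<in> V"
    by simp
next
  fix c x assume "x \<in> V"
  then show "frag_cmul c x \<in> V"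
    using frag_closure_minus_cmul[of "\<lambda>x. x \<in> V"] assms by blast
qed (rule assms)

lemma frag_span_minimal:
  assumes "z \<in> frag.span X" "frag.subspace V" "\<And>x. x \<in> X \<Longrightarrow> x \<in> V"
  shows "z \<in> V"
  using frag.span_minimal[of X V] assms by auto

lemma frag_span_map:
  assumes z: "z \<in> frag.span X" and f: "\<And>x y. f (x - y) = f x - f y"
    and V: "frag.subspace V" and X: "\<And>x. x \<in> X \<Longrightarrow> f x \<in> V"
  shows "f z \<in> V"
proof -
  have f0: "f 0 = 0"
    using f[of 0 0] by simp
  have "frag.subspace {x. f x \<in> V}"
    using V by (intro frag_subspaceI) (auto simp: f f0 frag.subspace_0 frag.subspace_diff)
  then have "z \<in> {x. f x \<in> V}"
    by (rule frag_span_minimal[OF z]) (use X in auto)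
  then show ?thesis
    by simp
qed

definition frags :: "'a set \<Rightarrow> ('a \<Rightarrow>\<^sub>0 int) set"
  where "frags S = {x. Poly_Mapping.keys x \<subseteq> S}"

lemma carrier_free_eq_frags [simp]: "carrier (free_Abelian_group S) = frags S"
  by (auto simp: frags_def)

lemma subspace_frags [simp, intro]: "frag.subspace (frags S)"
  using keys_diff by (intro frag_subspaceI) (fastforce simp: frags_def)+

lemma frags_closed [simp]:
  "0 \<in> frags S" "\<lbrakk>x \<in> frags S; y \<in> frags S\<rbrakk> \<Longrightarrow> x + y \<in> frags S"
  "\<lbrakk>x \<in> frags S; y \<in> frags S\<rbrakk> \<Longrightarrow> x - y \<in> frags S" "x \<in> frags S \<Longrightarrow> - x \<in> frags S"
  "x \<in> frags S \<Longrightarrow> frag_cmul n x \<in> frags S"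
  using frag.subspace_0[OF subspace_frags] frag.subspace_add[OF subspace_frags]
    frag.subspace_diff[OF subspace_frags] frag.subspace_neg[OF subspace_frags]
    frag.subspace_scale[OF subspace_frags] by auto

lemma frag_of_in_frags [simp]: "frag_of a \<in> frags S \<longleftrightarrow> a \<in> S"
  by (simp add: frags_def)

lemma frags_mono: "S \<subseteq> T \<Longrightarrow> frags S \<subseteq> frags T"
  by (auto simp: frags_def)

lemma frags_lookup: "x \<in> frags S \<Longrightarrow> s \<notin> S \<Longrightarrow> Poly_Mapping.lookup x s = 0"
  by (auto simp: frags_def in_keys_iff)

lemma frags_eq_span: "frags S = frag.span (frag_of ` S)"
proof
  show "frags S \<subseteq> frag.span (frag_of ` S)"
  proof
    fix x assume "x \<in> frags S"
    then have "Poly_Mapping.keys x \<subseteq> S"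
      by (simp add: frags_def)
    then show "x \<in> frag.span (frag_of ` S)"
      by (induction x rule: frag_induction) (auto intro: frag.span_zero frag.span_base frag.span_diff)
  qed
  show "frag.span (frag_of ` S) \<subseteq> frags S"
    by (rule frag.span_minimal) auto
qed

lemma frags_induct [consumes 1, case_names zero of diff]:
  assumes "x \<in> frags S" "P 0" "\<And>a. a \<in> S \<Longrightarrow> P (frag_of a)"
    "\<And>x y. \<lbrakk>x \<in> frags S; y \<in> frags S; P x; P y\<rbrakk> \<Longrightarrow> P (x - y)"
  shows "P x"
  by (rule free_Abelian_group_induct[of x S P]) (use assms in \<open>auto simp: frags_def\<close>)

lemma frag_ext_induct [case_names zero of diff]:
  assumes "P 0" "\<And>a. P (frag_of a)" "\<And>x y. \<lbrakk>P x; P y\<rbrakk> \<Longrightarrow> P (x - y)"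
  shows "P (x :: 'a \<Rightarrow>\<^sub>0 int)"
  by (rule frags_induct[of x UNIV]) (use assms in \<open>auto simp: frags_def\<close>)

lemma frag_extend_in:
  assumes "x \<in> frags S" "frag.subspace V" "\<And>a. a \<in> S \<Longrightarrow> f a \<in> V"
  shows "frag_extend f x \<in> V"
  using assms unfolding frags_eq_span
  by (elim frag_span_map) (auto simp: frag_extend_diff)

lemma frag_extend_cong:
  assumes "x \<in> frags S" "\<And>a. a \<in> S \<Longrightarrow> f a = g a"
  shows "frag_extend f x = frag_extend g x"
  using assms by (intro frag_extend_eq) (auto simp: frags_def)

lemma frag_extend_span:
  "frag_extend f ` frags S = frag.span (f ` S)"
proof
  show "frag_extend f ` frags S \<subseteq> frag.span (f ` S)"
    by (auto elim!: frag_extend_in intro: frag.span_base)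
  show "frag.span (f ` S) \<subseteq> frag_extend f ` frags S"
  proof (rule frag.span_minimal)
    show "f ` S \<subseteq> frag_extend f ` frags S"
      by (auto intro!: image_eqI[where x = "frag_of _"])
    show "frag.subspace (frag_extend f ` frags S)"
      by (intro frag_subspaceI)
        (auto simp: image_iff simp flip: frag_extend_diff
          intro: frag.subspace_diff[OF subspace_frags] bexI[where x = 0] frag.subspace_0[OF subspace_frags])
  qed
qed

lemma frag_extend_frag_of [simp]: "frag_extend frag_of x = x"
  using frag_expansion[of x] by simp

lemma frag_finite_support: "\<exists>T. finite T \<and> T \<subseteq> S \<and> x \<in> frags T" if "x \<in> frags S"
  using that by (intro exI[of _ "Poly_Mapping.keys x"]) (auto simp: frags_def)

text \<open>The spans of \<open>X T\<close> over finite \<open>T\<close> are directed, so their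
  union is a subgroup, and it contains \<open>Y\<close>. This is the passage from arbitrary families
  of generators to finite ones.\<close>

lemma frag_span_directed:
  fixes X :: "'b set \<Rightarrow> ('a \<Rightarrow>\<^sub>0 int) set"
  assumes z: "z \<in> frag.span Y" and Y: "\<And>y. y \<in> Y \<Longrightarrow> \<exists>T. finite T \<and> T \<subseteq> S \<and> y \<in> X T"
    and mono: "\<And>T U. T \<subseteq> U \<Longrightarrow> X T \<subseteq> X U"
  shows "\<exists>T. finite T \<and> T \<subseteq> S \<and> z \<in> frag.span (X T)"
proof -
  have "frag.subspace {z. \<exists>T. finite T \<and> T \<subseteq> S \<and> z \<in> frag.span (X T)}"
  proof (rule frag_subspaceI; clarify)
    show "\<exists>T. finite T \<and> T \<subseteq> S \<and> 0 \<in> frag.span (X T)"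
      by (intro exI[of _ "{}"]) (simp add: frag.span_zero)
    fix x y T U assume "finite T" "T \<subseteq> S" "x \<in> frag.span (X T)" "finite U" "U \<subseteq> S" "y \<in> frag.span (X U)"
    moreover then have "x \<in> frag.span (X (T \<union> U))" "y \<in> frag.span (X (T \<union> U))"
      using frag.span_mono[OF mono, of T "T \<union> U"] frag.span_mono[OF mono, of U "T \<union> U"] by auto
    ultimately show "\<exists>T. finite T \<and> T \<subseteq> S \<and> x - y \<in> frag.span (X T)"
      by (intro exI[of _ "T \<union> U"]) (simp add: frag.span_diff)
  qed
  from frag_span_minimal[OF z this] show ?thesis
    using Y by (force intro: frag.span_base)
qed

text \<open>
  As in Rado's proof of the structure theorem for finitely generated abelian groups, take among all
  relations between all generating families one with the least positive coefficient; this coefficient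
  then divides all others.
\<close>

lemma stacked_basis:
  fixes H :: "('a \<Rightarrow>\<^sub>0 int) set" and x :: "'i \<Rightarrow> 'a \<Rightarrow>\<^sub>0 int"
  assumes H: "frag.subspace H" and "finite I"
  shows "\<exists>y e. y ` I \<subseteq> frag.span (x ` I) \<and> x ` I \<subseteq> frag.span (y ` I) \<and>
    (\<forall>c\<in>frags I. frag_extend y c \<in> H \<longleftrightarrow> (\<forall>i\<in>I. (e i :: int) dvd Poly_Mapping.lookup c i))"
  using \<open>finite I\<close>
proof (induction "card I" arbitrary: I x)
  case 0
  then show ?case
    by (intro exI[of _ x] exI[of _ "\<lambda>_. 0"]) (auto simp: frags_def frag.subspace_0[OF H])
next
  case (Suc n)
  define gen where "gen x' \<longleftrightarrow> x' ` I \<subseteq> frag.span (x ` I) \<and> x ` I \<subseteq> frag.span (x' ` I)" for x'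
  define P where "P m \<longleftrightarrow> m > 0 \<and> (\<exists>x' c j. gen x' \<and> c \<in> frags I \<and> j \<in> I \<and> frag_extend x' c \<in> H \<and>
    Poly_Mapping.lookup c j = int m)" for m :: nat
  have genx: "gen x"
    by (auto simp: gen_def intro: frag.span_base)
  show ?case
  proof (cases "\<exists>m. P m")
    \<comment> \<open>Call a coefficient vector whose combination lies in \<open>H\<close> a
      relation. Here all relations are trivial, which is divisibility by 0.\<close>
    case False
    have "c = 0" if "c \<in> frags I" "frag_extend x c \<in> H" for c
    proof (rule ccontr)
      assume "c \<noteq> 0"
      then obtain j where j: "Poly_Mapping.lookup c j \<noteq> 0"
        by (metis poly_mapping_eqI lookup_zero)
      then have "j \<in> I"
        using that frags_lookup by fastforce
      show False
      proof (cases "Poly_Mapping.lookup c j > 0")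
        case True
        then have "P (nat (Poly_Mapping.lookup c j))"
          unfolding P_def using genx that \<open>j \<in> I\<close> by auto
        then show False
          using False by blast
      next
        case neg: False
        have "- c \<in> frags I" "frag_extend x (- c) \<in> H"
          using that H by (auto simp: frag_extend_minus frag.subspace_neg frag.subspace_neg[OF subspace_frags])
        then have "P (nat (Poly_Mapping.lookup (- c) j))"
          unfolding P_def using genx neg j \<open>j \<in> I\<close> by (intro conjI exI[of _ x] exI[of _ "- c"] exI[of _ j]) auto
        then show False
          using False by blast
      qed
    qed
    then have "frag_extend x c \<in> H \<longleftrightarrow> (\<forall>i\<in>I. 0 dvd Poly_Mapping.lookup c i)" if "c \<in> frags I" for c
      using that frag.subspace_0[OF H] frags_lookup[OF that]
      by (metis dvd_0_left_iff dvd_0_right frag_extend_0 poly_mapping_eqI lookup_zero)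
    then show ?thesis
      using genx by (intro exI[of _ x] exI[of _ "\<lambda>_. 0"]) (auto simp: gen_def)
  next
    case True
    define m where "m = (LEAST m. P m)"
    have "P m"
      unfolding m_def using True by (rule LeastI_ex)
    then obtain x' c j where m: "m > 0" and x': "gen x'" and c: "c \<in> frags I" "frag_extend x' c \<in> H"
      and j: "j \<in> I" and cj: "Poly_Mapping.lookup c j = int m"
      unfolding P_def by blast
    have least: "\<not> P k" if "k < m" for k
      using not_less_Least that unfolding m_def by blast
    define J where "J = I - {j}"
    have IJ: "I = insert j J" "j \<notin> J" "finite J" "card J = n"
      using j Suc.prems Suc.hyps by (auto simp: J_def)
    \<comment> \<open>Division of the coefficients of \<open>c\<close> by \<open>m\<close>. Moving
      the quotients into the generator at \<open>j\<close> leaves the relation with coefficient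
      \<open>m\<close> at \<open>j\<close> and remainders below \<open>m\<close> elsewhere.\<close>
    define d where "d = (\<Sum>i\<in>J. frag_cmul (Poly_Mapping.lookup c i div int m) (frag_of i))"
    have lookup_d: "Poly_Mapping.lookup d i = (if i \<in> J then Poly_Mapping.lookup c i div int m else 0)" for i
      unfolding d_def lookup_sum by (simp add: IJ(3) if_distrib[of "(*) _"] sum.delta' cong: if_cong)
    have d: "d \<in> frags J"
      by (auto simp: frags_def in_keys_iff lookup_d split: if_splits)
    define x'' where "x'' = x'(j := x' j + frag_extend x' d)"
    have x''J: "frag_extend x'' z = frag_extend x' z" if "z \<in> frags J" for z
      using that by (rule frag_extend_cong) (use IJ in \<open>auto simp: x''_def\<close>)
    have "gen x''"
      unfolding gen_def
    proof
      have "frags J \<subseteq> frags I"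
        using IJ by (intro frags_mono) auto
      then have "frag_extend x' d \<in> frag.span (x' ` I)"
        using d unfolding frag_extend_span[symmetric] by blast
      moreover have "frag.span (x' ` I) \<subseteq> frag.span (x ` I)"
        using x' by (intro frag.span_minimal) (auto simp: gen_def)
      ultimately show "x'' ` I \<subseteq> frag.span (x ` I)"
        using x' j by (auto simp: x''_def gen_def intro!: frag.span_add)
      have x'i: "x' i \<in> frag.span (x'' ` I)" if "i \<in> J" for i
      proof -
        have "x' i = x'' i" "i \<in> I"
          using that IJ by (auto simp: x''_def)
        then show ?thesis
          using frag.span_base[of "x'' i" "x'' ` I"] by simp
      qed
      have "x' j = x'' j - frag_extend x' d"
        by (simp add: x''_def)
      moreover have "frag_extend x' d \<in> frag.span (x'' ` I)"
        using frag_extend_in[OF d _ x'i] by simp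
      ultimately have "x' j \<in> frag.span (x'' ` I)"
        using frag.span_base[of "x'' j" "x'' ` I"] j by (simp add: frag.span_diff)
      then have "frag.span (x' ` I) \<subseteq> frag.span (x'' ` I)"
        using x'i IJ(1) by (intro frag.span_minimal) auto
      then show "x ` I \<subseteq> frag.span (x'' ` I)"
        using x' by (auto simp: gen_def)
    qed
    \<comment> \<open>\<open>x''\<close> generates the same subgroup, so the minimality of
      \<open>m\<close> governs its relations too.\<close>
    have small: "Poly_Mapping.lookup z i = 0"
      if "z \<in> frags I" "frag_extend x'' z \<in> H" "i \<in> I" "0 \<le> Poly_Mapping.lookup z i"
        "Poly_Mapping.lookup z i < int m" for z i
    proof (rule ccontr)
      assume "Poly_Mapping.lookup z i \<noteq> 0"
      then have "P (nat (Poly_Mapping.lookup z i))"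
        unfolding P_def using that \<open>gen x''\<close> by (intro conjI exI[of _ x''] exI[of _ z] exI[of _ i]) auto
      then show False
        using least[of "nat (Poly_Mapping.lookup z i)"] that by linarith
    qed
    define r where "r = c - frag_cmul (int m) (frag_of j) - frag_cmul (int m) d"
    have r: "r \<in> frags J"
    proof -
      have "i \<in> J" if "Poly_Mapping.lookup r i \<noteq> 0" for i
        using that cj IJ(1) frags_lookup[OF c(1), of i]
        by (auto simp: r_def lookup_minus lookup_d split: if_splits)
      then show ?thesis
        by (auto simp: frags_def in_keys_iff)
    qed
    have "frag_extend x' c = frag_extend x'' (frag_cmul (int m) (frag_of j) + r)"
    proof -
      have "frag_extend x' c = frag_cmul (int m) (x' j) + frag_extend x' r + frag_cmul (int m) (frag_extend x' d)"
        by (simp add: r_def frag_extend_diff frag_extend_cmul)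
      also have "\<dots> = frag_cmul (int m) (x'' j) + frag_extend x' r"
        by (simp add: x''_def frag_cmul_distrib2)
      finally show ?thesis
        using x''J[OF r] by (simp add: frag_extend_add frag_extend_cmul)
    qed
    then have rH: "frag_extend x'' (frag_cmul (int m) (frag_of j) + r) \<in> H"
      using c(2) by simp
    have rI: "frag_cmul (int m) (frag_of j) + r \<in> frags I"
      using r frags_mono[of J I] IJ(1)
      by (auto intro!: frag.subspace_add[OF subspace_frags] frag.subspace_scale[OF subspace_frags])
    have "Poly_Mapping.lookup r i = 0" if "i \<in> J" for i
    proof -
      have eq: "Poly_Mapping.lookup (frag_cmul (int m) (frag_of j) + r) i = Poly_Mapping.lookup c i mod int m"
        using that IJ(2) by (auto simp: r_def lookup_add lookup_minus lookup_d minus_div_mult_eq_mod[symmetric] algebra_simps)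
      have "Poly_Mapping.lookup (frag_cmul (int m) (frag_of j) + r) i = 0"
        by (rule small[OF rI rH]) (use that m IJ(1) eq in auto)
      moreover have "i \<noteq> j"
        using that IJ(2) by auto
      ultimately show ?thesis
        by (simp add: lookup_add)
    qed
    then have "r = 0"
      using frags_lookup[OF r] by (metis poly_mapping_eqI lookup_zero)
    then have mj: "frag_cmul (int m) (x'' j) \<in> H"
      using rH by (simp add: frag_extend_cmul)
    have dvd: "int m dvd Poly_Mapping.lookup z j" if z: "z \<in> frags I" "frag_extend x'' z \<in> H" for z
    proof -
      let ?q = "Poly_Mapping.lookup z j div int m" and ?z = "z - frag_cmul (Poly_Mapping.lookup z j div int m * int m) (frag_of j)"
      have eq: "Poly_Mapping.lookup ?z j = Poly_Mapping.lookup z j mod int m"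
        by (simp add: lookup_minus minus_div_mult_eq_mod)
      have "?z \<in> frags I"
        using z(1) j by (intro frag.subspace_diff[OF subspace_frags] frag.subspace_scale[OF subspace_frags]) auto
      moreover have "frag_extend x'' ?z \<in> H"
        using z(2) frag.subspace_scale[OF H mj, of ?q]
        by (simp add: frag_extend_diff frag_extend_cmul frag.subspace_diff[OF H])
      ultimately have "Poly_Mapping.lookup ?z j = 0"
        by (rule small[OF _ _ j]) (use m eq in auto)
      then show ?thesis
        using eq by (simp add: dvd_eq_mod_eq_0)
    qed
    obtain y e where y: "y ` J \<subseteq> frag.span (x'' ` J)" "x'' ` J \<subseteq> frag.span (y ` J)"
      and e: "\<And>c. c \<in> frags J \<Longrightarrow> frag_extend y c \<in> H \<longleftrightarrow> (\<forall>i\<in>J. (e i :: int) dvd Poly_Mapping.lookup c i)"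
      using Suc.hyps(1)[OF IJ(4)[symmetric] IJ(3), of x'']
      by (elim exE conjE) (rule that, assumption+, erule bspec, assumption)
    let ?y = "y(j := x'' j)" and ?e = "e(j := int m)"
    have yJ: "frag_extend ?y z = frag_extend y z" if "z \<in> frags J" for z
      using that by (rule frag_extend_cong) (use IJ in auto)
    have yIm: "?y ` I = insert (x'' j) (y ` J)"
      using IJ by auto
    have xIm: "x'' ` I = insert (x'' j) (x'' ` J)"
      using IJ(1) by auto
    have sp: "frag.span (?y ` I) = frag.span (x'' ` I)"
    proof -
      have "frag.span (y ` J) \<subseteq> frag.span (insert (x'' j) (y ` J))"
        "frag.span (x'' ` J) \<subseteq> frag.span (insert (x'' j) (x'' ` J))"
        by (intro frag.span_mono; blast)+
      then show ?thesis
        unfolding yIm xIm frag.span_eq using y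
        by (auto intro: frag.span_base)
    qed
    have sp': "frag.span (x'' ` I) = frag.span (x ` I)"
      using \<open>gen x''\<close> unfolding gen_def frag.span_eq by blast
    have "frag_extend ?y z \<in> H \<longleftrightarrow> (\<forall>i\<in>I. ?e i dvd Poly_Mapping.lookup z i)" if z: "z \<in> frags I" for z
    proof -
      define z' where "z' = z - frag_cmul (Poly_Mapping.lookup z j) (frag_of j)"
      have z': "z' \<in> frags J"
      proof -
        have "i \<in> J" if "Poly_Mapping.lookup z' i \<noteq> 0" for i
          using that IJ(1) frags_lookup[OF z, of i] by (auto simp: z'_def lookup_minus split: if_splits)
        then show ?thesis
          by (auto simp: frags_def in_keys_iff)
      qed
      have look: "Poly_Mapping.lookup z' i = Poly_Mapping.lookup z i" if "i \<in> J" for i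
        using that IJ(2) by (auto simp: z'_def lookup_minus)
      have "frag_extend ?y z = frag_extend ?y (frag_cmul (Poly_Mapping.lookup z j) (frag_of j)) + frag_extend ?y z'"
        by (simp add: z'_def frag_extend_diff)
      then have split: "frag_extend ?y z = frag_cmul (Poly_Mapping.lookup z j) (x'' j) + frag_extend y z'"
        using yJ[OF z'] by (simp add: frag_extend_cmul)
      \<comment> \<open>\<open>dvd\<close> speaks of coefficients with respect to
        \<open>x''\<close>. Rewriting the part over \<open>J\<close> from \<open>y\<close> to
        \<open>x''\<close> does not touch the coefficient at \<open>j\<close>.\<close>
      have "int m dvd Poly_Mapping.lookup z j" if zH: "frag_extend ?y z \<in> H"
      proof -
        have "frag_extend y z' \<in> frag.span (x'' ` J)"
          using z' by (rule frag_extend_in) (use y(1) in auto)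
        then obtain w where w: "w \<in> frags J" "frag_extend y z' = frag_extend x'' w"
          unfolding frag_extend_span[symmetric] by blast
        let ?u = "frag_cmul (Poly_Mapping.lookup z j) (frag_of j) + w"
        have "?u \<in> frags I"
          using w frags_mono[of J I] IJ(1) j
          by (intro frag.subspace_add[OF subspace_frags] frag.subspace_scale[OF subspace_frags]) auto
        moreover have "frag_extend x'' ?u \<in> H"
          using zH split w by (simp add: frag_extend_add frag_extend_cmul)
        ultimately have "int m dvd Poly_Mapping.lookup ?u j"
          by (rule dvd)
        then show ?thesis
          using frags_lookup[OF w(1) IJ(2)] by (simp add: lookup_add)
      qed
      moreover have "frag_cmul (Poly_Mapping.lookup z j) (x'' j) \<in> H" if "int m dvd Poly_Mapping.lookup z j"
      proof -
        obtain k where "Poly_Mapping.lookup z j = int m * k"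
          using \<open>int m dvd _\<close> by blast
        then show ?thesis
          using frag.subspace_scale[OF H mj, of k] by (simp add: mult.commute)
      qed
      ultimately have "frag_extend ?y z \<in> H \<longleftrightarrow> int m dvd Poly_Mapping.lookup z j \<and> frag_extend y z' \<in> H"
        unfolding split using frag.subspace_add[OF H] frag.subspace_diff[OF H]
        by (metis add_diff_cancel_left')
      then show ?thesis
        unfolding e[OF z'] using IJ look by auto
    qed
    then show ?thesis
      using sp sp' frag.span_superset[of "?y ` I"] frag.span_superset[of "x ` I"]
      by (intro exI[of _ ?y] exI[of _ ?e]) auto
  qed
qed

text \<open>\<open>p t\<close> is a chosen coordinate vector of the basis element \<open>t\<close>
  in the generators \<open>y\<close>, which makes \<open>frag_extend p\<close> a section of
  \<open>frag_extend y\<close> over \<open>frags T\<close>.\<close>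

lemma stacked_coordinates:
  fixes H :: "('a \<Rightarrow>\<^sub>0 int) set"
  assumes H: "frag.subspace H" and T: "finite T"
  obtains y p :: "'a \<Rightarrow> 'a \<Rightarrow>\<^sub>0 int" and e :: "'a \<Rightarrow> int"
  where "\<And>t. t \<in> T \<Longrightarrow> y t \<in> frags T" "\<And>t. t \<in> T \<Longrightarrow> p t \<in> frags T"
    "\<And>x. x \<in> frags T \<Longrightarrow> frag_extend y (frag_extend p x) = x"
    "\<And>c. c \<in> frags T \<Longrightarrow> frag_extend y c \<in> H \<longleftrightarrow> (\<forall>t\<in>T. e t dvd Poly_Mapping.lookup c t)"
proof -
  obtain y e where y: "y ` T \<subseteq> frag.span (frag_of ` T)" "frag_of ` T \<subseteq> frag.span (y ` T)"
    and e: "\<And>c. c \<in> frags T \<Longrightarrow> frag_extend y c \<in> H \<longleftrightarrow> (\<forall>i\<in>T. (e i :: int) dvd Poly_Mapping.lookup c i)"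
    using stacked_basis[OF H T, of frag_of] by metis
  have "\<exists>c\<in>frags T. frag_of t = frag_extend y c" if "t \<in> T" for t
    using y(2) that unfolding frag_extend_span[symmetric] by blast
  then obtain p where p: "\<And>t. t \<in> T \<Longrightarrow> p t \<in> frags T \<and> frag_extend y (p t) = frag_of t"
    by metis
  have "frag_extend y (frag_extend p x) = x" if "x \<in> frags T" for x
    using that by (induction rule: frags_induct) (auto simp: p frag_extend_diff)
  then show ?thesis
    using that[of y p e] y(1) p e unfolding frags_eq_span[symmetric] by blast
qed

section \<open>Tensor squares of free abelian groups\<close>

text \<open>The tensor product of free groups is realised as the free group on pairs. Its elements
  have coefficients, and the quotient construction \<open>tensor\<close> is met only where
  \<open>A\<close> itself is a factor.\<close>

definition tens :: "('a \<Rightarrow>\<^sub>0 int) \<Rightarrow> ('b \<Rightarrow>\<^sub>0 int) \<Rightarrow> ('a \<times> 'b \<Rightarrow>\<^sub>0 int)"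
  where "tens x y = frag_extend (\<lambda>a. frag_extend (\<lambda>b. frag_of (a, b)) y) x"

lemma frag_extend_fun_diff:
  "frag_extend (\<lambda>a. f a - g a) x = frag_extend f x - frag_extend g x"
  by (induction x rule: frag_ext_induct) (auto simp: frag_extend_diff)

lemma frag_extend_fun_0 [simp]: "frag_extend (\<lambda>a. 0) x = 0"
  by (induction x rule: frag_ext_induct) (auto simp: frag_extend_diff)

lemma tens_frag_of [simp]: "tens (frag_of a) (frag_of b) = frag_of (a, b)"
  by (simp add: tens_def)

lemma tens_diff_left: "tens (x - x') y = tens x y - tens x' y"
  by (simp add: tens_def frag_extend_diff)

lemma tens_diff_right: "tens x (y - y') = tens x y - tens x y'"
  by (simp add: tens_def frag_extend_diff frag_extend_fun_diff)

lemma tens_zero [simp]: "tens 0 y = 0" "tens x 0 = 0"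
  by (simp_all add: tens_def)

lemma tens_uminus: "tens (- x) y = - tens x y" "tens x (- y) = - tens x y"
  using tens_diff_left[of 0 x y] tens_diff_right[of x 0 y] by simp_all

lemma tens_add: "tens (x + x') y = tens x y + tens x' y" "tens x (y + y') = tens x y + tens x y'"
  using tens_diff_left[of x "- x'" y] tens_diff_right[of x y "- y'"] by (simp_all add: tens_uminus)

lemma tens_cmul: "tens (frag_cmul n x) y = frag_cmul n (tens x y)" "tens x (frag_cmul n y) = frag_cmul n (tens x y)"
proof -
  show "tens (frag_cmul n x) y = frag_cmul n (tens x y)" for y :: "'b \<Rightarrow>\<^sub>0 int"
    by (simp add: tens_def frag_extend_cmul)
  show "tens x (frag_cmul n y) = frag_cmul n (tens x y)"
    by (induction x rule: frag_ext_induct)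
      (simp_all add: tens_diff_left frag.scale_right_diff_distrib, simp add: tens_def frag_extend_cmul)
qed

lemma lookup_tens: "Poly_Mapping.lookup (tens x y) (a, b) = Poly_Mapping.lookup x a * Poly_Mapping.lookup y b"
proof (induction x rule: frag_ext_induct)
  case (of c)
  show ?case
    by (induction y rule: frag_ext_induct) (auto simp: tens_diff_right lookup_minus right_diff_distrib)
qed (auto simp: tens_diff_left lookup_minus left_diff_distrib)

lemma tens_in_frags: "\<lbrakk>x \<in> frags S; y \<in> frags T\<rbrakk> \<Longrightarrow> tens x y \<in> frags (S \<times> T)"
  unfolding tens_def by (intro frag_extend_in[of x S] frag_extend_in[of y T]) auto

text \<open>For subgroups \<open>X\<close> and \<open>Y\<close> this is a faithful copy of X
  \<otimes> Y, since subgroups of free abelian groups are flat.\<close>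

definition tspan :: "('a \<Rightarrow>\<^sub>0 int) set \<Rightarrow> ('b \<Rightarrow>\<^sub>0 int) set \<Rightarrow> ('a \<times> 'b \<Rightarrow>\<^sub>0 int) set"
  where "tspan X Y = frag.span {tens x y | x y. x \<in> X \<and> y \<in> Y}"

lemma subspace_tspan [simp, intro]: "frag.subspace (tspan X Y)"
  by (simp add: tspan_def)

lemma tens_in_tspan: "\<lbrakk>x \<in> X; y \<in> Y\<rbrakk> \<Longrightarrow> tens x y \<in> tspan X Y"
  unfolding tspan_def by (intro frag.span_base) auto

lemma tspan_mono: "\<lbrakk>X \<subseteq> X'; Y \<subseteq> Y'\<rbrakk> \<Longrightarrow> tspan X Y \<subseteq> tspan X' Y'"
  unfolding tspan_def by (intro frag.span_mono) auto

lemma tspan_minimal: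
  assumes "z \<in> tspan X Y" "frag.subspace V" "\<And>x y. \<lbrakk>x \<in> X; y \<in> Y\<rbrakk> \<Longrightarrow> tens x y \<in> V"
  shows "z \<in> V"
  using frag_span_minimal[OF assms(1)[unfolded tspan_def] assms(2)] assms(3) by auto

lemma tspan_map:
  assumes "z \<in> tspan X Y" "\<And>x y. f (x - y) = f x - f y" "frag.subspace V"
    "\<And>x y. \<lbrakk>x \<in> X; y \<in> Y\<rbrakk> \<Longrightarrow> f (tens x y) \<in> V"
  shows "f z \<in> V"
  using frag_span_map[OF assms(1)[unfolded tspan_def] assms(2,3)] assms(4) by auto

lemma frags_Times_eq_tspan: "frags (S \<times> T) = tspan (frags S) (frags T)"
proof
  show "frags (S \<times> T) \<subseteq> tspan (frags S) (frags T)"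
  proof
    fix z assume "z \<in> frags (S \<times> T)"
    then show "z \<in> tspan (frags S) (frags T)"
    proof (induction rule: frags_induct)
      case (of p)
      then show ?case
        using tens_in_tspan[of "frag_of (fst p)" "frags S" "frag_of (snd p)" "frags T"] by auto
    qed (auto intro: frag.subspace_diff frag.subspace_0)
  qed
  show "tspan (frags S) (frags T) \<subseteq> frags (S \<times> T)"
    using tspan_minimal tens_in_frags by blast
qed

text \<open>The factors of the witness have to be supported on \<open>T\<close>, not merely
  \<open>z\<close>: divisibility of coordinates is known only for elements of \<open>R\<close>
  inside \<open>frags T\<close>.\<close>

lemma tspan_finite_support:
  assumes z: "z \<in> tspan X Y" and "X \<subseteq> frags S" "Y \<subseteq> frags S"
  shows "\<exists>T. finite T \<and> T \<subseteq> S \<and> z \<in> tspan (X \<inter> frags T) (Y \<inter> frags T)"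
  unfolding tspan_def
proof (rule frag_span_directed[OF z[unfolded tspan_def]])
  fix w assume "w \<in> {tens x y |x y. x \<in> X \<and> y \<in> Y}"
  then obtain x y where w: "w = tens x y" and x: "x \<in> X" and y: "y \<in> Y"
    by auto
  obtain T U where "finite T" "T \<subseteq> S" "x \<in> frags T" "finite U" "U \<subseteq> S" "y \<in> frags U"
    using frag_finite_support x y assms(2,3) by (metis subsetD)
  moreover then have "x \<in> frags (T \<union> U)" "y \<in> frags (T \<union> U)"
    using frags_mono[of T "T \<union> U"] frags_mono[of U "T \<union> U"] by auto
  ultimately show "\<exists>T. finite T \<and> T \<subseteq> S \<and> w \<in> {tens x y |x y. x \<in> X \<inter> frags T \<and> y \<in> Y \<inter> frags T}"
    using w x y by (intro exI[of _ "T \<union> U"]) auto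
qed (use frags_mono in blast)

lemma tspan_widen:
  assumes "T \<subseteq> U" "z \<in> tspan (X \<inter> frags T) (Y \<inter> frags T)"
  shows "z \<in> tspan (X \<inter> frags U) (Y \<inter> frags U)"
  using tspan_mono[of "X \<inter> frags T" "X \<inter> frags U" "Y \<inter> frags T" "Y \<inter> frags U"] frags_mono[OF assms(1)] assms(2)
  by blast

section \<open>Functoriality of the tensor square and the interchange of factors\<close>

definition tmap :: "('a \<Rightarrow> 'c \<Rightarrow>\<^sub>0 int) \<Rightarrow> ('b \<Rightarrow> 'd \<Rightarrow>\<^sub>0 int) \<Rightarrow> ('a \<times> 'b \<Rightarrow>\<^sub>0 int) \<Rightarrow> ('c \<times> 'd \<Rightarrow>\<^sub>0 int)"
  where "tmap f g = frag_extend (\<lambda>(a, b). tens (f a) (g b))"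

lemma tmap_diff: "tmap f g (z - w) = tmap f g z - tmap f g w"
  and tmap_add: "tmap f g (z + w) = tmap f g z + tmap f g w"
  and tmap_0 [simp]: "tmap f g 0 = 0"
  and tmap_of [simp]: "tmap f g (frag_of (a, b)) = tens (f a) (g b)"
  by (simp_all add: tmap_def frag_extend_diff frag_extend_add)

lemma tmap_tens [simp]: "tmap f g (tens x y) = tens (frag_extend f x) (frag_extend g y)"
proof (induction x rule: frag_ext_induct)
  case (of a)
  show ?case
    by (induction y rule: frag_ext_induct) (simp_all add: tens_diff_right frag_extend_diff tmap_diff)
qed (simp_all add: tens_diff_left frag_extend_diff tmap_diff)

lemma tmap_in_frags:
  assumes "z \<in> frags (T \<times> U)" "\<And>t. t \<in> T \<Longrightarrow> f t \<in> frags T'" "\<And>u. u \<in> U \<Longrightarrow> g u \<in> frags U'"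
  shows "tmap f g z \<in> frags (T' \<times> U')"
  unfolding tmap_def using assms(1)
  by (rule frag_extend_in) (use assms in \<open>auto intro: tens_in_frags\<close>)

lemma frag_extend_Times_in:
  assumes "z \<in> frags (T \<times> U)" "frag.subspace V"
    "\<And>i j. \<lbrakk>i \<in> T; j \<in> U\<rbrakk> \<Longrightarrow> frag_cmul (Poly_Mapping.lookup z (i, j)) (f (i, j)) \<in> V"
  shows "frag_extend f z \<in> V"
  unfolding frag_extend_def
  by (rule frag.subspace_sum[OF assms(2)]) (use assms in \<open>auto simp: frags_def\<close>)

definition flip :: "('a \<times> 'b \<Rightarrow>\<^sub>0 int) \<Rightarrow> ('b \<times> 'a \<Rightarrow>\<^sub>0 int)"
  where "flip = frag_extend (\<lambda>(a, b). frag_of (b, a))"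

lemma flip_diff: "flip (z - w) = flip z - flip w"
  and flip_add: "flip (z + w) = flip z + flip w"
  and flip_0 [simp]: "flip 0 = 0"
  and flip_uminus: "flip (- z) = - flip z"
  and flip_of [simp]: "flip (frag_of (a, b)) = frag_of (b, a)"
  and flip_cmul: "flip (frag_cmul n z) = frag_cmul n (flip z)"
  by (simp_all add: flip_def frag_extend_diff frag_extend_add frag_extend_cmul frag_extend_minus)

lemma flip_flip [simp]: "flip (flip z) = z"
  by (induction z rule: frag_ext_induct) (auto simp: flip_diff)

lemma lookup_flip: "Poly_Mapping.lookup (flip z) (a, b) = Poly_Mapping.lookup z (b, a)"
  by (induction z rule: frag_ext_induct) (auto simp: flip_diff lookup_minus split: if_splits)

lemma flip_tens [simp]: "flip (tens x y) = tens y x"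
  by (rule poly_mapping_eqI) (auto simp: lookup_flip lookup_tens)

lemma tmap_flip: "tmap f f (flip z) = flip (tmap f f z)"
  by (induction z rule: frag_ext_induct) (auto simp: flip_diff tmap_diff)

lemma flip_in_tspan: "z \<in> tspan X Y \<Longrightarrow> flip z \<in> tspan Y X"
  by (erule tspan_map) (auto simp: flip_diff intro: tens_in_tspan)

lemma lookup_dvd_subspace: "frag.subspace {z. (n :: int) dvd Poly_Mapping.lookup z i}"
  by (rule frag_subspaceI) (auto simp: lookup_minus)

text \<open>
  A tournament in place of a linear order: for \<open>i \<noteq> j\<close> it selects exactly one of \<open>(i, j)\<close> and \<open>(j, i)\<close>.
\<close>

definition precedes :: "'a \<Rightarrow> 'a \<Rightarrow> bool"
  where "precedes = (SOME P. \<forall>i j. i \<noteq> j \<longrightarrow> P i j \<noteq> P j i)"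

lemma precedes_iff: "i \<noteq> j \<Longrightarrow> precedes i j \<longleftrightarrow> \<not> precedes j i"
proof -
  obtain r :: "'a rel" where "well_order_on UNIV r"
    using well_order_on[of UNIV] by (rule exE)
  then have "\<forall>i j. i \<noteq> j \<longrightarrow> ((i, j) \<in> r) \<noteq> ((j, i) \<in> r)"
    unfolding well_order_on_def linear_order_on_def partial_order_on_def antisym_def total_on_def by blast
  then have "\<exists>P :: 'a \<Rightarrow> 'a \<Rightarrow> bool. \<forall>i j. i \<noteq> j \<longrightarrow> P i j \<noteq> P j i"
    by (rule exI[of _ "\<lambda>i j. (i, j) \<in> r"])
  then have "\<forall>i j :: 'a. i \<noteq> j \<longrightarrow> precedes i j \<noteq> precedes j i"
    unfolding precedes_def by (rule someI_ex)
  then show "i \<noteq> j \<Longrightarrow> ?thesis"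
    by blast
qed

lemma precedes_cases [case_names eq less greater]:
  obtains "i = j" | "i \<noteq> j" "precedes i j" "\<not> precedes j i" | "i \<noteq> j" "precedes j i" "\<not> precedes i j"
  using precedes_iff[of i j] by blast

text \<open>Averaging z and its flip would need division by 2. Instead the coefficients on the
  diagonal and at the selected pairs are kept, and the latter are reflected. The result is an
  integral projection onto the symmetric elements.\<close>

definition symz :: "('a \<times> 'a \<Rightarrow>\<^sub>0 int) \<Rightarrow> ('a \<times> 'a \<Rightarrow>\<^sub>0 int)"
  where "symz = frag_extend (\<lambda>(i, j). if i = j then frag_of (i, i)
    else if precedes i j then frag_of (i, j) + frag_of (j, i) else 0)"

lemma lookup_symz: "Poly_Mapping.lookup (symz z) (i, j) =
    (if i = j \<or> precedes i j then Poly_Mapping.lookup z (i, j) else Poly_Mapping.lookup z (j, i))"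
proof (induction z rule: frag_ext_induct)
  case (of p)
  obtain k l where "p = (k, l)"
    by (cases p)
  then show ?case
    by (cases i j rule: precedes_cases; cases k l rule: precedes_cases) (auto simp: symz_def lookup_add)
qed (auto simp: symz_def frag_extend_diff lookup_minus)

lemma symz_sym:
  assumes "flip z = z"
  shows "symz z = z"
proof -
  have "Poly_Mapping.lookup z (j, i) = Poly_Mapping.lookup z (i, j)" for i j
    using lookup_flip[of z i j] assms by simp
  then show ?thesis
    by (intro poly_mapping_eqI) (auto simp: lookup_symz)
qed

lemma flip_symz: "flip (symz z) = symz z"
proof (rule poly_mapping_eqI, clarify)
  fix i j
  show "Poly_Mapping.lookup (flip (symz z)) (i, j) = Poly_Mapping.lookup (symz z) (i, j)"
    by (cases i j rule: precedes_cases) (simp_all add: lookup_flip lookup_symz)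
qed

lemma symz_diff: "symz (z - w) = symz z - symz w"
  by (simp add: symz_def frag_extend_diff)

lemma tmap_symz: "tmap f f (symz z) = frag_extend (\<lambda>(i, j). if i = j then tens (f i) (f i)
    else if precedes i j then tens (f i) (f j) + tens (f j) (f i) else 0) z"
  by (induction z rule: frag_ext_induct)
    (auto simp: symz_def frag_extend_diff tmap_diff tmap_add)

section \<open>The lattices attached to a subgroup \<open>R\<close> of \<open>F\<close>, and their
  symmetric elements\<close>

locale lattice_pair =
  fixes S :: "'a set" and R :: "('a \<Rightarrow>\<^sub>0 int) set"
  assumes subspace_R [simp]: "frag.subspace R" and R_le: "R \<subseteq> frags S"
begin

abbreviation "F \<equiv> frags S"
abbreviation "RF \<equiv> tspan R F"
abbreviation "FR \<equiv> tspan F R"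
abbreviation "RR \<equiv> tspan R R"

definition J :: "('a \<times> 'a \<Rightarrow>\<^sub>0 int) set"
  where "J = frag.span (RF \<union> FR)"

definition K :: "('a \<times> 'a \<Rightarrow>\<^sub>0 int) set"
  where "K = RF \<inter> FR"

definition N :: "('a \<times> 'a \<Rightarrow>\<^sub>0 int) set"
  where "N = frag.span ({tens r f + tens f r | r f. r \<in> R \<and> f \<in> F} \<union> {tens r r | r. r \<in> R})"

lemma subspace_J [simp]: "frag.subspace J"
  unfolding J_def by simp

lemma J_cases:
  assumes "z \<in> J"
  obtains u v where "u \<in> RF" "v \<in> FR" "z = u + v"
  using assms frag.span_eq_iff[THEN iffD2, OF subspace_tspan] unfolding J_def frag.span_Un by blast

lemma RF_le_J: "RF \<subseteq> J" and FR_le_J: "FR \<subseteq> J"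
  unfolding J_def using frag.span_superset[of "RF \<union> FR"] by blast+

lemma subspace_K [simp]: "frag.subspace K"
  unfolding K_def by (simp add: frag.subspace_inter)

lemma subspace_N [simp]: "frag.subspace N"
  unfolding N_def by simp

lemma N_intros: "\<lbrakk>r \<in> R; f \<in> F\<rbrakk> \<Longrightarrow> tens r f + tens f r \<in> N" "r \<in> R \<Longrightarrow> tens r r \<in> N"
  unfolding N_def by (auto intro: frag.span_base)

lemma RR_le: "RR \<subseteq> RF" "RR \<subseteq> FR" "RR \<subseteq> K"
  unfolding K_def using tspan_mono[of R R R F] tspan_mono[of R F R R] R_le by auto

lemma N_le_J: "N \<subseteq> J"
  unfolding N_def
proof (rule frag.span_minimal)
  have "tens r f \<in> J" "tens f r \<in> J" if "r \<in> R" "f \<in> F" for r f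
    using RF_le_J FR_le_J tens_in_tspan[of r R f F] tens_in_tspan[of f F r R] that by auto
  then show "{tens r f + tens f r | r f. r \<in> R \<and> f \<in> F} \<union> {tens r r | r. r \<in> R} \<subseteq> J"
    using R_le by (auto intro!: frag.subspace_add)
qed simp

lemma flip_K: "k \<in> K \<Longrightarrow> flip k \<in> K"
  unfolding K_def using flip_in_tspan by auto

lemma RF_le: "RF \<subseteq> frags (S \<times> S)"
  unfolding frags_Times_eq_tspan by (rule tspan_mono[OF R_le]) simp

lemma add_flip_N: "y \<in> RF \<Longrightarrow> y + flip y \<in> N"
  by (erule tspan_map[where f = "\<lambda>y. y + flip y"]) (auto simp: flip_diff intro: N_intros)

text \<open>By linearity all the generators \<open>tens r f + tens f r\<close> merge into one norm
  \<open>y + flip y\<close>. The remaining squares lie in \<open>RR\<close>, so modulo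
  \<open>RR\<close> an element of \<open>N\<close> is the norm of an element of
  \<open>RF\<close>.\<close>

lemma N_cases:
  assumes "k \<in> N"
  obtains y s where "y \<in> RF" "s \<in> frag.span {tens r r | r. r \<in> R}" "k = y + flip y + s"
proof -
  have "frag.subspace {k. \<exists>y s. y \<in> RF \<and> s \<in> frag.span {tens r r | r. r \<in> R} \<and> k = y + flip y + s}"
  proof (rule frag_subspaceI; clarify)
    show "\<exists>y s. y \<in> RF \<and> s \<in> frag.span {tens r r | r. r \<in> R} \<and> 0 = y + flip y + s"
      by (intro exI[of _ 0]) (auto intro: frag.subspace_0 frag.span_zero)
    fix y y' s s' assume *: "y \<in> RF" "y' \<in> RF" "s \<in> frag.span {tens r r | r. r \<in> R}"
      "s' \<in> frag.span {tens r r | r. r \<in> R}"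
    show "\<exists>y'' s''. y'' \<in> RF \<and> s'' \<in> frag.span {tens r r | r. r \<in> R} \<and>
        y + flip y + s - (y' + flip y' + s') = y'' + flip y'' + s''"
      by (intro exI[of _ "y - y'"] exI[of _ "s - s'"])
        (use * in \<open>auto simp: flip_diff frag.subspace_diff frag.span_diff algebra_simps\<close>)
  qed
  then have "k \<in> {k. \<exists>y s. y \<in> RF \<and> s \<in> frag.span {tens r r | r. r \<in> R} \<and> k = y + flip y + s}"
    using assms unfolding N_def
  proof (elim frag_span_minimal)
    fix x assume "x \<in> {tens r f + tens f r | r f. r \<in> R \<and> f \<in> F} \<union> {tens r r | r. r \<in> R}"
    then consider r f where "r \<in> R" "f \<in> F" "x = tens r f + tens f r" | r where "r \<in> R" "x = tens r r"
      by blast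
    then show "x \<in> {k. \<exists>y s. y \<in> RF \<and> s \<in> frag.span {tens r r | r. r \<in> R} \<and> k = y + flip y + s}"
    proof cases
      case 1
      then show ?thesis
        by (intro CollectI exI[of _ "tens r f"] exI[of _ 0]) (auto intro: tens_in_tspan frag.span_zero)
    next
      case 2
      then show ?thesis
        by (intro CollectI exI[of _ 0] exI[of _ x]) (auto intro: frag.subspace_0 frag.span_base)
    qed
  qed
  then show ?thesis
    using that by blast
qed

text \<open>
  Over a finite \<open>T\<close> a stacked basis turns \<open>RF\<close>, \<open>FR\<close> and \<open>RR\<close> into divisibility conditions on the
  coefficients.
\<close>

lemma local_coordinates:
  assumes T: "finite T" "T \<subseteq> S"
  obtains y p :: "'a \<Rightarrow> 'a \<Rightarrow>\<^sub>0 int" and e :: "'a \<Rightarrow> int"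
  where "\<And>t. t \<in> T \<Longrightarrow> y t \<in> F" "\<And>t. t \<in> T \<Longrightarrow> frag_cmul (e t) (y t) \<in> R"
    "\<And>x. x \<in> frags T \<Longrightarrow> frag_extend p x \<in> frags T"
    "\<And>x. x \<in> frags T \<Longrightarrow> frag_extend y (frag_extend p x) = x"
    "\<And>r t. \<lbrakk>r \<in> R \<inter> frags T; t \<in> T\<rbrakk> \<Longrightarrow> e t dvd Poly_Mapping.lookup (frag_extend p r) t"
    "\<And>z. z \<in> frags (T \<times> T) \<Longrightarrow> tmap p p z \<in> frags (T \<times> T)"
    "\<And>z. z \<in> frags (T \<times> T) \<Longrightarrow> tmap y y (tmap p p z) = z"
proof -
  obtain y p e where y: "\<And>t. t \<in> T \<Longrightarrow> y t \<in> frags T" and p: "\<And>t. t \<in> T \<Longrightarrow> p t \<in> frags T"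
    and yp: "\<And>x. x \<in> frags T \<Longrightarrow> frag_extend y (frag_extend p x) = x"
    and e: "\<And>c. c \<in> frags T \<Longrightarrow> frag_extend y c \<in> R \<longleftrightarrow> (\<forall>t\<in>T. (e t :: int) dvd Poly_Mapping.lookup c t)"
    by (rule stacked_coordinates[OF subspace_R T(1)]) (rule that)
  show ?thesis
  proof (rule that[of y e p])
    show "y t \<in> F" if "t \<in> T" for t
      using y[OF that] frags_mono[OF T(2)] by auto
    show "frag_cmul (e t) (y t) \<in> R" if "t \<in> T" for t
      using e[of "frag_cmul (e t) (frag_of t)"] that by (auto simp: frag_extend_cmul)
    show px: "frag_extend p x \<in> frags T" if "x \<in> frags T" for x
      using that by (rule frag_extend_in) (use p in auto)
    show "frag_extend y (frag_extend p x) = x" if "x \<in> frags T" for x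
      by (rule yp[OF that])
    show "e t dvd Poly_Mapping.lookup (frag_extend p r) t" if "r \<in> R \<inter> frags T" "t \<in> T" for r t
      using e[OF px, of r] yp[of r] that by auto
    show "tmap p p z \<in> frags (T \<times> T)" if "z \<in> frags (T \<times> T)" for z
      using that p p by (rule tmap_in_frags)
    show "tmap y y (tmap p p z) = z" if "z \<in> frags (T \<times> T)" for z
      using that
    proof (induction rule: frags_induct)
      case (of q)
      then show ?case
        using yp[of "frag_of (fst q)"] yp[of "frag_of (snd q)"] by (cases q) auto
    qed (auto simp: tmap_diff)
  qed
qed

text \<open>Coefficients of \<open>tens x y\<close> are products of coordinates, coordinates of
  relations are divisible by \<open>e\<close>, and divisibility of a fixed coefficient is inherited
  by sums.\<close>

lemma coeff_dvd:
  assumes e: "\<And>r t. \<lbrakk>r \<in> R \<inter> frags T; t \<in> T\<rbrakk> \<Longrightarrow> e t dvd Poly_Mapping.lookup (frag_extend p r) t"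
    and ij: "i \<in> T" "j \<in> T"
  shows "z \<in> tspan (R \<inter> frags T) (Y \<inter> frags T) \<Longrightarrow> e i dvd Poly_Mapping.lookup (tmap p p z) (i, j)"
    and "z \<in> tspan (Y \<inter> frags T) (R \<inter> frags T) \<Longrightarrow> e j dvd Poly_Mapping.lookup (tmap p p z) (i, j)"
    and "z \<in> tspan (R \<inter> frags T) (R \<inter> frags T) \<Longrightarrow> e i * e j dvd Poly_Mapping.lookup (tmap p p z) (i, j)"
proof -
  have *: "e i dvd Poly_Mapping.lookup (frag_extend p r) i" "e j dvd Poly_Mapping.lookup (frag_extend p r) j"
    if "r \<in> R" "r \<in> frags T" for r
    using e that ij by auto
  show "e i dvd Poly_Mapping.lookup (tmap p p z) (i, j)" if "z \<in> tspan (R \<inter> frags T) (Y \<inter> frags T)"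
  proof -
    have "tmap p p z \<in> {z. e i dvd Poly_Mapping.lookup z (i, j)}"
      using that by (rule tspan_map)
        (use * in \<open>auto simp: tmap_diff lookup_tens lookup_dvd_subspace intro: dvd_mult dvd_mult2 mult_dvd_mono\<close>)
    then show ?thesis
      by simp
  qed
  show "e j dvd Poly_Mapping.lookup (tmap p p z) (i, j)" if "z \<in> tspan (Y \<inter> frags T) (R \<inter> frags T)"
  proof -
    have "tmap p p z \<in> {z. e j dvd Poly_Mapping.lookup z (i, j)}"
      using that by (rule tspan_map)
        (use * in \<open>auto simp: tmap_diff lookup_tens lookup_dvd_subspace intro: dvd_mult dvd_mult2 mult_dvd_mono\<close>)
    then show ?thesis
      by simp
  qed
  show "e i * e j dvd Poly_Mapping.lookup (tmap p p z) (i, j)" if "z \<in> tspan (R \<inter> frags T) (R \<inter> frags T)"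
  proof -
    have "tmap p p z \<in> {z. e i * e j dvd Poly_Mapping.lookup z (i, j)}"
      using that by (rule tspan_map)
        (use * in \<open>auto simp: tmap_diff lookup_tens lookup_dvd_subspace intro: dvd_mult dvd_mult2 mult_dvd_mono\<close>)
    then show ?thesis
      by simp
  qed
qed

text \<open>The converse of \<open>coeff_dvd\<close> for a single term: a sufficiently divisible
  scalar can be moved onto the factor or factors that it turns into relations.\<close>

lemma cmul_tens_in:
  assumes "y \<in> F" "y' \<in> F" "frag_cmul m y \<in> R" "frag_cmul m' y' \<in> R"
  shows "m dvd n \<Longrightarrow> frag_cmul n (tens y y') \<in> RF"
    and "m' dvd n \<Longrightarrow> frag_cmul n (tens y y') \<in> FR"
    and "m * m' dvd n \<Longrightarrow> frag_cmul n (tens y y') \<in> RR"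
    and "m dvd n \<Longrightarrow> frag_cmul n (tens y y' + tens y' y) \<in> N"
    and "m * m dvd n \<Longrightarrow> frag_cmul n (tens y y) \<in> N"
proof -
  note sc = frag.subspace_scale[OF subspace_R]
  show "frag_cmul n (tens y y') \<in> RF" if n: "m dvd n"
  proof -
    obtain d where "n = d * m"
      using n by (metis dvdE mult.commute)
    then have "frag_cmul n (tens y y') = tens (frag_cmul d (frag_cmul m y)) y'"
      by (simp add: tens_cmul)
    then show ?thesis
      using sc[OF assms(3), of d] assms(2) by (metis tens_in_tspan)
  qed
  show "frag_cmul n (tens y y') \<in> FR" if n: "m' dvd n"
  proof -
    obtain d where "n = d * m'"
      using n by (metis dvdE mult.commute)
    then have "frag_cmul n (tens y y') = tens y (frag_cmul d (frag_cmul m' y'))"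
      by (simp add: tens_cmul)
    then show ?thesis
      using sc[OF assms(4), of d] assms(1) by (metis tens_in_tspan)
  qed
  show "frag_cmul n (tens y y') \<in> RR" if n: "m * m' dvd n"
  proof -
    obtain d where "n = d * (m * m')"
      using n by (metis dvdE mult.commute)
    then have "frag_cmul n (tens y y') = tens (frag_cmul d (frag_cmul m y)) (frag_cmul m' y')"
      by (simp add: tens_cmul ac_simps)
    then show ?thesis
      using sc[OF assms(3), of d] assms(4) by (metis tens_in_tspan)
  qed
  show "frag_cmul n (tens y y' + tens y' y) \<in> N" if n: "m dvd n"
  proof -
    obtain d where "n = d * m"
      using n by (metis dvdE mult.commute)
    then have "frag_cmul n (tens y y' + tens y' y) =
        tens (frag_cmul d (frag_cmul m y)) y' + tens y' (frag_cmul d (frag_cmul m y))"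
      by (simp add: tens_cmul frag_cmul_distrib2)
    then show ?thesis
      using sc[OF assms(3), of d] assms(2) by (metis N_intros(1))
  qed
  show "frag_cmul n (tens y y) \<in> N" if n: "m * m dvd n"
  proof -
    obtain d where "n = d * (m * m)"
      using n by (metis dvdE mult.commute)
    then have "frag_cmul n (tens y y) = frag_cmul d (tens (frag_cmul m y) (frag_cmul m y))"
      by (simp add: tens_cmul ac_simps)
    then show ?thesis
      using N_intros(2)[OF assms(3)] by (simp add: frag.subspace_scale)
  qed
qed

text \<open>An invariant class of K/RR has \<open>n (i, j)\<close> and \<open>n (j, i)\<close>
  congruent modulo \<open>e i * e j\<close>, so replacing one by the other changes the element by
  \<open>RR\<close> only. In other words, the first cohomology of the group of order two in
  \<open>RR\<close> is no obstruction, because that group permutes a basis of R \<otimes> R.\<close>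

lemma symmetric_representative:
  assumes k: "k \<in> K" and fl: "flip k - k \<in> RR"
  shows "\<exists>k'\<in>K. flip k' = k' \<and> k' - k \<in> RR"
proof -
  have le: "R \<subseteq> F" "F \<subseteq> F"
    using R_le by auto
  obtain T1 T2 T3 where T: "finite T1" "T1 \<subseteq> S" "k \<in> tspan (R \<inter> frags T1) (F \<inter> frags T1)"
    "finite T2" "T2 \<subseteq> S" "k \<in> tspan (F \<inter> frags T2) (R \<inter> frags T2)"
    "finite T3" "T3 \<subseteq> S" "flip k - k \<in> tspan (R \<inter> frags T3) (R \<inter> frags T3)"
    using k fl tspan_finite_support le unfolding K_def by (metis IntE)
  define T where "T = T1 \<union> T2 \<union> T3"
  have fT: "finite T" "T \<subseteq> S"
    using T by (auto simp: T_def)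
  have kT: "k \<in> tspan (R \<inter> frags T) (F \<inter> frags T)" "k \<in> tspan (F \<inter> frags T) (R \<inter> frags T)"
    "flip k - k \<in> tspan (R \<inter> frags T) (R \<inter> frags T)"
    by (rule tspan_widen[OF _ T(3)] tspan_widen[OF _ T(6)] tspan_widen[OF _ T(9)]; auto simp: T_def)+
  obtain y p e where y: "\<And>t. t \<in> T \<Longrightarrow> y t \<in> F" and ye: "\<And>t. t \<in> T \<Longrightarrow> frag_cmul (e t :: int) (y t) \<in> R"
    and e: "\<And>r t. \<lbrakk>r \<in> R \<inter> frags T; t \<in> T\<rbrakk> \<Longrightarrow> e t dvd Poly_Mapping.lookup (frag_extend p r) t"
    and pz: "\<And>z. z \<in> frags (T \<times> T) \<Longrightarrow> tmap p p z \<in> frags (T \<times> T)"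
    and yp: "\<And>z. z \<in> frags (T \<times> T) \<Longrightarrow> tmap y y (tmap p p z) = z"
    using local_coordinates[OF fT] by metis
  define n where "n = tmap p p k"
  have kTT: "k \<in> frags (T \<times> T)"
    using kT(1) tspan_mono[of "R \<inter> frags T" "frags T" "F \<inter> frags T" "frags T"]
    unfolding frags_Times_eq_tspan by blast
  then have n: "n \<in> frags (T \<times> T)" "tmap y y n = k"
    using pz yp by (auto simp: n_def)
  have dvd: "e i dvd Poly_Mapping.lookup n (i, j)" "e j dvd Poly_Mapping.lookup n (i, j)"
    "e i * e j dvd Poly_Mapping.lookup n (j, i) - Poly_Mapping.lookup n (i, j)"
    if "i \<in> T" "j \<in> T" for i j
    using coeff_dvd(1)[OF e that kT(1)] coeff_dvd(2)[OF e that kT(2)] coeff_dvd(3)[OF e that kT(3)]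
    by (simp_all add: n_def tmap_diff tmap_flip lookup_minus lookup_flip)
  have sTT: "symz n \<in> frags (T \<times> T)"
    using n(1) unfolding symz_def
    by (rule frag_extend_in) auto
  note V = cmul_tens_in[OF y y ye ye]
  show ?thesis
  proof (intro bexI conjI)
    show "flip (tmap y y (symz n)) = tmap y y (symz n)"
      by (simp add: flip_symz flip: tmap_flip)
    have "tmap y y (symz n - n) \<in> RR"
      unfolding tmap_def
    proof (rule frag_extend_Times_in)
      fix i j assume ij: "i \<in> T" "j \<in> T"
      \<comment> \<open>The coefficient is 0 where \<open>symz\<close> keeps \<open>n\<close> and
        \<open>n (j, i) - n (i, j)\<close> where it reflects.\<close>
      have "e i * e j dvd Poly_Mapping.lookup (symz n - n) (i, j)"
        using dvd(3)[OF ij] by (auto simp: lookup_symz lookup_minus)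
      then show "frag_cmul (Poly_Mapping.lookup (symz n - n) (i, j)) (case (i, j) of (a, b) \<Rightarrow> tens (y a) (y b)) \<in> RR"
        using V(3)[OF ij ij] by simp
    qed (use n sTT in \<open>auto intro: frag.subspace_diff\<close>)
    then show "tmap y y (symz n) - k \<in> RR"
      using n(2) by (simp add: tmap_diff)
    then have "tmap y y (symz n) - k + k \<in> K"
      using RR_le k by (intro frag.subspace_add) auto
    then show "tmap y y (symz n) \<in> K"
      by simp
  qed
qed

text \<open>A symmetric \<open>n\<close> equals \<open>symz n\<close>, so \<open>k\<close> is a sum
  of diagonal terms and of multiples of y_i \<otimes> y_j + y_j \<otimes> y_i. Since one factor of
  the original tensors is a relation, the latter lie in \<open>N\<close>; all that depends on the
  application is the diagonal, left to the hypothesis \<open>diag\<close>.\<close>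

lemma symmetric_coordinates:
  assumes "flip k = k" and X: "k \<in> tspan X Y" "X \<subseteq> F" "Y \<subseteq> F" and V: "frag.subspace V"
    and diag: "\<And>T y p e t. \<lbrakk>y t \<in> F; frag_cmul (e t :: int) (y t) \<in> R; t \<in> T;
      \<And>r t. \<lbrakk>r \<in> R \<inter> frags T; t \<in> T\<rbrakk> \<Longrightarrow> e t dvd Poly_Mapping.lookup (frag_extend p r) t;
      k \<in> tspan (X \<inter> frags T) (Y \<inter> frags T)\<rbrakk> \<Longrightarrow>
      frag_cmul (Poly_Mapping.lookup (tmap p p k) (t, t)) (tens (y t) (y t)) \<in> V"
    and "N \<subseteq> V" "X = R \<or> Y = R"
  shows "k \<in> V"
proof -
  obtain T where T: "finite T" "T \<subseteq> S" and kT: "k \<in> tspan (X \<inter> frags T) (Y \<inter> frags T)"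
    using tspan_finite_support[OF X] by blast
  obtain y p e where y: "\<And>t. t \<in> T \<Longrightarrow> y t \<in> F" and ye: "\<And>t. t \<in> T \<Longrightarrow> frag_cmul (e t :: int) (y t) \<in> R"
    and e: "\<And>r t. \<lbrakk>r \<in> R \<inter> frags T; t \<in> T\<rbrakk> \<Longrightarrow> e t dvd Poly_Mapping.lookup (frag_extend p r) t"
    and pz: "\<And>z. z \<in> frags (T \<times> T) \<Longrightarrow> tmap p p z \<in> frags (T \<times> T)"
    and yp: "\<And>z. z \<in> frags (T \<times> T) \<Longrightarrow> tmap y y (tmap p p z) = z"
    using local_coordinates[OF T] by metis
  define n where "n = tmap p p k"
  have kTT: "k \<in> frags (T \<times> T)"
    using kT tspan_mono[of "X \<inter> frags T" "frags T" "Y \<inter> frags T" "frags T"]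
    unfolding frags_Times_eq_tspan by blast
  then have n: "n \<in> frags (T \<times> T)" "tmap y y n = k"
    using pz yp by (auto simp: n_def)
  have "flip n = n"
    using assms(1) unfolding n_def by (simp flip: tmap_flip)
  then have "k = tmap y y (symz n)"
    using n(2) by (simp add: symz_sym)
  also have "\<dots> \<in> V"
    unfolding tmap_symz using n(1) V
  proof (rule frag_extend_Times_in)
    fix i j assume ij: "i \<in> T" "j \<in> T"
    \<comment> \<open>Either divisibility will do, as the symmetric sum contains both
      orders.\<close>
    have "e i dvd Poly_Mapping.lookup n (i, j) \<or> e j dvd Poly_Mapping.lookup n (i, j)"
      using coeff_dvd(1,2)[OF e ij, of k] kT assms(8) unfolding n_def by blast
    then have "frag_cmul (Poly_Mapping.lookup n (i, j)) (tens (y i) (y j) + tens (y j) (y i)) \<in> V"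
      using cmul_tens_in(4)[OF y y ye ye, OF ij ij] cmul_tens_in(4)[OF y y ye ye, OF ij(2,1) ij(2,1)] assms(7)
      by (auto simp: add.commute)
    moreover have "frag_cmul (Poly_Mapping.lookup n (i, i)) (tens (y i) (y i)) \<in> V"
      unfolding n_def by (rule diag[OF y ye _ e kT]) (use ij in auto)
    ultimately show "frag_cmul (Poly_Mapping.lookup n (i, j))
        (case (i, j) of (i, j) \<Rightarrow> if i = j then tens (y i) (y i)
          else if precedes i j then tens (y i) (y j) + tens (y j) (y i) else 0) \<in> V"
      using frag.subspace_0[OF V] by auto
  qed
  finally show ?thesis .
qed

text \<open>On the diagonal \<open>e t * e t\<close> divides the coefficient, which gives a multiple
  of the square of the relation \<open>frag_cmul (e t) (y t)\<close>. This will make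
  \<open>theta\<close> independent of representatives.\<close>

lemma symmetric_RR_le_N:
  assumes "k \<in> RR" "flip k = k"
  shows "k \<in> N"
proof (rule symmetric_coordinates[OF assms(2,1) R_le R_le subspace_N])
  fix T y p e t assume *: "y t \<in> F" "frag_cmul (e t :: int) (y t) \<in> R" "t \<in> T"
    "\<And>r t. \<lbrakk>r \<in> R \<inter> frags T; t \<in> T\<rbrakk> \<Longrightarrow> e t dvd Poly_Mapping.lookup (frag_extend p r) t"
    "k \<in> tspan (R \<inter> frags T) (R \<inter> frags T)"
  show "frag_cmul (Poly_Mapping.lookup (tmap p p k) (t, t)) (tens (y t) (y t)) \<in> N"
    by (rule cmul_tens_in(5)[OF *(1,1,2,2)]) (rule coeff_dvd(3)[OF *(4) *(3,3,5)])
qed auto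

text \<open>On the diagonal only \<open>e t\<close> divides the coefficient n, so n (y \<otimes> y)
  with n y in \<open>R\<close> survives. These are the classes that produce the kernel of
  \<Psi>.\<close>

lemma symmetric_K_generators:
  assumes "k \<in> K" "flip k = k"
  shows "k \<in> frag.span (N \<union> {frag_cmul n (tens y y) | n y. y \<in> F \<and> frag_cmul n y \<in> R})"
  using assms(2)
proof (rule symmetric_coordinates[where X = R and Y = F])
  show "k \<in> tspan R F"
    using assms(1) by (simp add: K_def)
  fix T y p e t assume *: "y t \<in> F" "frag_cmul (e t :: int) (y t) \<in> R" "t \<in> T"
    "\<And>r t. \<lbrakk>r \<in> R \<inter> frags T; t \<in> T\<rbrakk> \<Longrightarrow> e t dvd Poly_Mapping.lookup (frag_extend p r) t"
    "k \<in> tspan (R \<inter> frags T) (F \<inter> frags T)"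
  obtain d where d: "Poly_Mapping.lookup (tmap p p k) (t, t) = d * e t"
    using coeff_dvd(1)[OF *(4) *(3,3,5)] by (metis dvdE mult.commute)
  then have "frag_cmul (Poly_Mapping.lookup (tmap p p k) (t, t)) (y t) \<in> R"
    using frag.subspace_scale[OF subspace_R *(2), of d] by simp
  then show "frag_cmul (Poly_Mapping.lookup (tmap p p k) (t, t)) (tens (y t) (y t)) \<in>
      frag.span (N \<union> {frag_cmul n (tens y y) | n y. y \<in> F \<and> frag_cmul n y \<in> R})"
    using *(1) by (intro frag.span_base) blast
next
  show "N \<subseteq> frag.span (N \<union> {frag_cmul n (tens y y) | n y. y \<in> F \<and> frag_cmul n y \<in> R})"
    by (rule order_trans[OF Un_upper1 frag.span_superset])
qed (use R_le in auto)

text \<open>Membership in both \<open>RF\<close> and \<open>FR\<close> makes each coefficient n at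
  (i, j) divisible by \<open>e i\<close> and by \<open>e j\<close>, so n kills both factors in F/R.
  The terms are thus representatives of standard generators of Tor.\<close>

lemma K_generators:
  assumes k: "k \<in> K"
  shows "k \<in> frag.span (RR \<union> {frag_cmul n (tens x y) | n x y. x \<in> F \<and> y \<in> F \<and> frag_cmul n x \<in> R \<and> frag_cmul n y \<in> R})"
    (is "k \<in> ?V")
proof -
  have le: "R \<subseteq> F" "F \<subseteq> F"
    using R_le by auto
  obtain T1 T2 where T: "finite T1" "T1 \<subseteq> S" "k \<in> tspan (R \<inter> frags T1) (F \<inter> frags T1)"
    "finite T2" "T2 \<subseteq> S" "k \<in> tspan (F \<inter> frags T2) (R \<inter> frags T2)"
    using k tspan_finite_support le unfolding K_def by (metis IntE)
  define T where "T = T1 \<union> T2"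
  have fT: "finite T" "T \<subseteq> S"
    using T by (auto simp: T_def)
  have kT: "k \<in> tspan (R \<inter> frags T) (F \<inter> frags T)" "k \<in> tspan (F \<inter> frags T) (R \<inter> frags T)"
    by (rule tspan_widen[OF _ T(3)] tspan_widen[OF _ T(6)]; auto simp: T_def)+
  obtain y p e where y: "\<And>t. t \<in> T \<Longrightarrow> y t \<in> F" and ye: "\<And>t. t \<in> T \<Longrightarrow> frag_cmul (e t :: int) (y t) \<in> R"
    and e: "\<And>r t. \<lbrakk>r \<in> R \<inter> frags T; t \<in> T\<rbrakk> \<Longrightarrow> e t dvd Poly_Mapping.lookup (frag_extend p r) t"
    and pz: "\<And>z. z \<in> frags (T \<times> T) \<Longrightarrow> tmap p p z \<in> frags (T \<times> T)"
    and yp: "\<And>z. z \<in> frags (T \<times> T) \<Longrightarrow> tmap y y (tmap p p z) = z"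
    using local_coordinates[OF fT] by metis
  have kTT: "k \<in> frags (T \<times> T)"
    using kT(1) tspan_mono[of "R \<inter> frags T" "frags T" "F \<inter> frags T" "frags T"]
    unfolding frags_Times_eq_tspan by blast
  have "tmap y y (tmap p p k) \<in> ?V"
    unfolding tmap_def[of y y]
  proof (rule frag_extend_Times_in[OF pz[OF kTT]])
    fix i j assume ij: "i \<in> T" "j \<in> T"
    let ?n = "Poly_Mapping.lookup (tmap p p k) (i, j)"
    obtain c d where d: "?n = c * e i" "?n = d * e j"
      using coeff_dvd(1)[OF e ij kT(1)] coeff_dvd(2)[OF e ij kT(2)] by (metis dvdE mult.commute)
    have "frag_cmul ?n (y i) \<in> R"
      unfolding d(1) using frag.subspace_scale[OF subspace_R ye[OF ij(1)], of c] by simp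
    moreover have "frag_cmul ?n (y j) \<in> R"
      unfolding d(2) using frag.subspace_scale[OF subspace_R ye[OF ij(2)], of d] by simp
    ultimately show "frag_cmul ?n (case (i, j) of (a, b) \<Rightarrow> tens (y a) (y b)) \<in> ?V"
      using y ij by (intro frag.span_base) auto
  qed simp
  then show ?thesis
    using yp[OF kTT] by simp
qed

end

section \<open>Presented groups as quotients by spans\<close>

lemma generate_eq_span:
  assumes "X \<subseteq> frags S"
  shows "generate (free_Abelian_group S) X = frag.span X"
proof
  have span_le: "frag.span X \<subseteq> frags S"
    by (rule frag.span_minimal[OF assms subspace_frags])
  show "generate (free_Abelian_group S) X \<subseteq> frag.span X"
  proof
    fix h assume "h \<in> generate (free_Abelian_group S) X"
    then show "h \<in> frag.span X"
    proof induction
      case (inv h)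
      then have "Poly_Mapping.keys h \<subseteq> S"
        using assms by (auto simp: frags_def)
      then show ?case
        using inv by (auto intro: frag.span_neg frag.span_base)
    qed (auto intro: frag.span_zero frag.span_base frag.span_add)
  qed
  have sub: "subgroup (generate (free_Abelian_group S) X) (free_Abelian_group S)"
    by (rule subgroup_generate_rels) (use assms in simp)
  have "frag.subspace (generate (free_Abelian_group S) X)"
  proof (rule frag_subspaceI)
    show "0 \<in> generate (free_Abelian_group S) X"
      using generate.one[of "free_Abelian_group S"] by simp
    fix x y assume xy: "x \<in> generate (free_Abelian_group S) X" "y \<in> generate (free_Abelian_group S) X"
    then have "Poly_Mapping.keys y \<subseteq> S"
      using subgroup.mem_carrier[OF sub] by (auto simp: frags_def)
    then have "- y \<in> generate (free_Abelian_group S) X"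
      using subgroup.m_inv_closed[OF sub xy(2)] by simp
    then show "x - y \<in> generate (free_Abelian_group S) X"
      using subgroup.m_closed[OF sub xy(1)] by fastforce
  qed
  then show "frag.span X \<subseteq> generate (free_Abelian_group S) X"
    by (intro frag.span_minimal) (auto intro: generate.incl)
qed

definition pcl :: "'s set \<Rightarrow> ('s \<Rightarrow>\<^sub>0 int) set \<Rightarrow> ('s \<Rightarrow>\<^sub>0 int) \<Rightarrow> ('s \<Rightarrow>\<^sub>0 int) set"
  where "pcl S X x = generate (free_Abelian_group S) X #>\<^bsub>free_Abelian_group S\<^esub> x"

lemma presented_gen_eq_pcl: "presented_gen S X s = pcl S X (frag_of s)"
  by (simp add: presented_gen_def pcl_def)

lemma carrier_presented_pcl: "carrier (presented S X) = pcl S X ` frags S"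
  unfolding carrier_presented pcl_def by simp

lemma pcl_hom:
  assumes "X \<subseteq> frags S"
  shows "group_hom (free_Abelian_group S) (presented S X) (pcl S X)"
proof -
  have "pcl S X \<in> hom (free_Abelian_group S) (presented S X)"
    unfolding pcl_def[abs_def] by (rule presented_proj_hom) (use assms in simp)
  moreover have "comm_group (presented S X)"
    by (rule presented_comm_group) (use assms in simp)
  ultimately show ?thesis
    by (simp add: group_hom_def group_hom_axioms_def comm_group_def)
qed

lemma pcl_eq_one_iff:
  assumes "X \<subseteq> frags S" "x \<in> frags S"
  shows "pcl S X x = \<one>\<^bsub>presented S X\<^esub> \<longleftrightarrow> x \<in> frag.span X"
proof -
  let ?H = "generate (free_Abelian_group S) X"
  have sub: "subgroup ?H (free_Abelian_group S)"
    by (rule subgroup_generate_rels) (use assms in simp)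
  have "pcl S X x = \<one>\<^bsub>presented S X\<^esub> \<longleftrightarrow> ?H #>\<^bsub>free_Abelian_group S\<^esub> x = ?H"
    by (simp add: pcl_def presented_def FactGroup_def)
  also have "\<dots> \<longleftrightarrow> x \<in> ?H"
    using group.coset_join1[OF group_free_Abelian_group _ _ sub] group.coset_join2[OF group_free_Abelian_group _ sub]
      assms(2) by auto
  finally show ?thesis
    by (simp add: generate_eq_span[OF assms(1)])
qed

lemma free_hom_diff:
  assumes "group_hom (free_Abelian_group S) H h" "x \<in> frags S" "y \<in> frags S"
  shows "h (x - y) = h x \<otimes>\<^bsub>H\<^esub> inv\<^bsub>H\<^esub> h y"
proof -
  interpret group_hom "free_Abelian_group S" H h by fact
  have "h (x \<otimes>\<^bsub>free_Abelian_group S\<^esub> inv\<^bsub>free_Abelian_group S\<^esub> y) = h x \<otimes>\<^bsub>H\<^esub> inv\<^bsub>H\<^esub> h y"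
    using assms hom_mult[of x "inv\<^bsub>free_Abelian_group S\<^esub> y"] hom_inv[of y] G.inv_closed[of y]
    by (simp del: inv_free_Abelian_group mult_free_Abelian_group)
  then show ?thesis
    using assms(3) by (simp add: frags_def)
qed

lemma free_hom_zero:
  assumes "group_hom (free_Abelian_group S) H h"
  shows "h 0 = \<one>\<^bsub>H\<^esub>"
  using group_hom.hom_one[OF assms] by simp

lemma pcl_eq_iff:
  assumes "X \<subseteq> frags S" "x \<in> frags S" "y \<in> frags S"
  shows "pcl S X x = pcl S X y \<longleftrightarrow> x - y \<in> frag.span X"
proof -
  interpret group_hom "free_Abelian_group S" "presented S X" "pcl S X"
    by (rule pcl_hom[OF assms(1)])
  have c: "pcl S X x \<in> carrier (presented S X)" "pcl S X y \<in> carrier (presented S X)"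
    using assms by (auto simp: carrier_presented_pcl)
  have "x - y \<in> frag.span X \<longleftrightarrow> pcl S X (x - y) = \<one>\<^bsub>presented S X\<^esub>"
    using pcl_eq_one_iff[OF assms(1), of "x - y"] assms(2,3) by simp
  also have "\<dots> \<longleftrightarrow> pcl S X x \<otimes>\<^bsub>presented S X\<^esub> inv\<^bsub>presented S X\<^esub> pcl S X y = \<one>\<^bsub>presented S X\<^esub>"
    using free_hom_diff[OF group_hom_axioms assms(2,3)] by simp
  also have "\<dots> \<longleftrightarrow> pcl S X x = pcl S X y"
    using c H.inv_equality H.r_inv H.inv_inv H.inv_closed by metis
  finally show ?thesis
    by simp
qed


section \<open>The standard presentation of an abelian group\<close>

abbreviation eps :: "('a, 'm) monoid_scheme \<Rightarrow> ('a \<Rightarrow>\<^sub>0 int) \<Rightarrow> 'a"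
  where "eps A \<equiv> free_lift A (\<lambda>a. a)"

definition rels :: "('a, 'm) monoid_scheme \<Rightarrow> ('a \<Rightarrow>\<^sub>0 int) set"
  where "rels A = {x \<in> frags (carrier A). eps A x = \<one>\<^bsub>A\<^esub>}"

text \<open>The linear lift of \<Psi> to \<open>F\<close>, not the quadratic map x \<mapsto> x
  \<otimes> x.\<close>

definition diag :: "('a \<Rightarrow>\<^sub>0 int) \<Rightarrow> ('a \<times> 'a \<Rightarrow>\<^sub>0 int)"
  where "diag = frag_extend (\<lambda>a. frag_of (a, a))"

lemma diag_of [simp]: "diag (frag_of a) = frag_of (a, a)"
  and diag_diff: "diag (x - y) = diag x - diag y"
  and diag_0 [simp]: "diag 0 = 0"
  by (simp_all add: diag_def frag_extend_diff)

lemma flip_diag [simp]: "flip (diag x) = diag x"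
  by (induction x rule: frag_ext_induct) (auto simp: diag_diff flip_diff)

locale abelian_presentation = comm_group A for A :: "('a, 'm) monoid_scheme" (structure)
begin

lemma comm_group_A: "comm_group A"
  by (rule comm_group_axioms)

lemma eps_hom: "group_hom (free_Abelian_group (carrier A)) A (eps A)"
  using res_proj_hom[OF comm_group_A] unfolding res_F_def
  by (simp add: group_hom_def group_hom_axioms_def is_group)

lemma eps_closed [simp]: "x \<in> frags (carrier A) \<Longrightarrow> eps A x \<in> carrier A"
  using group_hom.hom_closed[OF eps_hom] by simp

lemma eps_of [simp]: "a \<in> carrier A \<Longrightarrow> eps A (frag_of a) = a"
  by (rule free_lift_frag_of[OF comm_group_A])

lemma eps_0 [simp]: "eps A 0 = \<one>"
  by (rule free_hom_zero[OF eps_hom])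

lemmas eps_diff = free_hom_diff[OF eps_hom]

lemma eps_cmul: "x \<in> frags (carrier A) \<Longrightarrow> eps A (frag_cmul n x) = eps A x [^] n"
  using group_hom.hom_int_pow[OF eps_hom, of x n] int_pow_free_Abelian_group[of x "carrier A" n]
  by (simp add: frags_def)

lemma subspace_rels: "frag.subspace (rels A)"
  unfolding rels_def by (rule frag_subspaceI) (auto simp: eps_diff)

sublocale lattice_pair "carrier A" "rels A"
  by standard (simp_all only: subspace_rels, auto simp: rels_def)

lemma rels_iff: "x \<in> F \<Longrightarrow> y \<in> F \<Longrightarrow> x - y \<in> rels A \<longleftrightarrow> eps A x = eps A y"
proof -
  assume xy: "x \<in> F" "y \<in> F"
  have "eps A x \<otimes> inv eps A y = \<one> \<longleftrightarrow> eps A x = eps A y"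
    using xy eps_closed by (metis inv_equality inv_inv inv_closed r_inv)
  then show ?thesis
    using xy by (simp add: rels_def eps_diff)
qed

lemma sub_frag_of_eps: "x \<in> F \<Longrightarrow> x - frag_of (eps A x) \<in> rels A" "x \<in> F \<Longrightarrow> frag_of (eps A x) - x \<in> rels A"
  by (simp_all add: rels_iff)

lemma rels_le: "r \<in> rels A \<Longrightarrow> r \<in> F"
  using R_le by auto

lemma mult_rel: "a \<in> carrier A \<Longrightarrow> b \<in> carrier A \<Longrightarrow> frag_of (a \<otimes> b) - frag_of a - frag_of b \<in> rels A"
proof -
  assume ab: "a \<in> carrier A" "b \<in> carrier A"
  have "frag_of (a \<otimes> b) - frag_of a - frag_of b \<in> rels A \<longleftrightarrow> a \<otimes> b \<otimes> inv a \<otimes> inv b = \<one>"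
    using ab by (simp add: rels_def eps_diff)
  then show ?thesis
    using comm_group_diff_eq_iff[OF comm_group_A, of "a \<otimes> b" a b] ab by simp
qed

lemma inv_rel: "a \<in> carrier A \<Longrightarrow> frag_of (inv a) + frag_of a \<in> rels A"
  using rels_iff[of "frag_of (inv a)" "- frag_of a"] eps_diff[of 0 "frag_of a"] by simp


subsection \<open>The tensor square\<close>

abbreviation "tcl \<equiv> pcl (carrier A \<times> carrier A) (tensor_rels A A)"

lemma tensor_rels_le: "tensor_rels A A \<subseteq> frags (carrier A \<times> carrier A)"
  using tensor_rels_subset[OF comm_group_A comm_group_A] by simp

lemma tcl_hom: "group_hom (free_Abelian_group (carrier A \<times> carrier A)) (tensor A A) tcl"
  unfolding tensor_def by (rule pcl_hom[OF tensor_rels_le])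

lemma tcl_of: "tcl (frag_of (a, b)) = tensor_elem A A a b"
  by (simp add: tensor_elem_def presented_gen_eq_pcl)

lemma tensor_elem_hom:
  assumes "c \<in> carrier A"
  shows "group_hom A (tensor A A) (\<lambda>a. tensor_elem A A a c)" "group_hom A (tensor A A) (tensor_elem A A c)"
proof -
  have "comm_group (tensor A A)"
    by (rule tensor_comm_group[OF comm_group_A comm_group_A])
  then show "group_hom A (tensor A A) (\<lambda>a. tensor_elem A A a c)" "group_hom A (tensor A A) (tensor_elem A A c)"
    using bilinear_tensor_elem[OF comm_group_A comm_group_A] assms is_group
    by (simp_all add: bilinear_map_def group_hom_def group_hom_axioms_def comm_group_def)
qed

lemma tensor_elem_one:
  assumes "c \<in> carrier A"
  shows "tensor_elem A A \<one> c = \<one>\<^bsub>tensor A A\<^esub>" "tensor_elem A A c \<one> = \<one>\<^bsub>tensor A A\<^esub>"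
  using group_hom.hom_one[OF tensor_elem_hom(1)[OF assms]] group_hom.hom_one[OF tensor_elem_hom(2)[OF assms]] .

lemma tensor_elem_diff:
  assumes "a \<in> carrier A" "b \<in> carrier A" "c \<in> carrier A"
  shows "tensor_elem A A (a \<otimes> inv b) c = tensor_elem A A a c \<otimes>\<^bsub>tensor A A\<^esub> inv\<^bsub>tensor A A\<^esub> tensor_elem A A b c"
    and "tensor_elem A A c (a \<otimes> inv b) = tensor_elem A A c a \<otimes>\<^bsub>tensor A A\<^esub> inv\<^bsub>tensor A A\<^esub> tensor_elem A A c b"
  using group_hom.hom_mult[OF tensor_elem_hom(1)[OF assms(3)]] group_hom.hom_inv[OF tensor_elem_hom(1)[OF assms(3)]]
    group_hom.hom_mult[OF tensor_elem_hom(2)[OF assms(3)]] group_hom.hom_inv[OF tensor_elem_hom(2)[OF assms(3)]]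
    assms(1,2) by simp_all

lemma tcl_tens:
  assumes "x \<in> F" "y \<in> F"
  shows "tcl (tens x y) = tensor_elem A A (eps A x) (eps A y)"
  using assms(1)
proof (induction rule: frags_induct)
  case zero
  then show ?case
    using assms(2) by (simp add: free_hom_zero[OF tcl_hom] tensor_elem_one tensor_elem_diff)
next
  case (of a)
  show ?case
    using assms(2)
    by (induction rule: frags_induct)
      (use of in \<open>simp_all add: free_hom_zero[OF tcl_hom] tensor_elem_one tensor_elem_diff tcl_of tens_diff_right
        free_hom_diff[OF tcl_hom] tens_in_frags eps_diff\<close>)
next
  case (diff x x')
  then show ?case
    using assms(2)
    by (simp add: tensor_elem_one tensor_elem_diff tens_diff_left free_hom_diff[OF tcl_hom] tens_in_frags eps_diff)
qed

text \<open>The defining relations are relations of \<open>A\<close> tensored with a basis element.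
  For the converse no generators of \<open>rels A\<close> are chosen: \<open>tcl\<close> evaluates
  \<open>tens x y\<close> to the tensor of the values in \<open>A\<close>, which is trivial as soon
  as one value is.\<close>

lemma span_tensor_rels: "frag.span (tensor_rels A A) = J"
proof
  have "frag_of (a \<otimes> a', b) - frag_of (a, b) - frag_of (a', b) \<in> J"
    if "a \<in> carrier A" "a' \<in> carrier A" "b \<in> carrier A" for a a' b
  proof -
    have "tens (frag_of (a \<otimes> a') - frag_of a - frag_of a') (frag_of b) \<in> RF"
      using that mult_rel by (intro tens_in_tspan) auto
    then show ?thesis
      using RF_le_J by (auto simp: tens_diff_left)
  qed
  moreover have "frag_of (a, b \<otimes> b') - frag_of (a, b) - frag_of (a, b') \<in> J"
    if "a \<in> carrier A" "b \<in> carrier A" "b' \<in> carrier A" for a b b'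
  proof -
    have "tens (frag_of a) (frag_of (b \<otimes> b') - frag_of b - frag_of b') \<in> FR"
      using that mult_rel by (intro tens_in_tspan) auto
    then show ?thesis
      using FR_le_J by (auto simp: tens_diff_right)
  qed
  ultimately show "frag.span (tensor_rels A A) \<subseteq> J"
    unfolding tensor_rels_def by (intro frag.span_minimal) auto
  have iff: "z \<in> frag.span (tensor_rels A A) \<longleftrightarrow> tcl z = \<one>\<^bsub>tensor A A\<^esub>" if "z \<in> frags (carrier A \<times> carrier A)" for z
    using pcl_eq_one_iff[OF tensor_rels_le that] by (simp add: tensor_def)
  have mem: "tens x y \<in> frag.span (tensor_rels A A)"
    if "x \<in> F" "y \<in> F" "eps A x = \<one> \<or> eps A y = \<one>" for x y
    using that by (subst iff) (auto simp: tens_in_frags tcl_tens tensor_elem_one)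
  have "RF \<union> FR \<subseteq> frag.span (tensor_rels A A)"
    unfolding tspan_def Un_subset_iff
    by (intro conjI frag.span_minimal frag.subspace_span) (auto intro!: mem simp: rels_def)
  then show "J \<subseteq> frag.span (tensor_rels A A)"
    unfolding J_def by (intro frag.span_minimal) auto
qed

lemma tcl_eq_one_iff: "z \<in> frags (carrier A \<times> carrier A) \<Longrightarrow> tcl z = \<one>\<^bsub>tensor A A\<^esub> \<longleftrightarrow> z \<in> J"
  using pcl_eq_one_iff[OF tensor_rels_le, of z] by (simp add: tensor_def span_tensor_rels)


subsection \<open>The quadratic functor\<close>

abbreviation "pol \<equiv> polarization A"

definition Grel :: "('a \<Rightarrow>\<^sub>0 int) set"
  where "Grel = frag.span (Gamma_rels A)"

lemma subspace_Grel [simp]: "frag.subspace Grel"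
  by (simp add: Grel_def)

lemmas Grel_add = frag.subspace_add[OF subspace_Grel]
lemmas Grel_diff = frag.subspace_diff[OF subspace_Grel]
lemmas Grel_neg = frag.subspace_neg[OF subspace_Grel]

lemma pol_left: "\<lbrakk>a \<in> carrier A; a' \<in> carrier A; b \<in> carrier A\<rbrakk> \<Longrightarrow> pol (a \<otimes> a') b - pol a b - pol a' b \<in> Grel"
  unfolding Grel_def Gamma_rels_def by (rule frag.span_base) blast

lemma frag_of_inv: "a \<in> carrier A \<Longrightarrow> frag_of a - frag_of (inv a) \<in> Grel"
  unfolding Grel_def Gamma_rels_def by (rule frag.span_base) blast

lemma pol_sym: "\<lbrakk>a \<in> carrier A; b \<in> carrier A\<rbrakk> \<Longrightarrow> pol a b = pol b a"
  by (simp add: polarization_def m_comm)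

lemma pol_one: "b \<in> carrier A \<Longrightarrow> pol \<one> b \<in> Grel"
  using pol_left[of \<one> \<one> b] Grel_neg[of "- pol \<one> b"] by simp

lemma frag_of_one: "frag_of \<one> \<in> Grel"
  using pol_one[of \<one>] Grel_neg[of "- frag_of \<one>"] by (simp add: polarization_def)

lemma pol_inv: "\<lbrakk>a \<in> carrier A; b \<in> carrier A\<rbrakk> \<Longrightarrow> pol (inv a) b + pol a b \<in> Grel"
  using Grel_diff[OF pol_one[of b] pol_left[of a "inv a" b]] by (simp add: add.commute)

lemma pol_diff: "\<lbrakk>a \<in> carrier A; b \<in> carrier A; c \<in> carrier A\<rbrakk> \<Longrightarrow> pol (a \<otimes> inv b) c - pol a c + pol b c \<in> Grel"
  using Grel_add[OF pol_left[of a "inv b" c] pol_inv[of b c]] by (simp add: algebra_simps)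

text \<open>This is \<gamma>(2a) = 4 \<gamma>(a). The polarization at (-a, a) is \<gamma>(0) - 2
  \<gamma>(a), and by linearity it is the negative of the one at (a, a).\<close>

lemma pol_self: "a \<in> carrier A \<Longrightarrow> pol a a - frag_of a - frag_of a \<in> Grel"
proof -
  assume a: "a \<in> carrier A"
  have "pol (inv a) a = frag_of \<one> - frag_of (inv a) - frag_of a"
    using a by (simp add: polarization_def)
  then have eq: "pol a a - frag_of a - frag_of a =
      (pol (inv a) a + pol a a) - (frag_of a - frag_of (inv a)) - frag_of \<one>"
    by simp
  show ?thesis
    by (subst eq) (intro Grel_diff pol_inv frag_of_inv frag_of_one a)
qed

text \<open>The polarization at (-b, a) is computed once from its definition and once by linearity
  in -b.\<close>

lemma frag_of_diff: "\<lbrakk>a \<in> carrier A; b \<in> carrier A\<rbrakk> \<Longrightarrow>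
    frag_of (a \<otimes> inv b) - (frag_of a - pol a b + frag_of b) \<in> Grel"
proof -
  assume ab: "a \<in> carrier A" "b \<in> carrier A"
  have "pol (inv b) a + pol b a \<in> Grel" "frag_of b - frag_of (inv b) \<in> Grel"
    using ab by (simp_all add: pol_inv frag_of_inv)
  then have "pol (inv b) a + pol b a - (frag_of b - frag_of (inv b)) \<in> Grel"
    by (rule Grel_diff)
  moreover have "pol (inv b) a + pol b a - (frag_of b - frag_of (inv b)) =
      frag_of (a \<otimes> inv b) - (frag_of a - pol a b + frag_of b)"
    using ab pol_sym[of a b] by (simp add: polarization_def[of A "inv b" a] m_comm)
  ultimately show ?thesis
    by simp
qed

text \<open>
  On symmetric elements \<open>mu\<close> is the map to \<open>Gamma A\<close> with \<open>[a] \<otimes> [a] \<mapsto> \<gamma>(a)\<close> and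
  \<open>[a] \<otimes> [b] + [b] \<otimes> [a] \<mapsto> \<gamma>(a + b) - \<gamma>(a) - \<gamma>(b)\<close>.
\<close>

definition mu :: "('a \<times> 'a \<Rightarrow>\<^sub>0 int) \<Rightarrow> ('a \<Rightarrow>\<^sub>0 int)"
  where "mu = frag_extend (\<lambda>(s, t). if s = t then frag_of s else if precedes s t then pol s t else 0)"

lemma mu_diff: "mu (z - w) = mu z - mu w"
  and mu_add: "mu (z + w) = mu z + mu w"
  and mu_0 [simp]: "mu 0 = 0"
  by (simp_all add: mu_def frag_extend_diff frag_extend_add)

lemma pol_in_F [simp]: "\<lbrakk>a \<in> carrier A; b \<in> carrier A\<rbrakk> \<Longrightarrow> pol a b \<in> F"
  using keys_polarization[OF comm_group_A] by (simp add: frags_def)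

lemma mu_in_F: "z \<in> frags (carrier A \<times> carrier A) \<Longrightarrow> mu z \<in> F"
  unfolding mu_def by (erule frag_extend_in) auto

text \<open>Both terms are biadditive modulo \<open>Grel\<close>, so basis elements suffice.\<close>

lemma mu_tens:
  assumes "x \<in> F" "y \<in> F"
  shows "mu (tens x y + tens y x) - pol (eps A x) (eps A y) \<in> Grel"
  using assms(1)
proof (induction rule: frags_induct)
  case zero
  then show ?case
    using pol_one[of "eps A y"] assms(2) by (simp add: Grel_neg)
next
  case (of s)
  show ?case
    using assms(2)
  proof (induction rule: frags_induct)
    case zero
    then show ?case
      using pol_one[of s] of by (simp add: Grel_neg pol_sym)
  next
    case t: (of t)
    then show ?case
      using of
    proof (cases s t rule: precedes_cases)
      \<comment> \<open>Here \<open>mu\<close> counts \<open>frag_of s\<close> twice, which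
        \<open>pol_self\<close> compares with the polarization at (s, s).\<close>
      case eq
      then show ?thesis
        using Grel_neg[OF pol_self[OF of]] of by (simp add: mu_add mu_def frag_extend_add algebra_simps)
    qed (auto simp: mu_def frag_extend_add pol_sym frag.subspace_0)
  next
    case (diff y y')
    then have e: "eps A y \<in> carrier A" "eps A y' \<in> carrier A"
      by auto
    have eq: "mu (tens (frag_of s) (y - y') + tens (y - y') (frag_of s)) - pol (eps A (frag_of s)) (eps A (y - y')) =
      (mu (tens (frag_of s) y + tens y (frag_of s)) - pol (eps A (frag_of s)) (eps A y)) -
      (mu (tens (frag_of s) y' + tens y' (frag_of s)) - pol (eps A (frag_of s)) (eps A y')) -
      (pol (eps A y \<otimes> inv eps A y') s - pol (eps A y) s + pol (eps A y') s)"
      using of e diff pol_sym[of s "eps A y \<otimes> inv eps A y'"] pol_sym[OF of e(1)] pol_sym[OF of e(2)]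
      by (simp add: tens_diff_left tens_diff_right mu_add mu_diff eps_diff algebra_simps)
    show ?case
      by (subst eq) (intro Grel_diff diff pol_diff e of)
  qed
next
  case (diff x x')
  then have e: "eps A x \<in> carrier A" "eps A x' \<in> carrier A"
    by auto
  have eq: "mu (tens (x - x') y + tens y (x - x')) - pol (eps A (x - x')) (eps A y) =
    (mu (tens x y + tens y x) - pol (eps A x) (eps A y)) -
    (mu (tens x' y + tens y x') - pol (eps A x') (eps A y)) -
    (pol (eps A x \<otimes> inv eps A x') (eps A y) - pol (eps A x) (eps A y) + pol (eps A x') (eps A y))"
    using diff by (simp add: tens_diff_left tens_diff_right mu_add mu_diff eps_diff algebra_simps)
  show ?case
    by (subst eq) (intro Grel_diff diff pol_diff e eps_closed assms(2))
qed

lemma mu_square: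
  assumes "x \<in> F"
  shows "mu (tens x x) - frag_of (eps A x) \<in> Grel"
  using assms
proof (induction rule: frags_induct)
  case zero
  then show ?case
    using frag_of_one by (simp add: Grel_neg)
next
  case (of a)
  then show ?case
    by (simp add: mu_def frag.subspace_0)
next
  case (diff x y)
  then have e: "eps A x \<in> carrier A" "eps A y \<in> carrier A"
    by auto
  have eq: "mu (tens (x - y) (x - y)) - frag_of (eps A (x - y)) =
     (mu (tens x x) - frag_of (eps A x)) + (mu (tens y y) - frag_of (eps A y))
     - (mu (tens x y + tens y x) - pol (eps A x) (eps A y))
     - (frag_of (eps A x \<otimes> inv eps A y) - (frag_of (eps A x) - pol (eps A x) (eps A y) + frag_of (eps A y)))"
    using diff by (simp add: tens_diff_left tens_diff_right mu_add mu_diff eps_diff)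
  show ?case
    by (subst eq) (intro Grel_diff Grel_add diff mu_tens frag_of_diff e)
qed

text \<open>\<open>eps\<close> sends a relation to the neutral element, so the generators of
  \<open>N\<close> go to polarizations with that element and to its \<gamma>, both trivial in
  \<Gamma>.\<close>

lemma mu_N:
  assumes "z \<in> N"
  shows "mu z \<in> Grel"
  using assms unfolding N_def
proof (rule frag_span_map)
  fix z assume "z \<in> {tens r f + tens f r | r f. r \<in> rels A \<and> f \<in> F} \<union> {tens r r | r. r \<in> rels A}"
  then consider r f where "r \<in> rels A" "f \<in> F" "z = tens r f + tens f r" | r where "r \<in> rels A" "z = tens r r"
    by blast
  then show "mu z \<in> Grel"
  proof cases
    case 1
    then have "mu z - pol \<one> (eps A f) \<in> Grel" "pol \<one> (eps A f) \<in> Grel"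
      using mu_tens[of r f] pol_one by (auto simp: rels_def)
    then show ?thesis
      using Grel_add by fastforce
  next
    case 2
    then have "mu z - frag_of \<one> \<in> Grel"
      using mu_square[of r] by (auto simp: rels_def)
    then show ?thesis
      using Grel_add[OF _ frag_of_one] by fastforce
  qed
qed (auto simp: mu_diff)

lemma mu_diag [simp]: "mu (diag x) = x"
  by (induction x rule: frag_ext_induct) (auto simp: mu_diff diag_diff, simp add: mu_def)

text \<open>Substituting [a + b] = [a] + [b] + r with r a relation and expanding the square, all
  terms without r cancel.\<close>

lemma diag_pol:
  assumes "a \<in> carrier A" "b \<in> carrier A"
  shows "diag (pol a b) - (frag_of (a, b) + frag_of (b, a)) \<in> N"
proof -
  define r where "r = frag_of (a \<otimes> b) - frag_of a - frag_of b"
  have r: "r \<in> rels A"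
    unfolding r_def using mult_rel assms by blast
  have ab: "frag_of (a \<otimes> b) = frag_of a + frag_of b + r"
    by (simp add: r_def)
  have "diag (pol a b) - (frag_of (a, b) + frag_of (b, a)) =
      tens (frag_of (a \<otimes> b)) (frag_of (a \<otimes> b)) - tens (frag_of a) (frag_of a) - tens (frag_of b) (frag_of b)
      - tens (frag_of a) (frag_of b) - tens (frag_of b) (frag_of a)"
    by (simp add: polarization_def diag_diff)
  also have "\<dots> = (tens r (frag_of a + frag_of b) + tens (frag_of a + frag_of b) r) + tens r r"
    unfolding ab tens_add by simp
  also have "\<dots> \<in> N"
    using r assms by (intro frag.subspace_add N_intros) auto
  finally show ?thesis .
qed

lemma diag_Grel:
  assumes "x \<in> Grel"
  shows "diag x \<in> N"
  using assms unfolding Grel_def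
proof (rule frag_span_map)
  note Nd = frag.subspace_diff[OF subspace_N] and Na = frag.subspace_add[OF subspace_N]
  fix x assume x: "x \<in> Gamma_rels A"
  have lin: "diag (pol (a \<otimes> a') b - pol a b - pol a' b) \<in> N"
    if c: "a \<in> carrier A" "a' \<in> carrier A" "b \<in> carrier A" for a a' b
  proof -
    have "diag (pol (a \<otimes> a') b - pol a b - pol a' b) =
      (diag (pol (a \<otimes> a') b) - (frag_of (a \<otimes> a', b) + frag_of (b, a \<otimes> a')))
      - (diag (pol a b) - (frag_of (a, b) + frag_of (b, a)))
      - (diag (pol a' b) - (frag_of (a', b) + frag_of (b, a')))
      + (tens (frag_of (a \<otimes> a') - frag_of a - frag_of a') (frag_of b) +
         tens (frag_of b) (frag_of (a \<otimes> a') - frag_of a - frag_of a'))"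
      by (simp add: diag_diff tens_diff_left tens_diff_right)
    also have "\<dots> \<in> N"
      using c by (intro Na Nd diag_pol N_intros mult_rel) auto
    finally show ?thesis .
  qed
  consider (inv) a where "x = frag_of a - frag_of (inv a)" "a \<in> carrier A" |
    (left) a a' b where "x = pol (a \<otimes> a') b - pol a b - pol a' b" "a \<in> carrier A" "a' \<in> carrier A" "b \<in> carrier A" |
    (right) a a' b where "x = pol b (a \<otimes> a') - pol b a - pol b a'" "b \<in> carrier A" "a \<in> carrier A" "a' \<in> carrier A"
    using x unfolding Gamma_rels_def
    by (elim UnE CollectE exE conjE) blast+
  then show "diag x \<in> N"
  proof cases
    case inv
    \<comment> \<open>The same expansion with [-a] = r - [a]; the square of [a] cancels.\<close>
    define r where "r = frag_of (inv a) + frag_of a"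
    have r: "r \<in> rels A" and i: "frag_of (inv a) = r - frag_of a"
      unfolding r_def using inv_rel[OF inv(2)] by auto
    have "diag x = tens (frag_of a) (frag_of a) - tens (frag_of (inv a)) (frag_of (inv a))"
      by (simp add: inv(1) diag_diff)
    also have "\<dots> = (tens r (frag_of a) + tens (frag_of a) r) - tens r r"
      unfolding i tens_diff_left tens_diff_right by simp
    also have "\<dots> \<in> N"
      using r inv(2) by (intro Nd N_intros) auto
    finally show ?thesis .
  next
    case left
    then show ?thesis
      using lin by simp
  next
    case right
    then show ?thesis
      using lin[OF right(3,4,2)] by (simp add: pol_sym)
  qed
qed (auto simp: diag_diff)

text \<open>\<open>diag\<close> is thus injective from F/Grel, which is \<Gamma>(A), into symmetric
  elements modulo \<open>N\<close>. Together with \<open>diag_mu_sym\<close> it is inverse to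
  \<open>mu\<close>.\<close>

lemma diag_in_N_iff: "diag x \<in> N \<longleftrightarrow> x \<in> Grel"
  using diag_Grel mu_N mu_diag by metis

lemma diag_mu:
  assumes "z \<in> frags (carrier A \<times> carrier A)"
  shows "diag (mu z) - symz z \<in> N"
  using assms
proof (induction rule: frags_induct)
  case (of p)
  obtain s t where p: "p = (s, t)" "s \<in> carrier A" "t \<in> carrier A"
    using of by auto
  then show ?case
    using diag_pol[OF p(2,3)] frag.subspace_0[OF subspace_N] by (simp add: mu_def symz_def)
next
  case (diff x y)
  have "diag (mu (x - y)) - symz (x - y) = (diag (mu x) - symz x) - (diag (mu y) - symz y)"
    by (simp add: mu_diff diag_diff symz_diff)
  then show ?case
    using diff by (simp add: frag.subspace_diff)
qed (auto simp: symz_def frag.subspace_0)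

lemma diag_mu_sym: "\<lbrakk>z \<in> frags (carrier A \<times> carrier A); flip z = z\<rbrakk> \<Longrightarrow> diag (mu z) - z \<in> N"
  using diag_mu symz_sym by metis

end

section \<open>Reduction to the 2-primary part\<close>

lemma int_two_power_odd:
  assumes "n \<noteq> 0"
  obtains f m where "n = 2 ^ f * m" "odd (m :: int)"
proof -
  have "\<exists>f m. n = 2 ^ f * m \<and> odd m" if "n \<noteq> 0" for n :: int
    using that
  proof (induction "nat \<bar>n\<bar>" arbitrary: n rule: less_induct)
    case less
    show ?case
    proof (cases "even n")
      case True
      then obtain k where k: "n = 2 * k"
        by blast
      have "nat \<bar>k\<bar> < nat \<bar>n\<bar>" "k \<noteq> 0"
        using k less(2) by auto
      then obtain f m where "k = 2 ^ f * m" "odd m"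
        using less(1) by blast
      then show ?thesis
        using k by (intro exI[of _ "Suc f"] exI[of _ m]) simp
    next
      case False
      then show ?thesis
        by (intro exI[of _ 0] exI[of _ n]) simp
    qed
  qed
  then show ?thesis
    using assms that by blast
qed

lemma (in comm_group) two_primary_comm_group: "comm_group (two_primary G)"
proof -
  let ?B = "{a \<in> carrier G. \<exists>k::nat. a [^] (2 ^ k :: nat) = \<one>}"
  have "subgroup ?B G"
  proof (rule subgroupI)
    show "?B \<noteq> {}"
      by (auto intro!: exI[of _ "\<one>"] exI[of _ 0])
    show "inv a \<in> ?B" if "a \<in> ?B" for a
      using that by (auto simp: nat_pow_inv)
    show "a \<otimes> b \<in> ?B" if ab: "a \<in> ?B" "b \<in> ?B" for a b
    proof -
      obtain k l where kl: "a [^] (2 ^ k :: nat) = \<one>" "b [^] (2 ^ l :: nat) = \<one>"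
        using ab by auto
      have "(a \<otimes> b) [^] (2 ^ (k + l) :: nat) = (a [^] (2 ^ k :: nat)) [^] (2 ^ l :: nat) \<otimes> (b [^] (2 ^ l :: nat)) [^] (2 ^ k :: nat)"
        using ab by (simp add: pow_mult_distrib m_comm nat_pow_pow power_add mult.commute)
      then show ?thesis
        using ab kl by auto
    qed
  qed auto
  then have "group (two_primary G)"
    unfolding two_primary_def by (rule subgroup_imp_group)
  then show ?thesis
    by (rule group.group_comm_groupI) (auto simp: two_primary_def m_comm)
qed

text \<open>\<open>B\<close> lives on a subset of the carrier of \<open>A\<close>, so its lattices
  lie in the same free group on pairs and are compared with those of \<open>A\<close> by
  inclusion.\<close>

locale primary_part = abelian_presentation A + B: abelian_presentation B
  for A :: "('a, 'm) monoid_scheme" (structure) and B :: "('a, 'm) monoid_scheme" +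
  assumes B_eq: "B = two_primary A"
begin

lemma carrier_B: "b \<in> carrier B \<longleftrightarrow> b \<in> carrier A \<and> (\<exists>k::nat. b [^] (2 ^ k :: nat) = \<one>)"
  by (simp add: B_eq two_primary_def)

lemma carrier_B_le: "carrier B \<subseteq> carrier A"
  by (auto simp: carrier_B)

lemma frags_B_le: "B.F \<subseteq> F"
  by (rule frags_mono[OF carrier_B_le])

lemma eps_B: "x \<in> B.F \<Longrightarrow> eps B x = eps A x"
proof (rule free_lift_unique[where S = "carrier B"])
  have "(\<otimes>\<^bsub>B\<^esub>) = (\<otimes>)"
    by (simp add: B_eq two_primary_def)
  then show "eps B \<in> hom (free_Abelian_group (carrier B)) A"
    using group_hom.homh[OF B.eps_hom] carrier_B_le by (auto simp: hom_def)
qed (use comm_group_A carrier_B_le in \<open>auto simp: frags_def\<close>)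

lemma rels_B: "rels B = rels A \<inter> B.F"
  using eps_B frags_B_le by (auto simp: rels_def B_eq two_primary_def)

lemma K_B_le: "B.K \<subseteq> K"
  unfolding B.K_def K_def using tspan_mono[of "rels B" "rels A" B.F F] tspan_mono[of B.F F "rels B" "rels A"]
    rels_B frags_B_le by auto

lemma N_B_le: "B.N \<subseteq> N"
  unfolding B.N_def N_def using rels_B frags_B_le by (intro frag.span_mono) auto

text \<open>Write n = q m with q a power of 2 and m = 2c + 1. As 2n (y \<otimes> y) is in
  \<open>N\<close>, multiplying n (y \<otimes> y) by m does not change it modulo \<open>N\<close>.
  The result q m^2 (y \<otimes> y) is q times the square of m y, whose value \<open>b\<close> in
  \<open>A\<close> is killed by q.\<close>

lemma primary_representative:
  assumes y: "y \<in> F" and ny: "frag_cmul n y \<in> rels A"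
  shows "\<exists>k\<in>B.K. flip k = k \<and> frag_cmul n (tens y y) - k \<in> N"
proof (cases "n = 0")
  case True
  then show ?thesis
    by (intro bexI[of _ 0]) (auto simp: frag.subspace_0)
next
  case False
  then obtain f m where n: "n = 2 ^ f * m" "odd m"
    by (rule int_two_power_odd)
  obtain c where m: "m = 2 * c + 1"
    using n(2) by (rule oddE)
  define q :: int where "q = 2 ^ f"
  define b where "b = eps A y [^] m"
  have bA: "b \<in> carrier A"
    using y by (simp add: b_def)
  have "b [^] q = eps A y [^] n"
    using y n(1) by (simp add: b_def q_def int_pow_pow mult.commute)
  also have "\<dots> = \<one>"
    using ny y by (simp add: rels_def eps_cmul)
  finally have bq: "b [^] q = \<one>" .
  have q: "q = int (2 ^ f)"
    by (simp add: q_def)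
  have b: "b \<in> carrier B"
    using bA bq unfolding q carrier_B int_pow_int by blast
  have "frag_cmul q (frag_of b) \<in> rels A"
    using bq bA by (simp add: rels_def eps_cmul)
  then have qb: "frag_cmul q (frag_of b) \<in> rels B"
    using b by (simp add: rels_B)
  let ?b = "frag_of b"
  \<comment> \<open>\<open>frag_of b\<close> and \<open>frag_cmul m y\<close> have the same value in
    \<open>A\<close>; \<open>r\<close> accounts for the change of representative.\<close>
  define r where "r = ?b - frag_cmul m y"
  have r: "r \<in> rels A" "?b = frag_cmul m y + r"
    unfolding r_def using y bA by (auto simp: rels_iff eps_cmul b_def)
  have "tens (frag_cmul q ?b) ?b \<in> B.RF" "tens ?b (frag_cmul q ?b) \<in> B.FR"
    using qb b by (auto intro: tens_in_tspan)
  then have "frag_cmul q (tens ?b ?b) \<in> B.K"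
    unfolding B.K_def tens_cmul by (rule IntI)
  moreover have "flip (frag_cmul q (tens ?b ?b)) = frag_cmul q (tens ?b ?b)"
    unfolding flip_cmul flip_tens ..
  moreover have "frag_cmul n (tens y y) - frag_cmul q (tens ?b ?b) \<in> N"
  proof -
    have "frag_cmul n (tens y y) - frag_cmul q (tens ?b ?b) =
        - frag_cmul c (tens (frag_cmul n y) y + tens y (frag_cmul n y))
        - frag_cmul (q * m) (tens r y + tens y r) - frag_cmul q (tens r r)"
    proof -
      have n': "n = q * m"
        using n(1) by (simp add: q_def)
      show ?thesis
        unfolding r(2) tens_add tens_cmul
        by (rule poly_mapping_eqI, simp only: lookup_add lookup_minus lookup_uminus lookup_frag_cmul n' m) algebra
    qed
    also have "\<dots> \<in> N"
      by (intro frag.subspace_diff[OF subspace_N] frag.subspace_neg[OF subspace_N]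
          frag.subspace_scale[OF subspace_N] N_intros r(1) ny y)
    finally show ?thesis .
  qed
  ultimately show ?thesis
    by blast
qed

lemma diag_in_J_representative:
  assumes x: "x \<in> F" and J: "diag x \<in> J"
  shows "\<exists>k\<in>B.K. flip k = k \<and> x - mu k \<in> Grel"
proof -
  obtain u v where uv: "u \<in> RF" "v \<in> FR" "diag x = u + v"
    using J by (rule J_cases)
  \<comment> \<open>By symmetry of \<open>diag x\<close>, this element of \<open>RF\<close> also
    equals \<open>flip u - v\<close>, which lies in \<open>FR\<close> and is its own flip.\<close>
  define k0 where "k0 = u - flip v"
  have "flip (diag x) = diag x"
    by simp
  then have eq: "flip u + flip v = u + v"
    by (simp add: uv(3) flip_add)
  have k0: "k0 = flip u - v"
    unfolding k0_def using eq by (simp add: algebra_simps)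
  have "k0 \<in> K"
    unfolding K_def
  proof
    show "k0 \<in> RF"
      unfolding k0_def by (rule frag.subspace_diff[OF subspace_tspan uv(1) flip_in_tspan[OF uv(2)]])
    show "k0 \<in> FR"
      unfolding k0 by (rule frag.subspace_diff[OF subspace_tspan flip_in_tspan[OF uv(1)] uv(2)])
  qed
  moreover have "flip k0 = k0"
    unfolding k0_def flip_diff flip_flip using eq by (simp add: algebra_simps)
  ultimately have gen: "k0 \<in> frag.span (N \<union> {frag_cmul n (tens y y) | n y. y \<in> F \<and> frag_cmul n y \<in> rels A})"
    by (rule symmetric_K_generators)
  let ?V = "{z. \<exists>k\<in>B.K. flip k = k \<and> z - k \<in> N}"
  have V: "frag.subspace ?V"
  proof (rule frag_subspaceI; clarify)
    show "\<exists>k\<in>B.K. flip k = k \<and> 0 - k \<in> N"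
      by (intro bexI[of _ 0]) (auto simp: frag.subspace_0)
    fix z w k l assume *: "k \<in> B.K" "flip k = k" "z - k \<in> N" "l \<in> B.K" "flip l = l" "w - l \<in> N"
    have "z - w - (k - l) = (z - k) - (w - l)"
      by simp
    also have "\<dots> \<in> N"
      by (rule frag.subspace_diff[OF subspace_N *(3,6)])
    finally show "\<exists>k\<in>B.K. flip k = k \<and> z - w - k \<in> N"
      using * by (intro bexI[of _ "k - l"]) (auto simp: flip_diff frag.subspace_diff)
  qed
  have "k0 \<in> ?V"
    using gen V
  proof (rule frag_span_minimal)
    fix z assume "z \<in> N \<union> {frag_cmul n (tens y y) | n y. y \<in> F \<and> frag_cmul n y \<in> rels A}"
    then show "z \<in> ?V"
    proof
      assume "z \<in> N"
      then show ?thesis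
        by (intro CollectI bexI[of _ 0]) (auto simp: frag.subspace_0)
    qed (use primary_representative in auto)
  qed
  then obtain k where k: "k \<in> B.K" "flip k = k" "k0 - k \<in> N"
    by blast
  have kF: "k \<in> frags (carrier A \<times> carrier A)"
    using k(1) K_B_le RF_le unfolding K_def by blast
  \<comment> \<open>\<open>diag x\<close> is the norm \<open>u + flip u\<close> minus
    \<open>k0\<close>, so it is congruent to -k, whence the sign in the final witness.\<close>
  have "diag x - - k = (u + flip u) - (k0 - k)"
    using k0 by (simp add: uv(3))
  also have "\<dots> \<in> N"
    by (rule frag.subspace_diff[OF subspace_N add_flip_N[OF uv(1)] k(3)])
  finally have "diag x - - k \<in> N" .
  moreover have "diag (mu (- k)) - - k \<in> N"
    using k(2) kF by (intro diag_mu_sym) (auto simp: flip_uminus)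
  ultimately have "(diag x - - k) - (diag (mu (- k)) - - k) \<in> N"
    by (rule frag.subspace_diff[OF subspace_N])
  then have "diag (x - mu (- k)) \<in> N"
    by (simp add: diag_diff)
  then show ?thesis
    using k by (intro bexI[of _ "- k"]) (auto simp: diag_in_N_iff flip_uminus frag.subspace_neg)
qed

text \<open>The norm lies in \<open>B.N\<close> by construction. The error is symmetric and in
  \<open>B.RR\<close>, hence in \<open>B.N\<close> as well.\<close>

lemma norm_class_in_N:
  assumes "k \<in> B.K" "flip k = k" "k1 \<in> B.K" "k - (k1 + flip k1) \<in> B.RR"
  shows "k \<in> N"
proof -
  have "k - (k1 + flip k1) \<in> B.N"
    using assms(2,4) by (intro B.symmetric_RR_le_N) (auto simp: flip_diff flip_add)
  moreover have "k1 + flip k1 \<in> B.N"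
    using assms(3) by (intro B.add_flip_N) (simp add: B.K_def)
  ultimately have "(k - (k1 + flip k1)) + (k1 + flip k1) \<in> B.N"
    by (rule frag.subspace_add[OF B.subspace_N])
  then show ?thesis
    using N_B_le by auto
qed

text \<open>The subgroup of \<open>A\<close> generated by \<open>T\<close> is a sum of cyclic groups
  of orders \<open>e i\<close> up to sign, with 0 for infinite order. Scaling the coordinates by
  integers acting as idempotents projects it onto its 2-primary part.\<close>

lemma local_retraction:
  assumes T: "finite T" "T \<subseteq> carrier A"
  obtains w where "\<And>t. t \<in> T \<Longrightarrow> w t \<in> carrier B" "\<And>t. \<lbrakk>t \<in> T; t \<in> carrier B\<rbrakk> \<Longrightarrow> w t = t"
    "\<And>r. \<lbrakk>r \<in> rels A; r \<in> frags T\<rbrakk> \<Longrightarrow> frag_extend (\<lambda>t. frag_of (w t)) r \<in> rels B"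
proof -
  obtain y p e where y: "\<And>t. t \<in> T \<Longrightarrow> y t \<in> frags T" and p: "\<And>t. t \<in> T \<Longrightarrow> p t \<in> frags T"
    and yp: "\<And>x. x \<in> frags T \<Longrightarrow> frag_extend y (frag_extend p x) = x"
    and e: "\<And>c. c \<in> frags T \<Longrightarrow> frag_extend y c \<in> rels A \<longleftrightarrow> (\<forall>t\<in>T. (e t :: int) dvd Poly_Mapping.lookup c t)"
    by (rule stacked_coordinates[OF subspace_rels T(1)]) (rule that)
  \<comment> \<open>For order 2^f m with m odd, \<open>u\<close> is to be 0 modulo m and 1 modulo
    2^f. The first conjunct puts the image into the 2-primary part, the second fixes everything of
    2-power order. An infinite cyclic summand takes \<open>u = 0\<close>.\<close>
  have "\<exists>u f. e i dvd 2 ^ f * u \<and> (\<forall>c h. e i dvd 2 ^ h * c \<longrightarrow> e i dvd (u - 1) * c)" for i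
  proof (cases "e i = 0")
    case True
    then show ?thesis
      by (intro exI[of _ 0]) auto
  next
    case False
    then obtain f m where fm: "e i = 2 ^ f * m" "odd m"
      by (rule int_two_power_odd)
    have cop: "coprime m (2 ^ h)" for h
      using fm(2) by simp
    \<comment> \<open>Bezout gives the idempotent of the Chinese remainder theorem, a m.\<close>
    obtain a b where ab: "a * m + b * 2 ^ f = 1"
      using bezout_int[of m "2 ^ f"] cop[of f] by (auto simp: coprime_iff_gcd_eq_1)
    show ?thesis
    proof (intro exI conjI allI impI)
      show "e i dvd 2 ^ f * (a * m)"
        by (simp add: fm)
      fix c h assume "e i dvd 2 ^ h * c"
      then have "m dvd 2 ^ h * c"
        unfolding fm(1) by (rule dvd_mult_right)
      then have "m dvd c"
        using cop[of h] by (simp add: coprime_dvd_mult_right_iff)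
      moreover have "2 ^ f dvd a * m - 1"
        using ab by (metis add_diff_cancel_left' dvd_minus_iff dvd_triv_right minus_diff_eq)
      ultimately show "e i dvd (a * m - 1) * c"
        unfolding fm(1) by (intro mult_dvd_mono)
    qed
  qed
  then obtain u f where uf: "\<And>i. e i dvd 2 ^ f i * u i"
    and u1: "\<And>i c h. e i dvd 2 ^ h * c \<Longrightarrow> e i dvd (u i - 1) * c"
    by metis
  define U where "U = frag_extend (\<lambda>i. frag_cmul (u i) (frag_of i))"
  have lookup_U: "Poly_Mapping.lookup (U c) i = u i * Poly_Mapping.lookup c i" for c i
    by (induction c rule: frag_ext_induct) (auto simp: U_def frag_extend_diff lookup_minus algebra_simps)
  have U_in: "U c \<in> frags T" if "c \<in> frags T" for c
    unfolding U_def using that by (rule frag_extend_in) auto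
  define L where "L = (\<lambda>x. frag_extend y (U (frag_extend p x)))"
  have px: "frag_extend p x \<in> frags T" if "x \<in> frags T" for x
    using that by (rule frag_extend_in) (use p in auto)
  have yx: "frag_extend y c \<in> frags T" if "c \<in> frags T" for c
    using that by (rule frag_extend_in) (use y in auto)
  have L_in: "L x \<in> F" if "x \<in> frags T" for x
    unfolding L_def using yx[OF U_in[OF px[OF that]]] frags_mono[OF T(2)] by blast
  have L_diff: "L (x - x') = L x - L x'" for x x'
    by (simp add: L_def U_def frag_extend_diff)
  have L_rels: "L r \<in> rels A" if r: "r \<in> rels A" "r \<in> frags T" for r
  proof -
    have "e t dvd Poly_Mapping.lookup (frag_extend p r) t" if "t \<in> T" for t
      using e[OF px[OF r(2)]] yp[OF r(2)] r(1) that by simp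
    then show ?thesis
      unfolding L_def by (subst e[OF U_in[OF px[OF r(2)]]]) (simp add: lookup_U)
  qed
  \<comment> \<open>\<open>L x\<close> need not be supported on \<open>B\<close>; only its value in
    \<open>A\<close> is 2-primary. Passing to the basis element of that value lands in
    \<open>B.F\<close> and changes \<open>L x\<close> by a relation of \<open>A\<close>.\<close>
  define w where "w t = eps A (L (frag_of t))" for t
  have wA: "w t \<in> carrier A" if "t \<in> T" for t
    using L_in[of "frag_of t"] that by (simp add: w_def)
  have wB: "w t \<in> carrier B" if t: "t \<in> T" for t
  proof -
    \<comment> \<open>One exponent serving all coordinates at once; it bounds each
      \<open>f i\<close>.\<close>
    define h where "h = sum f T"
    have "frag_cmul (2 ^ h) (L (frag_of t)) \<in> rels A"
    proof -
      have eh: "e i dvd 2 ^ h * u i" if "i \<in> T" for i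
      proof -
        have "f i \<le> h"
          unfolding h_def using T(1) that by (simp add: member_le_sum)
        then have "2 ^ f i * u i dvd 2 ^ h * u i"
          by (simp add: le_imp_power_dvd mult_dvd_mono)
        then show ?thesis
          using uf dvd_trans by blast
      qed
      have in_T: "frag_cmul (2 ^ h) (U (frag_extend p (frag_of t))) \<in> frags T"
        using U_in[OF px, of "frag_of t"] t by simp
      have "frag_cmul (2 ^ h) (L (frag_of t)) = frag_extend y (frag_cmul (2 ^ h) (U (frag_extend p (frag_of t))))"
        by (simp add: L_def frag_extend_cmul)
      also have "\<dots> \<in> rels A"
        using eh by (subst e[OF in_T]) (simp add: lookup_U mult.assoc[symmetric])
      finally show ?thesis .
    qed
    then have "w t [^] (2 ^ h :: int) = \<one>"
      using L_in[of "frag_of t"] t by (simp add: rels_def eps_cmul w_def)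
    then have "w t [^] (int (2 ^ h)) = \<one>"
      by simp
    then show ?thesis
      using wA[OF t] unfolding carrier_B int_pow_int by blast
  qed
  have w_id: "w t = t" if t: "t \<in> T" "t \<in> carrier B" for t
  proof -
    obtain h where h: "t [^] (2 ^ h :: nat) = \<one>"
      using t(2) by (auto simp: carrier_B)
    have pt: "frag_extend p (frag_of t) \<in> frags T"
      using px[of "frag_of t"] t by simp
    have "t [^] (int (2 ^ h)) = \<one>"
      using h unfolding int_pow_int .
    then have "frag_cmul (2 ^ h) (frag_of t) \<in> rels A"
      using t T by (auto simp: rels_def eps_cmul)
    then have "frag_extend y (frag_cmul (2 ^ h) (frag_extend p (frag_of t))) \<in> rels A"
      using yp[of "frag_of t"] t(1) unfolding frag_extend_cmul by simp
    then have "\<forall>i\<in>T. e i dvd 2 ^ h * Poly_Mapping.lookup (frag_extend p (frag_of t)) i"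
      using e[of "frag_cmul (2 ^ h) (frag_extend p (frag_of t))"] pt by simp
    then have "\<forall>i\<in>T. e i dvd Poly_Mapping.lookup (U (frag_extend p (frag_of t)) - frag_extend p (frag_of t)) i"
      using u1 by (auto simp: lookup_minus lookup_U left_diff_distrib)
    then have "frag_extend y (U (frag_extend p (frag_of t)) - frag_extend p (frag_of t)) \<in> rels A"
      using e[of "U (frag_extend p (frag_of t)) - frag_extend p (frag_of t)"] pt U_in[OF pt] by simp
    moreover have "frag_extend y (U (frag_extend p (frag_of t)) - frag_extend p (frag_of t)) = L (frag_of t) - frag_of t"
      using yp[of "frag_of t"] t(1) unfolding frag_extend_diff L_def by simp
    ultimately have "L (frag_of t) - frag_of t \<in> rels A"
      by simp
    then show ?thesis
      using rels_iff[of "L (frag_of t)" "frag_of t"] L_in[of "frag_of t"] t T by (auto simp: w_def)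
  qed
  have "frag_extend (\<lambda>t. frag_of (w t)) r \<in> rels B" if r: "r \<in> rels A" "r \<in> frags T" for r
  proof -
    have "frag_extend (\<lambda>t. frag_of (w t)) x - L x \<in> rels A" if "x \<in> frags T" for x
      using that
    proof (induction rule: frags_induct)
      case (of t)
      then show ?case
        using sub_frag_of_eps(2)[OF L_in[of "frag_of t"]] by (simp add: w_def)
    next
      case (diff x x')
      have "frag_extend (\<lambda>t. frag_of (w t)) (x - x') - L (x - x') =
          (frag_extend (\<lambda>t. frag_of (w t)) x - L x) - (frag_extend (\<lambda>t. frag_of (w t)) x' - L x')"
        by (simp add: frag_extend_diff L_diff)
      then show ?case
        using diff by (simp add: frag.subspace_diff[OF subspace_rels])
    qed (simp add: L_def U_def frag.subspace_0[OF subspace_rels])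
    then have "frag_extend (\<lambda>t. frag_of (w t)) r - L r + L r \<in> rels A"
      using r L_rels by (intro frag.subspace_add[OF subspace_rels]) auto
    moreover have "frag_extend (\<lambda>t. frag_of (w t)) r \<in> B.F"
      using r(2) by (rule frag_extend_in) (use wB in auto)
    ultimately show ?thesis
      by (simp add: rels_B)
  qed
  with wB w_id show ?thesis
    by (rule that)
qed

text \<open>Being in \<open>N\<close> yields a norm and squares with factors from \<open>A\<close>.
  A retraction of a finitely generated subgroup onto its 2-primary part carries them into
  \<open>B\<close> and leaves \<open>k\<close> in place.\<close>

lemma N_cap_K_B:
  assumes k: "k \<in> B.K" "k \<in> N"
  shows "\<exists>k1\<in>B.K. k - (k1 + flip k1) \<in> B.RR"
proof -
  obtain y s where y: "y \<in> RF" and s: "s \<in> frag.span {tens r r | r. r \<in> rels A}" and k_eq: "k = y + flip y + s"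
    using k(2) by (rule N_cases)
  have sFR: "s \<in> FR"
  proof (rule frag_span_minimal[OF s subspace_tspan])
    fix z assume "z \<in> {tens r r | r. r \<in> rels A}"
    then obtain r where "z = tens r r" "r \<in> rels A"
      by auto
    then show "z \<in> FR"
      using tens_in_tspan[OF rels_le] by blast
  qed
  have "k \<in> FR"
    using k(1) K_B_le by (auto simp: K_def)
  \<comment> \<open>\<open>y\<close> is only known to lie in \<open>RF\<close>. All other terms of
    the equation for \<open>k\<close> lie in \<open>FR\<close>, hence so does
    \<open>y\<close>.\<close>
  then have "k - s - flip y \<in> FR"
    by (intro frag.subspace_diff[OF subspace_tspan] sFR flip_in_tspan[OF y])
  moreover have "k - s - flip y = y"
    unfolding k_eq by simp
  ultimately have yK: "y \<in> FR"
    by (simp only:)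
  have le: "rels A \<subseteq> F" "rels B \<subseteq> B.F"
    using R_le B.R_le by auto
  obtain T0 where T0: "finite T0" "T0 \<subseteq> carrier B" "k \<in> tspan (rels B \<inter> frags T0) (B.F \<inter> frags T0)"
    using tspan_finite_support[of k "rels B" B.F "carrier B"] k(1) le unfolding B.K_def by blast
  obtain T1 where T1: "finite T1" "T1 \<subseteq> carrier A" "y \<in> tspan (rels A \<inter> frags T1) (F \<inter> frags T1)"
    using tspan_finite_support[OF y le(1)] by blast
  obtain T2 where T2: "finite T2" "T2 \<subseteq> carrier A" "y \<in> tspan (F \<inter> frags T2) (rels A \<inter> frags T2)"
    using tspan_finite_support[OF yK _ le(1)] by blast
  have "\<exists>T. finite T \<and> T \<subseteq> carrier A \<and> s \<in> frag.span {tens r r | r. r \<in> rels A \<inter> frags T}"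
  proof (rule frag_span_directed[OF s])
    fix z assume "z \<in> {tens r r | r. r \<in> rels A}"
    then obtain r where r: "z = tens r r" "r \<in> rels A"
      by auto
    obtain T where "finite T" "T \<subseteq> carrier A" "r \<in> frags T"
      using frag_finite_support[of r "carrier A"] r le by blast
    then show "\<exists>T. finite T \<and> T \<subseteq> carrier A \<and> z \<in> {tens r r |r. r \<in> rels A \<inter> frags T}"
      using r by blast
  qed (use frags_mono in blast)
  then obtain T3 where T3: "finite T3" "T3 \<subseteq> carrier A" "s \<in> frag.span {tens r r | r. r \<in> rels A \<inter> frags T3}"
    by blast
  \<comment> \<open>Room for all witnesses at once: \<open>k\<close> over \<open>B\<close>,
    \<open>y\<close> in \<open>RF\<close> and in \<open>FR\<close>, and \<open>s\<close> as a
    combination of squares.\<close>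
  define T where "T = T0 \<union> T1 \<union> T2 \<union> T3"
  have T: "finite T" "T \<subseteq> carrier A"
    unfolding T_def using T0 T1 T2 T3 carrier_B_le by auto
  have sub: "T0 \<subseteq> T" "T1 \<subseteq> T" "T2 \<subseteq> T" "T3 \<subseteq> T"
    by (auto simp: T_def)
  obtain w where wB: "\<And>t. t \<in> T \<Longrightarrow> w t \<in> carrier B" and w_id: "\<And>t. \<lbrakk>t \<in> T; t \<in> carrier B\<rbrakk> \<Longrightarrow> w t = t"
    and wr: "\<And>r. \<lbrakk>r \<in> rels A; r \<in> frags T\<rbrakk> \<Longrightarrow> frag_extend (\<lambda>t. frag_of (w t)) r \<in> rels B"
    by (rule local_retraction[OF T]) (rule that)
  define W where "W = frag_extend (\<lambda>t. frag_of (w t))"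
  define P where "P = tmap (\<lambda>t. frag_of (w t)) (\<lambda>t. frag_of (w t))"
  have WF: "W x \<in> B.F" if "x \<in> frags T" for x
    unfolding W_def using that by (rule frag_extend_in) (use wB in auto)
  have P_tens: "P (tens x x') = tens (W x) (W x')" for x x'
    by (simp add: P_def W_def)
  have P_diff: "P (z - z') = P z - P z'" for z z'
    by (simp add: P_def tmap_diff)
  have up: "x \<in> frags T" if "x \<in> frags T'" "T' \<subseteq> T" for x T'
    using that frags_mono by blast
  have "P y \<in> B.RF"
    using T1(3)
    by (rule tspan_map) (use sub up WF wr in \<open>auto simp: P_diff P_tens W_def intro!: tens_in_tspan\<close>)
  moreover have "P y \<in> B.FR"
    using T2(3)
    by (rule tspan_map) (use sub up WF wr in \<open>auto simp: P_diff P_tens W_def intro!: tens_in_tspan\<close>)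
  ultimately have "P y \<in> B.K"
    by (simp add: B.K_def)
  moreover have "P s \<in> B.RR"
    using T3(3)
    by (rule frag_span_map) (use sub up WF wr in \<open>auto simp: P_diff P_tens W_def intro!: tens_in_tspan\<close>)
  moreover have "P k = k"
  proof -
    have "k \<in> frags (T0 \<times> T0)"
      using T0(3) tspan_mono[of "rels B \<inter> frags T0" "frags T0" "B.F \<inter> frags T0" "frags T0"]
      unfolding frags_Times_eq_tspan by blast
    moreover have "w t = t" if "t \<in> T0" for t
      by (rule w_id) (use that sub(1) T0(2) in auto)
    ultimately show ?thesis
    proof (induction rule: frags_induct)
      case (of q)
      then show ?case
        by (cases q) (auto simp: P_def)
    qed (auto simp: P_def tmap_diff)
  qed
  moreover have "P k = P y + flip (P y) + P s"
    unfolding k_eq by (simp add: P_def tmap_add tmap_flip)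
  ultimately have *: "P y \<in> B.K" "k = P y + flip (P y) + P s" "P s \<in> B.RR"
    by simp_all
  then have "k - (P y + flip (P y)) = P s"
    by (metis add_diff_cancel_left')
  with * show ?thesis
    by (intro bexI[of _ "P y"]) (simp_all only:)
qed

end

section \<open>The torsion product\<close>

text \<open>The left factor x_b in the expansion of \<open>k\<close> as the sum of all x_b \<otimes>
  [b].\<close>

definition column :: "('a \<times> 'b \<Rightarrow>\<^sub>0 int) \<Rightarrow> 'b \<Rightarrow> ('a \<Rightarrow>\<^sub>0 int)"
  where "column k b = frag_extend (\<lambda>(a, b'). if b' = b then frag_of a else 0) k"

lemma column_add: "column (k + l) b = column k b + column l b"
  and column_diff: "column (k - l) b = column k b - column l b"
  and column_0 [simp]: "column 0 b = 0"
  by (simp_all add: column_def frag_extend_add frag_extend_diff)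

lemma lookup_column: "Poly_Mapping.lookup (column k b) a = Poly_Mapping.lookup k (a, b)"
  by (induction k rule: frag_ext_induct) (auto simp: column_def frag_extend_diff lookup_minus split: if_splits)

lemma column_tens: "column (tens x y) b = frag_cmul (Poly_Mapping.lookup y b) x"
  by (rule poly_mapping_eqI) (simp add: lookup_column lookup_tens)

lemma column_eq_0: "b \<notin> snd ` Poly_Mapping.keys k \<Longrightarrow> column k b = 0"
  by (rule poly_mapping_eqI) (force simp: lookup_column in_keys_iff)

text \<open>Used for \<open>X = rels A\<close> and for \<open>X = F\<close>, the source and the
  target of the map whose kernel is \<open>Tor1\<close>.\<close>

locale subgroup_tensor = abelian_presentation A for A :: "('a, 'm) monoid_scheme" (structure) +
  fixes X :: "('a \<Rightarrow>\<^sub>0 int) set"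
  assumes subspace_X: "frag.subspace X" and X_le: "X \<subseteq> F"
begin

definition XG :: "('a \<Rightarrow>\<^sub>0 int) monoid"
  where "XG = (free_Abelian_group (carrier A))\<lparr>carrier := X\<rparr>"

lemma XG_simps [simp]: "carrier XG = X" "x \<otimes>\<^bsub>XG\<^esub> y = x + y" "\<one>\<^bsub>XG\<^esub> = 0"
  by (simp_all add: XG_def free_Abelian_group_def)

lemma XG_comm_group: "comm_group XG"
proof (rule comm_groupI; (unfold XG_simps)?)
  fix x assume "x \<in> X"
  then show "\<exists>y\<in>X. y + x = 0"
    using frag.subspace_neg[OF subspace_X] by (intro bexI[of _ "- x"]) auto
qed (auto simp: frag.subspace_0[OF subspace_X] frag.subspace_add[OF subspace_X])

abbreviation "TX \<equiv> tensor XG A"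
abbreviation "te \<equiv> tensor_elem XG A"

sublocale TX: comm_group TX
  by (rule tensor_comm_group[OF XG_comm_group comm_group_A])

lemma te_closed [simp]: "\<lbrakk>x \<in> X; a \<in> carrier A\<rbrakk> \<Longrightarrow> te x a \<in> carrier TX"
  using tensor_elem_closed[OF XG_comm_group comm_group_A, of x a] by simp

lemma te_hom: "a \<in> carrier A \<Longrightarrow> group_hom XG TX (\<lambda>x. te x a)" "x \<in> X \<Longrightarrow> group_hom A TX (te x)"
  using bilinear_tensor_elem[OF XG_comm_group comm_group_A] XG_comm_group TX.is_group is_group
  by (auto simp: bilinear_map_def group_hom_def group_hom_axioms_def comm_group_def)

lemma te_add: "\<lbrakk>x \<in> X; y \<in> X; a \<in> carrier A\<rbrakk> \<Longrightarrow> te (x + y) a = te x a \<otimes>\<^bsub>TX\<^esub> te y a"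
  using group_hom.hom_mult[OF te_hom(1), of a x y] by simp

lemma te_zero: "a \<in> carrier A \<Longrightarrow> te 0 a = \<one>\<^bsub>TX\<^esub>"
  using group_hom.hom_one[OF te_hom(1), of a] by simp

lemma te_one: "x \<in> X \<Longrightarrow> te x \<one> = \<one>\<^bsub>TX\<^esub>"
  by (rule group_hom.hom_one[OF te_hom(2)])

lemma te_diff: "\<lbrakk>x \<in> X; a \<in> carrier A; b \<in> carrier A\<rbrakk> \<Longrightarrow> te x (a \<otimes> inv b) = te x a \<otimes>\<^bsub>TX\<^esub> inv\<^bsub>TX\<^esub> te x b"
  using group_hom.hom_mult[OF te_hom(2)] group_hom.hom_inv[OF te_hom(2)] by simp

text \<open>The homomorphism \<open>X \<otimes> F \<rightarrow> X \<otimes> A\<close>, with \<open>X \<otimes> F\<close> realised inside \<open>F \<otimes> F\<close> by columns.\<close>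

definition Lam :: "('a \<times> 'a \<Rightarrow>\<^sub>0 int) \<Rightarrow> (('a \<Rightarrow>\<^sub>0 int) \<times> 'a \<Rightarrow>\<^sub>0 int) set"
  where "Lam k = gfinprod TX (\<lambda>b. te (column k b) b) (carrier A)"

lemma column_in_X: "k \<in> tspan X F \<Longrightarrow> column k b \<in> X"
  by (erule tspan_map[where f = "\<lambda>k. column k b"])
    (auto simp: column_diff column_tens subspace_X frag.subspace_scale[OF subspace_X])

lemma XF_diff: "\<lbrakk>k \<in> tspan X F; l \<in> tspan X F\<rbrakk> \<Longrightarrow> k - l \<in> tspan X F"
  and XF_zero: "0 \<in> tspan X F"
  by (simp_all add: frag.subspace_diff frag.subspace_0)

lemma Lam_closed: "k \<in> tspan X F \<Longrightarrow> Lam k \<in> carrier TX"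
  unfolding Lam_def by (rule TX.gfinprod_closed) (auto simp: column_in_X)

lemma Lam_add:
  assumes "k \<in> tspan X F" "l \<in> tspan X F"
  shows "Lam (k + l) = Lam k \<otimes>\<^bsub>TX\<^esub> Lam l"
proof -
  have fin: "finite {b \<in> carrier A. te (column k b) b \<noteq> \<one>\<^bsub>TX\<^esub>}" for k
  proof (rule finite_subset)
    show "{b \<in> carrier A. te (column k b) b \<noteq> \<one>\<^bsub>TX\<^esub>} \<subseteq> snd ` Poly_Mapping.keys k"
      using column_eq_0 te_zero by fastforce
  qed simp
  have "Lam (k + l) = gfinprod TX (\<lambda>b. te (column k b) b \<otimes>\<^bsub>TX\<^esub> te (column l b) b) (carrier A)"
    unfolding Lam_def
    by (rule TX.gfinprod_cong) (use assms in \<open>auto simp: column_add te_add column_in_X simp_implies_def\<close>)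
  also have "\<dots> = Lam k \<otimes>\<^bsub>TX\<^esub> Lam l"
    unfolding Lam_def by (rule TX.gfinprod_distrib) (use assms fin in \<open>auto simp: column_in_X\<close>)
  finally show ?thesis .
qed

lemma Lam_zero: "Lam 0 = \<one>\<^bsub>TX\<^esub>"
  using Lam_add[of 0 0] Lam_closed[of 0] XF_zero by simp

lemma Lam_diff:
  assumes "k \<in> tspan X F" "l \<in> tspan X F"
  shows "Lam (k - l) = Lam k \<otimes>\<^bsub>TX\<^esub> inv\<^bsub>TX\<^esub> Lam l"
proof -
  have "Lam k = Lam (k - l) \<otimes>\<^bsub>TX\<^esub> Lam l"
    using Lam_add[OF XF_diff[OF assms] assms(2)] by simp
  then show ?thesis
    using Lam_closed[OF XF_diff[OF assms]] Lam_closed[OF assms(2)] by (simp add: TX.m_assoc)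
qed

lemma Lam_tens_of:
  assumes "x \<in> X" "b \<in> carrier A"
  shows "Lam (tens x (frag_of b)) = te x b"
proof -
  have "gfinprod TX (\<lambda>b'. te x b) {b} =
      gfinprod TX (\<lambda>b'. te (column (tens x (frag_of b)) b') b') (carrier A)"
    by (rule TX.gfinprod_mono_neutral_cong_left)
      (use assms in \<open>auto simp: column_tens te_zero frag.subspace_0[OF subspace_X]\<close>)
  then show ?thesis
    using assms by (simp add: Lam_def)
qed

lemma Lam_tens:
  assumes "x \<in> X" "y \<in> F"
  shows "Lam (tens x y) = te x (eps A y)"
  using assms(2)
proof (induction rule: frags_induct)
  case (diff y y')
  then show ?case
    using assms(1) by (simp add: tens_diff_right Lam_diff tens_in_tspan eps_diff te_diff)
qed (use assms(1) in \<open>simp_all add: Lam_zero te_one Lam_tens_of\<close>)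

lemma Lam_eq_one:
  assumes "k \<in> tspan X (rels A)"
  shows "k \<in> tspan X F \<and> Lam k = \<one>\<^bsub>TX\<^esub>"
proof -
  have "frag.subspace {k \<in> tspan X F. Lam k = \<one>\<^bsub>TX\<^esub>}"
    by (rule frag_subspaceI) (auto simp: XF_zero Lam_zero XF_diff Lam_diff)
  then have "k \<in> {k \<in> tspan X F. Lam k = \<one>\<^bsub>TX\<^esub>}"
    by (rule tspan_minimal[OF assms]) (auto simp: Lam_tens te_one tens_in_tspan, auto simp: rels_def Lam_tens te_one tens_in_tspan)
  then show ?thesis
    by simp
qed

text \<open>The universal property yields a homomorphism \<open>?L\<close> from X \<otimes> A to the
  group on pairs modulo \<open>tspan X (rels A)\<close>, sending x \<otimes> b to the class of x
  \<otimes> [b]. On \<open>tspan X F\<close>, \<open>Lam\<close> followed by \<open>?L\<close> is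
  the quotient map, so the kernel of \<open>Lam\<close> is no larger than claimed.\<close>

lemma Lam_kernel:
  assumes k: "k \<in> tspan X F" "Lam k = \<one>\<^bsub>TX\<^esub>"
  shows "k \<in> tspan X (rels A)"
proof -
  let ?S = "carrier A \<times> carrier A"
  define Y where "Y = {tens x r | x r. x \<in> X \<and> r \<in> rels A}"
  have Y: "Y \<subseteq> frags ?S"
    unfolding Y_def using X_le R_le tens_in_frags by blast
  have spanY: "frag.span Y = tspan X (rels A)"
    by (simp add: Y_def tspan_def)
  let ?Q = "presented ?S Y"
  interpret q: group_hom "free_Abelian_group ?S" ?Q "pcl ?S Y"
    by (rule pcl_hom[OF Y])
  have Q: "comm_group ?Q"
    by (rule presented_comm_group) (use Y in simp)
  have XS: "tens x y \<in> frags ?S" if "x \<in> X" "y \<in> F" for x y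
    using that X_le by (auto intro: tens_in_frags)
  have qadd: "pcl ?S Y (u + v) = pcl ?S Y u \<otimes>\<^bsub>?Q\<^esub> pcl ?S Y v" if "u \<in> frags ?S" "v \<in> frags ?S" for u v
    using q.hom_mult[of u v] that by simp
  have "bilinear_map XG A ?Q (\<lambda>x b. pcl ?S Y (tens x (frag_of b)))"
    unfolding bilinear_map_def
  proof (intro conjI ballI homI)
    fix x a b assume *: "x \<in> carrier XG" "a \<in> carrier A" "b \<in> carrier A"
    have "pcl ?S Y (tens x (frag_of (a \<otimes> b))) = pcl ?S Y (tens x (frag_of a) + tens x (frag_of b))"
    proof (subst pcl_eq_iff[OF Y])
      have "tens x (frag_of (a \<otimes> b) - frag_of a - frag_of b) \<in> tspan X (rels A)"
        using * mult_rel by (intro tens_in_tspan) auto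
      then show "tens x (frag_of (a \<otimes> b)) - (tens x (frag_of a) + tens x (frag_of b)) \<in> frag.span Y"
        unfolding spanY by (simp add: tens_diff_right tens_add diff_diff_eq)
    qed (use * XS in auto)
    then show "pcl ?S Y (tens x (frag_of (a \<otimes> b))) = pcl ?S Y (tens x (frag_of a)) \<otimes>\<^bsub>?Q\<^esub> pcl ?S Y (tens x (frag_of b))"
      using * XS by (simp add: qadd)
  qed (use XS q.hom_closed in \<open>simp_all add: tens_add qadd\<close>)
  note lift = tensor_lift[OF XG_comm_group comm_group_A Q this]
  let ?L = "tensor_lift ?Q (\<lambda>x b. pcl ?S Y (tens x (frag_of b)))"
  interpret L: group_hom TX ?Q ?L
    using lift(1) Q TX.is_group by (simp add: group_hom_def group_hom_axioms_def comm_group_def)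
  have XF_le: "tspan X F \<subseteq> frags ?S"
    unfolding frags_Times_eq_tspan by (rule tspan_mono[OF X_le order_refl])
  have "frag.subspace {k \<in> tspan X F. ?L (Lam k) = pcl ?S Y k}"
  proof (rule frag_subspaceI; clarify, intro conjI)
    show "?L (Lam 0) = pcl ?S Y 0"
      using free_hom_zero[OF q.group_hom_axioms] by (simp add: Lam_zero)
    fix u v assume *: "u \<in> tspan X F" "?L (Lam u) = pcl ?S Y u" "v \<in> tspan X F" "?L (Lam v) = pcl ?S Y v"
    have "pcl ?S Y (u - v) = pcl ?S Y u \<otimes>\<^bsub>?Q\<^esub> inv\<^bsub>?Q\<^esub> pcl ?S Y v"
      using free_hom_diff[OF q.group_hom_axioms] * XF_le by blast
    then show "?L (Lam (u - v)) = pcl ?S Y (u - v)"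
      using * Lam_closed by (simp add: Lam_diff)
  qed (simp_all add: XF_zero XF_diff)
  then have "k \<in> {k \<in> tspan X F. ?L (Lam k) = pcl ?S Y k}"
  proof (rule tspan_minimal[OF k(1)])
    fix x y assume xy: "x \<in> X" "y \<in> F"
    have "tens x (frag_of (eps A y) - y) \<in> tspan X (rels A)"
      using xy sub_frag_of_eps by (intro tens_in_tspan) auto
    then have "pcl ?S Y (tens x (frag_of (eps A y))) = pcl ?S Y (tens x y)"
      using xy XS by (subst pcl_eq_iff[OF Y]) (auto simp: spanY tens_diff_right)
    moreover have "?L (te x (eps A y)) = pcl ?S Y (tens x (frag_of (eps A y)))"
      using lift(2)[of x "eps A y"] xy by simp
    ultimately show "tens x y \<in> {k \<in> tspan X F. ?L (Lam k) = pcl ?S Y k}"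
      using xy by (simp add: tens_in_tspan Lam_tens)
  qed
  then have "pcl ?S Y k = \<one>\<^bsub>?Q\<^esub>"
    using k(2) by simp
  then show ?thesis
    using pcl_eq_one_iff[OF Y, of k] k(1) XF_le spanY by auto
qed

lemma Lam_eq_one_iff: "k \<in> tspan X F \<Longrightarrow> Lam k = \<one>\<^bsub>TX\<^esub> \<longleftrightarrow> k \<in> tspan X (rels A)"
  using Lam_kernel Lam_eq_one by blast

lemma Lam_surj: "carrier TX = Lam ` tspan X F"
proof
  show "Lam ` tspan X F \<subseteq> carrier TX"
    using Lam_closed by auto
  let ?q = "pcl (X \<times> carrier A) (tensor_rels XG A)"
  have rel: "tensor_rels XG A \<subseteq> frags (X \<times> carrier A)"
    using tensor_rels_subset[OF XG_comm_group comm_group_A] by simp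
  have q: "group_hom (free_Abelian_group (X \<times> carrier A)) TX ?q"
    unfolding tensor_def XG_simps by (rule pcl_hom[OF rel])
  show "carrier TX \<subseteq> Lam ` tspan X F"
  proof
    fix t assume "t \<in> carrier TX"
    then obtain z where z: "z \<in> frags (X \<times> carrier A)" "t = ?q z"
      unfolding tensor_def XG_simps carrier_presented_pcl by blast
    let ?h = "frag_extend (\<lambda>(x, b). tens x (frag_of b))"
    have "?h z \<in> tspan X F \<and> Lam (?h z) = ?q z"
      using z(1)
    proof (induction rule: frags_induct)
      case zero
      then show ?case
        by (simp add: XF_zero Lam_zero free_hom_zero[OF q])
    next
      case (of p)
      then show ?case
        by (cases p) (auto simp: tens_in_tspan Lam_tens_of tensor_elem_def presented_gen_eq_pcl)
    next
      case (diff u v)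
      then show ?case
        by (simp add: frag_extend_diff XF_diff Lam_diff free_hom_diff[OF q])
    qed
    then show "t \<in> Lam ` tspan X F"
      using z(2) by force
  qed
qed

end

section \<open>The torsion product as \<open>K\<close> modulo \<open>RR\<close>, and its
  involution\<close>

context abelian_presentation
begin

sublocale TR: subgroup_tensor A "rels A"
  by standard (auto simp: subspace_rels R_le)

sublocale TF: subgroup_tensor A F
  by standard auto

lemma res_F_eq: "res_F A = TF.XG"
  unfolding res_F_def TF.XG_def by (simp add: free_Abelian_group_def frags_def)

lemma res_R_eq: "res_R A = TR.XG"
  unfolding res_R_def TR.XG_def res_F_def by (simp add: kernel_def rels_def)

lemma Tor1_map_Lam:
  assumes "k \<in> RF"
  shows "Tor1_map A A (TR.Lam k) = TF.Lam k"
proof -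
  have bil: "bilinear_map TR.XG A TF.TX TF.te"
    using bilinear_res[OF comm_group_A comm_group_A] by (simp add: res_F_eq res_R_eq)
  note lift = tensor_lift[OF TR.XG_comm_group comm_group_A TF.TX.comm_group_axioms bil]
  interpret L: group_hom TR.TX TF.TX "Tor1_map A A"
    using lift(1) TR.TX.is_group TF.TX.is_group
    by (simp add: group_hom_def group_hom_axioms_def Tor1_map_def res_F_eq)
  have le: "RF \<subseteq> tspan F F"
    by (rule tspan_mono[OF R_le order_refl])
  have "frag.subspace {k \<in> RF. Tor1_map A A (TR.Lam k) = TF.Lam k}"
  proof (rule frag_subspaceI; clarify, intro conjI)
    fix u v assume *: "u \<in> RF" "Tor1_map A A (TR.Lam u) = TF.Lam u" "v \<in> RF" "Tor1_map A A (TR.Lam v) = TF.Lam v"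
    then show "Tor1_map A A (TR.Lam (u - v)) = TF.Lam (u - v)"
      using le by (simp add: TR.Lam_diff TF.Lam_diff TR.Lam_closed subset_iff)
  qed (simp_all add: TR.XF_zero TR.XF_diff TR.Lam_zero TF.Lam_zero)
  then have "k \<in> {k \<in> RF. Tor1_map A A (TR.Lam k) = TF.Lam k}"
  proof (rule tspan_minimal[OF assms])
    fix r f assume rf: "r \<in> rels A" "f \<in> F"
    have "Tor1_map A A (TR.te r (eps A f)) = TF.te r (eps A f)"
      using lift(2)[of r "eps A f"] rf by (simp add: Tor1_map_def res_F_eq)
    then show "tens r f \<in> {k \<in> RF. Tor1_map A A (TR.Lam k) = TF.Lam k}"
      using rf R_le by (auto simp: TR.Lam_tens TF.Lam_tens tens_in_tspan)
  qed
  then show ?thesis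
    by simp
qed

abbreviation "Tor \<equiv> Tor1 A A"

lemma Tor_simps [simp]: "x \<otimes>\<^bsub>Tor\<^esub> y = x \<otimes>\<^bsub>TR.TX\<^esub> y" "\<one>\<^bsub>Tor\<^esub> = \<one>\<^bsub>TR.TX\<^esub>"
  by (simp_all add: Tor1_def res_R_eq)

text \<open>\<open>Lam\<close> identifies F \<otimes> A with F \<otimes> F modulo \<open>FR\<close>,
  so an element of \<open>RF\<close> dies there exactly when it lies in \<open>FR\<close>
  too.\<close>

lemma K_eq: "k \<in> K \<longleftrightarrow> k \<in> RF \<and> TF.Lam k = \<one>\<^bsub>TF.TX\<^esub>"
proof -
  have "RF \<subseteq> tspan F F"
    by (rule tspan_mono[OF R_le order_refl])
  then show ?thesis
    using TF.Lam_eq_one_iff[of k] by (auto simp: K_def)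
qed

lemma carrier_Tor: "carrier Tor = TR.Lam ` K"
proof -
  have "carrier Tor = {x \<in> TR.Lam ` RF. Tor1_map A A x = \<one>\<^bsub>TF.TX\<^esub>}"
    using TR.Lam_surj by (simp add: Tor1_def kernel_def res_R_eq res_F_eq)
  also have "\<dots> = TR.Lam ` K"
    using Tor1_map_Lam K_eq by auto
  finally show ?thesis .
qed

lemma K_le_RF: "k \<in> K \<Longrightarrow> k \<in> RF"
  by (simp add: K_def)

lemma K_add: "\<lbrakk>k \<in> K; l \<in> K\<rbrakk> \<Longrightarrow> k + l \<in> K"
  and K_diff: "\<lbrakk>k \<in> K; l \<in> K\<rbrakk> \<Longrightarrow> k - l \<in> K"
  and K_0: "0 \<in> K"
  and K_neg: "k \<in> K \<Longrightarrow> - k \<in> K"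
  by (simp_all add: frag.subspace_add frag.subspace_diff frag.subspace_0 frag.subspace_neg)

lemma Lam_Tor_closed: "k \<in> K \<Longrightarrow> TR.Lam k \<in> carrier Tor"
  by (simp add: carrier_Tor)

lemma Lam_Tor_add: "\<lbrakk>k \<in> K; l \<in> K\<rbrakk> \<Longrightarrow> TR.Lam (k + l) = TR.Lam k \<otimes>\<^bsub>Tor\<^esub> TR.Lam l"
  by (simp add: TR.Lam_add K_le_RF)

lemma Lam_Tor_eq_one_iff: "k \<in> K \<Longrightarrow> TR.Lam k = \<one>\<^bsub>Tor\<^esub> \<longleftrightarrow> k \<in> RR"
  by (simp add: TR.Lam_eq_one_iff K_le_RF)

lemma Tor_comm_group: "comm_group Tor"
proof (rule comm_groupI)
  fix x assume "x \<in> carrier Tor"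
  then obtain k where "k \<in> K" "x = TR.Lam k"
    by (auto simp: carrier_Tor)
  then show "\<exists>y\<in>carrier Tor. y \<otimes>\<^bsub>Tor\<^esub> x = \<one>\<^bsub>Tor\<^esub>"
    using K_neg[of k] Lam_Tor_add[of "- k" k] by (intro bexI[of _ "TR.Lam (- k)"]) (simp_all add: Lam_Tor_closed TR.Lam_zero)
next
  show "\<one>\<^bsub>Tor\<^esub> \<in> carrier Tor"
    using Lam_Tor_closed[OF K_0] by (simp add: TR.Lam_zero)
next
  fix x y assume "x \<in> carrier Tor" "y \<in> carrier Tor"
  then obtain k l where "k \<in> K" "l \<in> K" "x = TR.Lam k" "y = TR.Lam l"
    by (auto simp: carrier_Tor)
  then show "x \<otimes>\<^bsub>Tor\<^esub> y \<in> carrier Tor"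
    using Lam_Tor_closed[OF K_add] by (simp add: Lam_Tor_add)
qed (auto simp: carrier_Tor TR.Lam_closed K_le_RF TR.TX.m_assoc intro!: TR.TX.m_comm)

lemma Lam_Tor_diff: "\<lbrakk>k \<in> K; l \<in> K\<rbrakk> \<Longrightarrow> TR.Lam (k - l) = TR.Lam k \<otimes>\<^bsub>Tor\<^esub> inv\<^bsub>Tor\<^esub> TR.Lam l"
proof -
  interpret T: comm_group Tor
    by (rule Tor_comm_group)
  assume k: "k \<in> K" "l \<in> K"
  have "TR.Lam k = TR.Lam (k - l) \<otimes>\<^bsub>Tor\<^esub> TR.Lam l"
    using Lam_Tor_add[OF K_diff[OF k] k(2)] by simp
  then show ?thesis
    using Lam_Tor_closed[OF K_diff[OF k]] Lam_Tor_closed[OF k(2)] by (simp add: T.m_assoc del: Tor_simps)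
qed

lemma Lam_eq_iff: "\<lbrakk>k \<in> K; l \<in> K\<rbrakk> \<Longrightarrow> TR.Lam k = TR.Lam l \<longleftrightarrow> k - l \<in> RR"
proof -
  interpret T: comm_group Tor
    by (rule Tor_comm_group)
  assume k: "k \<in> K" "l \<in> K"
  have "k - l \<in> RR \<longleftrightarrow> TR.Lam k \<otimes>\<^bsub>Tor\<^esub> inv\<^bsub>Tor\<^esub> TR.Lam l = \<one>\<^bsub>Tor\<^esub>"
    using Lam_Tor_eq_one_iff[OF K_diff[OF k]] Lam_Tor_diff[OF k] by simp
  also have "\<dots> \<longleftrightarrow> TR.Lam k = TR.Lam l"
    using Lam_Tor_closed k T.inv_equality T.r_inv T.inv_inv T.inv_closed by metis
  finally show ?thesis
    by simp
qed

lemma frag_cmul_torsion: "a \<in> carrier A \<Longrightarrow> frag_cmul (int n) (frag_of a) \<in> rels A \<longleftrightarrow> a [^] n = \<one>"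
  by (simp add: rels_def eps_cmul int_pow_int)

lemma tau_eq_Lam: "\<lbrakk>a \<in> n_torsion A n; b \<in> n_torsion A n\<rbrakk> \<Longrightarrow>
    frag_cmul (int n) (frag_of (a, b)) \<in> K \<and> tau A A n a b = TR.Lam (frag_cmul (int n) (frag_of (a, b)))"
proof -
  assume ab: "a \<in> n_torsion A n" "b \<in> n_torsion A n"
  then have r: "frag_cmul (int n) (frag_of a) \<in> rels A" "frag_cmul (int n) (frag_of b) \<in> rels A"
    and c: "a \<in> carrier A" "b \<in> carrier A"
    by (simp_all add: n_torsion_def frag_cmul_torsion)
  have eq: "frag_cmul (int n) (frag_of (a, b)) = tens (frag_cmul (int n) (frag_of a)) (frag_of b)"
    "frag_cmul (int n) (frag_of (a, b)) = tens (frag_of a) (frag_cmul (int n) (frag_of b))"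
    by (simp_all add: tens_cmul)
  have "frag_cmul (int n) (frag_of (a, b)) \<in> RF" "frag_cmul (int n) (frag_of (a, b)) \<in> FR"
    unfolding eq(1) using r(1) c by (auto intro: tens_in_tspan) (simp add: eq(1)[symmetric], simp add: eq(2) r(2) c tens_in_tspan)
  then show ?thesis
    using r(1) c by (simp add: K_def tau_def res_R_eq eq(1) TR.Lam_tens_of)
qed

text \<open>\<open>K_generators\<close> supplies arbitrary x and y in \<open>F\<close> and an
  integer n. Modulo \<open>RR\<close> the factors may be replaced by the basis elements of their
  values in \<open>A\<close>.\<close>

lemma K_tau_generators:
  assumes "k \<in> K"
  shows "k \<in> frag.span (RR \<union> {frag_cmul (int n) (frag_of (a, b)) | n a b. n \<ge> 1 \<and> a \<in> n_torsion A n \<and> b \<in> n_torsion A n})"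
    (is "k \<in> frag.span (RR \<union> ?Z)")
proof (rule frag_span_minimal[OF K_generators[OF assms]])
  fix z assume "z \<in> RR \<union> {frag_cmul n (tens x y) | n x y. x \<in> F \<and> y \<in> F \<and> frag_cmul n x \<in> rels A \<and> frag_cmul n y \<in> rels A}"
  then show "z \<in> frag.span (RR \<union> ?Z)"
  proof
    assume "z \<in> {frag_cmul n (tens x y) | n x y. x \<in> F \<and> y \<in> F \<and> frag_cmul n x \<in> rels A \<and> frag_cmul n y \<in> rels A}"
    then obtain n x y where z: "z = frag_cmul n (tens x y)" and x: "x \<in> F" "frag_cmul n x \<in> rels A"
      and y: "y \<in> F" "frag_cmul n y \<in> rels A"
      by auto
    let ?a = "eps A x" and ?b = "eps A y"
    \<comment> \<open>The generators of Tor carry a natural number that is at least 1. The sign of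
      \<open>n\<close> is restored by \<open>sgn n\<close>, and \<open>n = 0\<close> contributes
      0.\<close>
    let ?w = "frag_cmul (int (nat \<bar>n\<bar>)) (frag_of (?a, ?b))"
    have an: "?a [^] n = \<one>" "?b [^] n = \<one>"
      using x y by (simp_all add: rels_def eps_cmul)
    have tors: "c [^] nat \<bar>n\<bar> = \<one>" if "c [^] n = \<one>" "c \<in> carrier A" for c
      using that int_pow_neg[of c n] by (simp add: int_pow_int[symmetric] abs_if)
    have "?w \<in> frag.span (RR \<union> ?Z)"
    proof (cases "n = 0")
      case False
      have "?a \<in> n_torsion A (nat \<bar>n\<bar>)" "?b \<in> n_torsion A (nat \<bar>n\<bar>)"
        using an x y tors by (simp_all add: n_torsion_def)
      moreover have "nat \<bar>n\<bar> \<ge> 1"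
        using False by linarith
      ultimately show ?thesis
        by (intro frag.span_base) blast
    qed (simp add: frag.span_zero)
    then have "frag_cmul (sgn n) ?w \<in> frag.span (RR \<union> ?Z)"
      by (rule frag.span_scale)
    then have 1: "frag_cmul n (frag_of (?a, ?b)) \<in> frag.span (RR \<union> ?Z)"
      by (simp add: sgn_mult_abs)
    \<comment> \<open>The factors are replaced one at a time. In each term one factor is a
      difference with equal values in \<open>A\<close>, and the other absorbs n; both are
      relations.\<close>
    have "frag_cmul n (tens x y) - frag_cmul n (frag_of (?a, ?b)) =
        tens (x - frag_of ?a) (frag_cmul n y) + tens (frag_cmul n (frag_of ?a)) (y - frag_of ?b)"
      unfolding tens_cmul tens_diff_left tens_diff_right tens_frag_of
      by (rule poly_mapping_eqI, simp only: lookup_add lookup_minus lookup_frag_cmul) algebra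
    also have "\<dots> \<in> RR"
    proof (rule frag.subspace_add[OF subspace_tspan tens_in_tspan tens_in_tspan])
      show "frag_cmul n (frag_of ?a) \<in> rels A"
        using an x by (simp add: rels_def eps_cmul)
    qed (use sub_frag_of_eps x y in blast)+
    finally have "frag_cmul n (tens x y) - frag_cmul n (frag_of (?a, ?b)) \<in> RR" .
    then have "frag_cmul n (tens x y) - frag_cmul n (frag_of (?a, ?b)) \<in> frag.span (RR \<union> ?Z)"
      by (intro frag.span_base) blast
    from frag.span_add[OF this 1] show ?thesis
      by (simp add: z)
  qed (auto intro: frag.span_base)
qed simp

text \<open>\<open>sigma_eps\<close> is a definite description, so existence and uniqueness are both
  due. \<open>flip\<close> preserves \<open>RR\<close> and therefore acts on K/RR; two candidates
  agree because the elements \<open>tau\<close> generate.\<close>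

lemma sigma_eps_Lam:
  assumes "k \<in> K"
  shows "sigma_eps A (TR.Lam k) = TR.Lam (flip k)"
proof -
  interpret T: comm_group Tor
    by (rule Tor_comm_group)
  let ?P = "\<lambda>\<sigma>. \<sigma> \<in> hom Tor Tor \<and> \<sigma> \<in> extensional (carrier Tor) \<and>
    (\<forall>n\<ge>1. \<forall>a\<in>n_torsion A n. \<forall>b\<in>n_torsion A n. \<sigma> (tau A A n a b) = tau A A n b a)"
  define s where "s = restrict (\<lambda>m. TR.Lam (flip (SOME k. k \<in> K \<and> TR.Lam k = m))) (carrier Tor)"
  have s: "s (TR.Lam k) = TR.Lam (flip k)" if k: "k \<in> K" for k
  proof -
    define l where "l = (SOME l. l \<in> K \<and> TR.Lam l = TR.Lam k)"
    have l: "l \<in> K" "TR.Lam l = TR.Lam k"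
      using someI[of "\<lambda>l. l \<in> K \<and> TR.Lam l = TR.Lam k" k] k unfolding l_def by auto
    then have "flip (l - k) \<in> RR"
      using Lam_eq_iff[OF l(1) k] flip_in_tspan by blast
    then have "TR.Lam (flip l) = TR.Lam (flip k)"
      using Lam_eq_iff[OF flip_K[OF l(1)] flip_K[OF k]] by (simp add: flip_diff)
    then show ?thesis
      using Lam_Tor_closed[OF k] by (simp add: s_def l_def)
  qed
  have Ps: "?P s"
  proof (intro conjI allI impI ballI)
    show "s \<in> hom Tor Tor"
    proof (rule homI)
      fix x y assume "x \<in> carrier Tor" "y \<in> carrier Tor"
      then obtain k l where kl: "k \<in> K" "l \<in> K" "x = TR.Lam k" "y = TR.Lam l"
        by (auto simp: carrier_Tor)
      show "s x \<in> carrier Tor"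
        using kl by (simp add: s Lam_Tor_closed flip_K)
      show "s (x \<otimes>\<^bsub>Tor\<^esub> y) = s x \<otimes>\<^bsub>Tor\<^esub> s y"
        using kl by (simp add: s K_add flip_K flip_add del: Tor_simps flip: Lam_Tor_add)
    qed
    show "s (tau A A n a b) = tau A A n b a" if "a \<in> n_torsion A n" "b \<in> n_torsion A n" for n a b
      using tau_eq_Lam[OF that] tau_eq_Lam[OF that(2,1)] s by (simp add: flip_cmul)
  qed (simp add: s_def)
  have uniq: "\<sigma> = s" if P: "?P \<sigma>" for \<sigma>
  proof (rule extensionalityI[of _ "carrier Tor"])
    fix x assume "x \<in> carrier Tor"
    then obtain k where k: "k \<in> K" "x = TR.Lam k"
      by (auto simp: carrier_Tor)
    interpret \<sigma>: group_hom Tor Tor \<sigma>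
      using P T.is_group by (simp add: group_hom_def group_hom_axioms_def)
    have "frag.subspace {k \<in> K. \<sigma> (TR.Lam k) = TR.Lam (flip k)}"
    proof (rule frag_subspaceI; clarify, intro conjI)
      show "\<sigma> (TR.Lam 0) = TR.Lam (flip 0)"
        using \<sigma>.hom_one by (simp add: TR.Lam_zero)
      fix u v assume "u \<in> K" "\<sigma> (TR.Lam u) = TR.Lam (flip u)" "v \<in> K" "\<sigma> (TR.Lam v) = TR.Lam (flip v)"
      then show "\<sigma> (TR.Lam (u - v)) = TR.Lam (flip (u - v))"
        by (simp add: Lam_Tor_diff flip_diff flip_K Lam_Tor_closed del: Tor_simps)
    qed (simp_all add: K_0 K_diff)
    then have "k \<in> {k \<in> K. \<sigma> (TR.Lam k) = TR.Lam (flip k)}"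
    proof (rule frag_span_minimal[OF K_tau_generators[OF k(1)]])
      fix z assume "z \<in> RR \<union> {frag_cmul (int n) (frag_of (a, b)) | n a b. n \<ge> 1 \<and> a \<in> n_torsion A n \<and> b \<in> n_torsion A n}"
      then show "z \<in> {k \<in> K. \<sigma> (TR.Lam k) = TR.Lam (flip k)}"
      proof
        assume z: "z \<in> RR"
        then have "z \<in> K" "flip z \<in> RR" "flip z \<in> K"
          using RR_le(3) flip_in_tspan by blast+
        moreover have "\<sigma> \<one>\<^bsub>Tor\<^esub> = \<one>\<^bsub>Tor\<^esub>"
          by (rule \<sigma>.hom_one)
        moreover have "TR.Lam z = \<one>\<^bsub>Tor\<^esub>" "TR.Lam (flip z) = \<one>\<^bsub>Tor\<^esub>"
          using calculation(1-3) z Lam_Tor_eq_one_iff by blast+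
        ultimately show ?thesis
          by (simp only: mem_Collect_eq simp_thms)
      next
        assume "z \<in> {frag_cmul (int n) (frag_of (a, b)) | n a b. n \<ge> 1 \<and> a \<in> n_torsion A n \<and> b \<in> n_torsion A n}"
        then obtain n a b where z: "z = frag_cmul (int n) (frag_of (a, b))" "n \<ge> 1"
          and ab: "a \<in> n_torsion A n" "b \<in> n_torsion A n"
          by blast
        have "\<sigma> (tau A A n a b) = tau A A n b a"
          using P z(2) ab by blast
        then show ?thesis
          using tau_eq_Lam[OF ab] tau_eq_Lam[OF ab(2,1)] z(1) by (simp add: flip_cmul)
      qed
    qed
    then show "\<sigma> x = s x"
      using k s by simp
  qed (use P Ps in auto)
  have "sigma_eps A = s"
    unfolding sigma_eps_def by (rule the_equality, rule Ps, rule uniq)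
  then show ?thesis
    using s assms by simp
qed

end

section \<open>The bar complex\<close>

lemma (in group_hom) hom_finprod:
  assumes "comm_group G" "comm_group H" "finite I" "f \<in> I \<rightarrow> carrier G"
  shows "h (finprod G f I) = finprod H (\<lambda>i. h (f i)) I"
proof -
  interpret G: comm_group G by fact
  interpret H: comm_group H by fact
  show ?thesis
    using assms(3,4) by (induction I rule: finite_induct) (auto simp: Pi_iff)
qed

locale bar_complex = G: group G + M: comm_group M
  for G :: "('g, 'l) monoid_scheme" and M :: "('m, 'k) monoid_scheme" +
  fixes act :: "'g \<Rightarrow> 'm \<Rightarrow> 'm"
  assumes act_closed [simp]: "\<lbrakk>g \<in> carrier G; m \<in> carrier M\<rbrakk> \<Longrightarrow> act g m \<in> carrier M"
begin

abbreviation "C n \<equiv> bar_chain G M n"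
abbreviation "basis n \<equiv> bar_basis G n"

lemma pow_minus_one [simp]: "m \<in> carrier M \<Longrightarrow> m [^]\<^bsub>M\<^esub> (- 1 :: int) = inv\<^bsub>M\<^esub> m"
  using M.int_pow_neg[of m 1] by simp

lemma carrier_C: "carrier (C n) = {x \<in> basis n \<rightarrow>\<^sub>E carrier M. finite {gs \<in> basis n. x gs \<noteq> \<one>\<^bsub>M\<^esub>}}"
  unfolding bar_chain_def by (rule carrier_sum_group) simp

lemma C_extensional: "x \<in> carrier (C n) \<Longrightarrow> x \<in> extensional (basis n)"
  by (simp add: carrier_C PiE_def)

lemma C_simps [simp]: "\<one>\<^bsub>C n\<^esub> = (\<lambda>gs\<in>basis n. \<one>\<^bsub>M\<^esub>)" "x \<otimes>\<^bsub>C n\<^esub> y = (\<lambda>gs\<in>basis n. x gs \<otimes>\<^bsub>M\<^esub> y gs)"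
  by (simp_all add: bar_chain_def)

lemma C_comm_group: "comm_group (C n)"
proof (rule group.group_comm_groupI)
  show "group (C n)"
    unfolding bar_chain_def by simp
  fix x y assume "x \<in> carrier (C n)" "y \<in> carrier (C n)"
  then show "x \<otimes>\<^bsub>C n\<^esub> y = y \<otimes>\<^bsub>C n\<^esub> x"
    by (auto simp: carrier_C PiE_iff M.m_comm intro!: restrict_ext)
qed

lemma eval_hom: "hs \<in> basis n \<Longrightarrow> group_hom (C n) M (\<lambda>c. c hs)"
  using C_comm_group[of n] M.is_group
  by (auto simp: group_hom_def group_hom_axioms_def comm_group_def hom_def carrier_C PiE_iff)

lemma single_closed: "\<lbrakk>gs \<in> basis n; m \<in> carrier M\<rbrakk> \<Longrightarrow> bar_single G M gs m \<in> carrier (C n)"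
proof -
  assume gs: "gs \<in> basis n" "m \<in> carrier M"
  have "{hs \<in> basis n. bar_single G M gs m hs \<noteq> \<one>\<^bsub>M\<^esub>} \<subseteq> {gs}"
    using gs by (auto simp: bar_single_def bar_basis_def split: if_splits)
  then have "finite {hs \<in> basis n. bar_single G M gs m hs \<noteq> \<one>\<^bsub>M\<^esub>}"
    by (rule finite_subset) simp
  moreover have "length gs = n"
    using gs by (simp add: bar_basis_def)
  ultimately show ?thesis
    using gs by (auto simp: carrier_C bar_single_def)
qed

lemma single_eval: "\<lbrakk>hs \<in> basis n; length gs = n\<rbrakk> \<Longrightarrow> bar_single G M gs m hs = (if hs = gs then m else \<one>\<^bsub>M\<^esub>)"
  by (simp add: bar_single_def)

lemma face_closed:
  assumes "gs \<in> basis (n + 1)" "m \<in> carrier M"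
  shows "bar_face G M act i gs m \<in> carrier (C n)"
proof -
  have len: "length gs = n + 1" and gs: "set gs \<subseteq> carrier G"
    using assms by (auto simp: bar_basis_def)
  have ne: "gs \<noteq> []"
    using len by auto
  have 0: "tl gs \<in> basis n" "hd gs \<in> carrier G"
    using len gs ne by (auto simp: bar_basis_def dest: list.set_sel(2))
  have 1: "butlast gs \<in> basis n"
    using len gs by (auto simp: bar_basis_def dest: in_set_butlastD)
  have 2: "take (i - 1) gs @ [gs ! (i - 1) \<otimes>\<^bsub>G\<^esub> gs ! i] @ drop (i + 1) gs \<in> basis n"
    if "i \<noteq> 0" "i < length gs"
  proof -
    have "gs ! (i - 1) \<in> carrier G" "gs ! i \<in> carrier G"
      using that gs by (auto simp: subset_iff)
    then show ?thesis
      using that gs len by (auto simp: bar_basis_def dest: in_set_takeD in_set_dropD)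
  qed
  show ?thesis
    unfolding bar_face_def using assms(2) single_closed[OF 0(1)] single_closed[OF 1] single_closed[OF 2] 0(2) by simp
qed

lemma boundary_closed:
  assumes x: "x \<in> carrier (C (n + 1))"
  shows "bar_boundary G M act n x \<in> carrier (C n)"
proof -
  interpret C: comm_group "C n"
    by (rule C_comm_group)
  have "bar_face G M act i gs (x gs) \<in> carrier (C n)" if "gs \<in> basis (n + 1)" for i gs
    using that x by (intro face_closed) (auto simp: carrier_C)
  then show ?thesis
    unfolding bar_boundary_def by (intro C.finprod_closed) (auto intro!: C.finprod_closed)
qed

text \<open>Evaluation at \<open>hs\<close> is a homomorphism into \<open>M\<close> and so passes
  through both products.\<close>

lemma boundary_eval:
  assumes x: "x \<in> carrier (C (n + 1))" and hs: "hs \<in> basis n"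
  shows "bar_boundary G M act n x hs =
    (\<Otimes>\<^bsub>M\<^esub>gs\<in>{gs \<in> basis (n + 1). x gs \<noteq> \<one>\<^bsub>M\<^esub>}. \<Otimes>\<^bsub>M\<^esub>i\<in>{0..n + 1}.
      bar_face G M act i gs (x gs) hs [^]\<^bsub>M\<^esub> ((- 1) ^ i :: int))"
proof -
  interpret C: comm_group "C n"
    by (rule C_comm_group)
  interpret ev: group_hom "C n" M "\<lambda>c. c hs"
    by (rule eval_hom[OF hs])
  have f: "bar_face G M act i gs (x gs) \<in> carrier (C n)" if "gs \<in> basis (n + 1)" for i gs
    using that x by (intro face_closed) (auto simp: carrier_C)
  have "bar_boundary G M act n x hs = (\<Otimes>\<^bsub>M\<^esub>gs\<in>{gs \<in> basis (n + 1). x gs \<noteq> \<one>\<^bsub>M\<^esub>}.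
      (\<Otimes>\<^bsub>C n\<^esub>i\<in>{0..n + 1}. bar_face G M act i gs (x gs) [^]\<^bsub>C n\<^esub> ((- 1) ^ i :: int)) hs)"
    unfolding bar_boundary_def
  proof (rule ev.hom_finprod[OF C_comm_group M.comm_group_axioms])
    show "finite {gs \<in> basis (n + 1). x gs \<noteq> \<one>\<^bsub>M\<^esub>}"
      using x by (simp add: carrier_C)
  qed (auto intro!: C.finprod_closed C.int_pow_closed f simp del: C_simps)
  also have "\<dots> = (\<Otimes>\<^bsub>M\<^esub>gs\<in>{gs \<in> basis (n + 1). x gs \<noteq> \<one>\<^bsub>M\<^esub>}. \<Otimes>\<^bsub>M\<^esub>i\<in>{0..n + 1}.
      bar_face G M act i gs (x gs) hs [^]\<^bsub>M\<^esub> ((- 1) ^ i :: int))"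
  proof (rule M.finprod_cong')
    have fM: "bar_face G M act i gs (x gs) hs \<in> carrier M" if "gs \<in> basis (n + 1)" for i gs
      using ev.hom_closed[OF f[OF that]] .
    then show "(\<lambda>gs. \<Otimes>\<^bsub>M\<^esub>i\<in>{0..n + 1}. bar_face G M act i gs (x gs) hs [^]\<^bsub>M\<^esub> ((- 1) ^ i :: int))
        \<in> {gs \<in> basis (n + 1). x gs \<noteq> \<one>\<^bsub>M\<^esub>} \<rightarrow> carrier M"
      by (auto intro!: M.finprod_closed)
    fix gs assume "gs \<in> {gs \<in> basis (n + 1). x gs \<noteq> \<one>\<^bsub>M\<^esub>}"
    then have fgs: "bar_face G M act i gs (x gs) \<in> carrier (C n)" for i
      using f by simp
    have "(\<Otimes>\<^bsub>C n\<^esub>i\<in>{0..n + 1}. bar_face G M act i gs (x gs) [^]\<^bsub>C n\<^esub> ((- 1) ^ i :: int)) hs =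
        (\<Otimes>\<^bsub>M\<^esub>i\<in>{0..n + 1}. (bar_face G M act i gs (x gs) [^]\<^bsub>C n\<^esub> ((- 1) ^ i :: int)) hs)"
      by (rule ev.hom_finprod[OF C_comm_group M.comm_group_axioms]) (use fgs in auto)
    then show "(\<Otimes>\<^bsub>C n\<^esub>i\<in>{0..n + 1}. bar_face G M act i gs (x gs) [^]\<^bsub>C n\<^esub> ((- 1) ^ i :: int)) hs =
        (\<Otimes>\<^bsub>M\<^esub>i\<in>{0..n + 1}. bar_face G M act i gs (x gs) hs [^]\<^bsub>M\<^esub> ((- 1) ^ i :: int))"
      using ev.hom_int_pow[OF fgs] by simp
  qed simp
  finally show "bar_boundary G M act n x hs = \<dots>" .
qed

text \<open>Faces of a neutral coefficient are neutral, so the support of \<open>x\<close> can be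
  enlarged to the whole basis, an index set that does not depend on \<open>x\<close>.\<close>

lemma boundary_eval_finite:
  assumes "finite (carrier G)" "\<And>g. g \<in> carrier G \<Longrightarrow> act g \<one>\<^bsub>M\<^esub> = \<one>\<^bsub>M\<^esub>"
    and x: "x \<in> carrier (C (n + 1))" and hs: "hs \<in> basis n"
  shows "bar_boundary G M act n x hs =
    (\<Otimes>\<^bsub>M\<^esub>gs\<in>basis (n + 1). \<Otimes>\<^bsub>M\<^esub>i\<in>{0..n + 1}. bar_face G M act i gs (x gs) hs [^]\<^bsub>M\<^esub> ((- 1) ^ i :: int))"
proof -
  have fin: "finite (basis (n + 1))"
    using finite_lists_length_eq[OF assms(1), of "n + 1"] by (simp add: bar_basis_def conj_commute)
  have one: "bar_face G M act i gs \<one>\<^bsub>M\<^esub> hs = \<one>\<^bsub>M\<^esub>" if gs: "gs \<in> basis (n + 1)" for i gs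
  proof -
    have "hd gs \<in> carrier G"
      using gs by (cases gs) (auto simp: bar_basis_def)
    moreover have "length (bar_part) = n \<Longrightarrow> bar_single G M bar_part \<one>\<^bsub>M\<^esub> hs = \<one>\<^bsub>M\<^esub>" for bar_part
      using hs by (simp add: bar_single_def)
    ultimately show ?thesis
      using assms(2) gs by (auto simp: bar_face_def bar_basis_def)
  qed
  have fM: "bar_face G M act i gs (x gs) hs \<in> carrier M" if "gs \<in> basis (n + 1)" for i gs
    using that x group_hom.hom_closed[OF eval_hom[OF hs] face_closed[OF that, of "x gs" i]] by (auto simp: carrier_C)
  show ?thesis
    unfolding boundary_eval[OF x hs]
    by (rule M.finprod_mono_neutral_cong_left[OF fin])
      (use fM one in \<open>auto intro!: M.finprod_closed M.finprod_one_eqI\<close>)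
qed

lemma boundary_eval_0:
  assumes "finite (carrier G)" "\<And>g. g \<in> carrier G \<Longrightarrow> act g \<one>\<^bsub>M\<^esub> = \<one>\<^bsub>M\<^esub>"
    and x: "x \<in> carrier (C (Suc 0))"
  shows "bar_boundary G M act 0 x [] =
    (\<Otimes>\<^bsub>M\<^esub>gs\<in>basis (Suc 0). act (inv\<^bsub>G\<^esub> (gs ! 0)) (x gs) \<otimes>\<^bsub>M\<^esub> inv\<^bsub>M\<^esub> x gs)"
proof -
  have nil: "[] \<in> basis 0"
    by (simp add: bar_basis_def)
  have xM: "x gs \<in> carrier M" if "gs \<in> basis (Suc 0)" for gs
    using x that by (auto simp: carrier_C)
  have two: "{0..0 + 1} = {0, Suc 0}"
    by auto
  have "bar_boundary G M act 0 x [] =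
    (\<Otimes>\<^bsub>M\<^esub>gs\<in>basis (0 + 1). \<Otimes>\<^bsub>M\<^esub>i\<in>{0..0 + 1}. bar_face G M act i gs (x gs) [] [^]\<^bsub>M\<^esub> ((- 1) ^ i :: int))"
    by (rule boundary_eval_finite[OF assms(1,2) _ nil]) (use x in simp_all)
  also have "\<dots> = (\<Otimes>\<^bsub>M\<^esub>gs\<in>basis (Suc 0). act (inv\<^bsub>G\<^esub> (gs ! 0)) (x gs) \<otimes>\<^bsub>M\<^esub> inv\<^bsub>M\<^esub> x gs)"
  proof (rule M.finprod_cong')
    fix gs assume gs: "gs \<in> basis (Suc 0)"
    then obtain g where g: "gs = [g]" "g \<in> carrier G"
      by (auto simp: bar_basis_def length_Suc_conv)
    have "bar_face G M act 0 gs (x gs) [] = act (inv\<^bsub>G\<^esub> g) (x gs)" "bar_face G M act (Suc 0) gs (x gs) [] = x gs"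
      using nil by (simp_all add: bar_face_def g single_eval[of "[]" 0])
    then show "(\<Otimes>\<^bsub>M\<^esub>i\<in>{0..0 + 1}. bar_face G M act i gs (x gs) [] [^]\<^bsub>M\<^esub> ((- 1) ^ i :: int)) =
        act (inv\<^bsub>G\<^esub> (gs ! 0)) (x gs) \<otimes>\<^bsub>M\<^esub> inv\<^bsub>M\<^esub> x gs"
      unfolding two using xM[OF gs] g by simp
  qed (use xM in \<open>auto simp: bar_basis_def length_Suc_conv\<close>)
  finally show ?thesis .
qed

lemma boundary_eval_1:
  assumes "finite (carrier G)" "\<And>g. g \<in> carrier G \<Longrightarrow> act g \<one>\<^bsub>M\<^esub> = \<one>\<^bsub>M\<^esub>"
    and x: "x \<in> carrier (C (Suc (Suc 0)))" and hs: "hs \<in> basis (Suc 0)"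
  shows "bar_boundary G M act (Suc 0) x hs = (\<Otimes>\<^bsub>M\<^esub>gs\<in>basis (Suc (Suc 0)).
    (if hs = [gs ! 1] then act (inv\<^bsub>G\<^esub> (gs ! 0)) (x gs) else \<one>\<^bsub>M\<^esub>)
    \<otimes>\<^bsub>M\<^esub> inv\<^bsub>M\<^esub> (if hs = [gs ! 0 \<otimes>\<^bsub>G\<^esub> gs ! 1] then x gs else \<one>\<^bsub>M\<^esub>)
    \<otimes>\<^bsub>M\<^esub> (if hs = [gs ! 0] then x gs else \<one>\<^bsub>M\<^esub>))"
proof -
  have xM: "x gs \<in> carrier M" if "gs \<in> basis (Suc (Suc 0))" for gs
    using x that by (auto simp: carrier_C)
  have three: "{0..Suc 0 + 1} = {0, Suc 0, Suc (Suc 0)}"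
    by auto
  have "bar_boundary G M act (Suc 0) x hs = (\<Otimes>\<^bsub>M\<^esub>gs\<in>basis (Suc 0 + 1). \<Otimes>\<^bsub>M\<^esub>i\<in>{0..Suc 0 + 1}.
      bar_face G M act i gs (x gs) hs [^]\<^bsub>M\<^esub> ((- 1) ^ i :: int))"
    by (rule boundary_eval_finite[OF assms(1,2) _ hs]) (use x in simp_all)
  also have "\<dots> = (\<Otimes>\<^bsub>M\<^esub>gs\<in>basis (Suc (Suc 0)).
    (if hs = [gs ! 1] then act (inv\<^bsub>G\<^esub> (gs ! 0)) (x gs) else \<one>\<^bsub>M\<^esub>)
    \<otimes>\<^bsub>M\<^esub> inv\<^bsub>M\<^esub> (if hs = [gs ! 0 \<otimes>\<^bsub>G\<^esub> gs ! 1] then x gs else \<one>\<^bsub>M\<^esub>)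
    \<otimes>\<^bsub>M\<^esub> (if hs = [gs ! 0] then x gs else \<one>\<^bsub>M\<^esub>))"
  proof (rule M.finprod_cong')
    fix gs assume gs: "gs \<in> basis (Suc (Suc 0))"
    then obtain g h where g: "gs = [g, h]" "g \<in> carrier G" "h \<in> carrier G"
      by (auto simp: bar_basis_def length_Suc_conv)
    have aM: "act (inv\<^bsub>G\<^esub> g) (x gs) \<in> carrier M"
      using xM[OF gs] g by simp
    have "bar_face G M act 0 gs (x gs) hs = (if hs = [h] then act (inv\<^bsub>G\<^esub> g) (x gs) else \<one>\<^bsub>M\<^esub>)"
      "bar_face G M act (Suc 0) gs (x gs) hs = (if hs = [g \<otimes>\<^bsub>G\<^esub> h] then x gs else \<one>\<^bsub>M\<^esub>)"
      "bar_face G M act (Suc (Suc 0)) gs (x gs) hs = (if hs = [g] then x gs else \<one>\<^bsub>M\<^esub>)"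
      using hs by (simp_all add: bar_face_def g(1) single_eval[of hs "Suc 0"])
    then show "(\<Otimes>\<^bsub>M\<^esub>i\<in>{0..Suc 0 + 1}. bar_face G M act i gs (x gs) hs [^]\<^bsub>M\<^esub> ((- 1) ^ i :: int)) =
      (if hs = [gs ! 1] then act (inv\<^bsub>G\<^esub> (gs ! 0)) (x gs) else \<one>\<^bsub>M\<^esub>)
      \<otimes>\<^bsub>M\<^esub> inv\<^bsub>M\<^esub> (if hs = [gs ! 0 \<otimes>\<^bsub>G\<^esub> gs ! 1] then x gs else \<one>\<^bsub>M\<^esub>)
      \<otimes>\<^bsub>M\<^esub> (if hs = [gs ! 0] then x gs else \<one>\<^bsub>M\<^esub>)"
      unfolding three using xM[OF gs] aM g by (simp add: M.m_assoc)
  qed (use xM in \<open>auto simp: bar_basis_def length_Suc_conv\<close>)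
  finally show ?thesis .
qed

end


section \<open>First homology of the group of order two\<close>

definition swap12 :: "nat \<Rightarrow> nat"
  where "swap12 = transpose 1 2"

lemma swap12_neq [simp]: "swap12 \<noteq> id" "id \<noteq> swap12"
proof -
  have "swap12 1 \<noteq> 1"
    by (simp add: swap12_def)
  then show "swap12 \<noteq> id" "id \<noteq> swap12"
    by (metis id_apply)+
qed

lemma swap12_swap12 [simp]: "swap12 \<circ> swap12 = id"
  by (simp add: swap12_def)

lemma sym_group_2: "carrier (sym_group 2) = {id, swap12}"
proof -
  have "{1..2::nat} = {1, 2}"
    by auto
  then show ?thesis
    by (auto simp: sym_group_def permutes_doubleton_iff swap12_def)
qed

locale involution_module = M: comm_group M for M :: "('m, 'k) monoid_scheme" +
  fixes \<sigma> :: "'m \<Rightarrow> 'm"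
  assumes hom: "\<sigma> \<in> hom M M"
begin

abbreviation "t \<equiv> swap12"
abbreviation "C2 \<equiv> sym_group 2"

definition act :: "(nat \<Rightarrow> nat) \<Rightarrow> 'm \<Rightarrow> 'm"
  where "act p = (if p = id then (\<lambda>x. x) else \<sigma>)"

lemma \<sigma>_hom: "group_hom M M \<sigma>"
  using hom M.is_group by (simp add: group_hom_def group_hom_axioms_def)

lemma \<sigma>_closed [simp]: "m \<in> carrier M \<Longrightarrow> \<sigma> m \<in> carrier M"
  by (rule group_hom.hom_closed[OF \<sigma>_hom])

lemma \<sigma>_one [simp]: "\<sigma> \<one>\<^bsub>M\<^esub> = \<one>\<^bsub>M\<^esub>"
  by (rule group_hom.hom_one[OF \<sigma>_hom])

lemma act_simps [simp]: "act id m = m" "act t m = \<sigma> m"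
  by (simp_all add: act_def)

sublocale bar_complex C2 M act
proof (intro bar_complex.intro bar_complex_axioms.intro)
  show "group C2"
    by (rule sym_group_is_group)
  show "comm_group M"
    by (rule M.comm_group_axioms)
qed (auto simp: act_def)

lemma inv_simps [simp]: "inv\<^bsub>C2\<^esub> id = id" "inv\<^bsub>C2\<^esub> t = t"
  by (rule group.inv_equality[OF sym_group_is_group];
      simp add: sym_group_mult sym_group_one sym_group_2 del: sym_group_inv_equality)+

lemma basis_eq: "basis 0 = {[]}" "basis (Suc 0) = {[id], [t]}"
  "basis (Suc (Suc 0)) = {[id, id], [id, t], [t, id], [t, t]}"
  by (auto simp: bar_basis_def sym_group_2 length_Suc_conv)

lemma fin: "finite (carrier C2)" "g \<in> carrier C2 \<Longrightarrow> act g \<one>\<^bsub>M\<^esub> = \<one>\<^bsub>M\<^esub>"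
  by (auto simp: sym_group_2)

lemma boundary_0:
  assumes x: "x \<in> carrier (C (Suc 0))"
  shows "bar_boundary C2 M act 0 x [] = \<sigma> (x [t]) \<otimes>\<^bsub>M\<^esub> inv\<^bsub>M\<^esub> x [t]"
proof -
  have xM: "x [id] \<in> carrier M" "x [t] \<in> carrier M"
    using x by (auto simp: carrier_C basis_eq)
  have "bar_boundary C2 M act 0 x [] =
    (\<Otimes>\<^bsub>M\<^esub>gs\<in>basis (Suc 0). act (inv\<^bsub>C2\<^esub> (gs ! 0)) (x gs) \<otimes>\<^bsub>M\<^esub> inv\<^bsub>M\<^esub> x gs)"
    by (rule boundary_eval_0[OF fin x])
  also have "\<dots> = \<sigma> (x [t]) \<otimes>\<^bsub>M\<^esub> inv\<^bsub>M\<^esub> x [t]"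
    unfolding basis_eq using xM by (simp del: M.finprod_multf)
  finally show ?thesis .
qed

lemma boundary_1:
  assumes x: "x \<in> carrier (C (Suc (Suc 0)))"
  shows "bar_boundary C2 M act (Suc 0) x [t] = \<sigma> (x [t, t]) \<otimes>\<^bsub>M\<^esub> x [t, t]"
    and "bar_boundary C2 M act (Suc 0) x [id] =
      x [id, id] \<otimes>\<^bsub>M\<^esub> (x [id, t] \<otimes>\<^bsub>M\<^esub> (\<sigma> (x [t, id]) \<otimes>\<^bsub>M\<^esub> inv\<^bsub>M\<^esub> x [t, t]))"
proof -
  have xM: "x [id, id] \<in> carrier M" "x [t, t] \<in> carrier M" "x [id, t] \<in> carrier M" "x [t, id] \<in> carrier M"
    using x by (auto simp: carrier_C basis_eq)
  have hs: "[t] \<in> basis (Suc 0)" "[id] \<in> basis (Suc 0)"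
    by (simp_all add: basis_eq)
  note eval = boundary_eval_1[OF fin x, unfolded basis_eq(3)]
  show "bar_boundary C2 M act (Suc 0) x [t] = \<sigma> (x [t, t]) \<otimes>\<^bsub>M\<^esub> x [t, t]"
    by (rule trans[OF eval[OF _ hs(1)]]) (use xM in \<open>simp_all add: sym_group_mult fin M.m_assoc del: M.finprod_multf\<close>)
  show "bar_boundary C2 M act (Suc 0) x [id] =
      x [id, id] \<otimes>\<^bsub>M\<^esub> (x [id, t] \<otimes>\<^bsub>M\<^esub> (\<sigma> (x [t, id]) \<otimes>\<^bsub>M\<^esub> inv\<^bsub>M\<^esub> x [t, t]))"
    by (rule trans[OF eval[OF _ hs(2)]]) (use xM in \<open>simp_all add: sym_group_mult fin M.m_assoc del: M.finprod_multf\<close>)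
qed

lemma cycles_1: "carrier (bar_cycles C2 M act (Suc 0)) = {x \<in> carrier (C (Suc 0)). \<sigma> (x [t]) = x [t]}"
proof -
  have "bar_boundary C2 M act 0 x = \<one>\<^bsub>C 0\<^esub> \<longleftrightarrow> \<sigma> (x [t]) = x [t]" if x: "x \<in> carrier (C (Suc 0))" for x
  proof -
    have xM: "x [t] \<in> carrier M"
      using x by (auto simp: carrier_C basis_eq)
    have "bar_boundary C2 M act 0 x \<in> carrier (C 0)"
      using boundary_closed[of x 0] x by (simp add: basis_eq)
    then have "bar_boundary C2 M act 0 x = \<one>\<^bsub>C 0\<^esub> \<longleftrightarrow> bar_boundary C2 M act 0 x [] = \<one>\<^bsub>M\<^esub>"
      by (auto simp: carrier_C basis_eq PiE_iff extensional_def fun_eq_iff)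
    also have "\<dots> \<longleftrightarrow> \<sigma> (x [t]) = x [t]"
      unfolding boundary_0[OF x] using xM M.inv_equality M.r_inv M.inv_inv M.inv_closed \<sigma>_closed by metis
    finally show ?thesis .
  qed
  then show ?thesis
    by (auto simp: bar_cycles_def kernel_def)
qed

text \<open>In degree 1 the coordinate at \<open>[id]\<close> is unrestricted both in cycles and in
  boundaries. The homology is read off at \<open>[t]\<close>.\<close>

lemma boundaries_1:
  "bar_boundaries C2 M act (Suc 0) = {x \<in> carrier (C (Suc 0)). \<exists>m\<in>carrier M. x [t] = m \<otimes>\<^bsub>M\<^esub> \<sigma> m}"
proof
  show "bar_boundaries C2 M act (Suc 0) \<subseteq> {x \<in> carrier (C (Suc 0)). \<exists>m\<in>carrier M. x [t] = m \<otimes>\<^bsub>M\<^esub> \<sigma> m}"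
  proof
    fix x assume "x \<in> bar_boundaries C2 M act (Suc 0)"
    then obtain y where y: "y \<in> carrier (C (Suc (Suc 0)))" "x = bar_boundary C2 M act (Suc 0) y"
      by (auto simp: bar_boundaries_def)
    then have m: "y [t, t] \<in> carrier M"
      by (auto simp: carrier_C basis_eq)
    then have "x [t] = y [t, t] \<otimes>\<^bsub>M\<^esub> \<sigma> (y [t, t])"
      using boundary_1(1)[OF y(1)] y(2) by (simp add: M.m_comm)
    moreover have "x \<in> carrier (C (Suc 0))"
      using boundary_closed[of y "Suc 0"] y by (simp add: basis_eq)
    ultimately show "x \<in> {x \<in> carrier (C (Suc 0)). \<exists>m\<in>carrier M. x [t] = m \<otimes>\<^bsub>M\<^esub> \<sigma> m}"
      using m by blast
  qed
  show "{x \<in> carrier (C (Suc 0)). \<exists>m\<in>carrier M. x [t] = m \<otimes>\<^bsub>M\<^esub> \<sigma> m} \<subseteq> bar_boundaries C2 M act (Suc 0)"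
  proof
    fix x assume "x \<in> {x \<in> carrier (C (Suc 0)). \<exists>m\<in>carrier M. x [t] = m \<otimes>\<^bsub>M\<^esub> \<sigma> m}"
    then obtain m where x: "x \<in> carrier (C (Suc 0))" and m: "m \<in> carrier M" "x [t] = m \<otimes>\<^bsub>M\<^esub> \<sigma> m"
      by blast
    have xM: "x [id] \<in> carrier M"
      using x by (auto simp: carrier_C basis_eq)
    \<comment> \<open>At \<open>[id]\<close> the boundary of \<open>y\<close> is
      \<open>y [id, id]\<close> times the inverse of \<open>y [t, t]\<close>, which the extra factor
      \<open>m\<close> compensates.\<close>
    define y where "y = (\<lambda>gs\<in>basis (Suc (Suc 0)). if gs = [t, t] then m else if gs = [id, id] then x [id] \<otimes>\<^bsub>M\<^esub> m else \<one>\<^bsub>M\<^esub>)"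
    have "finite (basis (Suc (Suc 0)))"
      by (simp add: basis_eq)
    then have y: "y \<in> carrier (C (Suc (Suc 0)))"
      using m xM by (auto simp: carrier_C y_def)
    have yv: "y [t, t] = m" "y [id, id] = x [id] \<otimes>\<^bsub>M\<^esub> m" "y [id, t] = \<one>\<^bsub>M\<^esub>" "y [t, id] = \<one>\<^bsub>M\<^esub>"
      by (simp_all add: y_def basis_eq)
    have "bar_boundary C2 M act (Suc 0) y = x"
    proof (rule extensionalityI[of _ "basis (Suc 0)"])
      have "bar_boundary C2 M act (Suc 0) y \<in> carrier (C (Suc 0))"
        by (rule boundary_closed[of y "Suc 0"]) (use y in \<open>simp_all add: basis_eq(2)\<close>)
      then show "bar_boundary C2 M act (Suc 0) y \<in> extensional (basis (Suc 0))" "x \<in> extensional (basis (Suc 0))"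
        using x by (simp_all only: C_extensional)
      fix gs assume "gs \<in> basis (Suc 0)"
      then consider "gs = [t]" | "gs = [id]"
        by (auto simp: basis_eq)
      then show "bar_boundary C2 M act (Suc 0) y gs = x gs"
      proof cases
        case 1
        then show ?thesis
          using boundary_1(1)[OF y] yv m by (simp add: M.m_comm)
      next
        case 2
        then show ?thesis
          using boundary_1(2)[OF y] yv m xM by (simp add: M.m_assoc)
      qed
    qed
    then show "x \<in> bar_boundaries C2 M act (Suc 0)"
      unfolding bar_boundaries_def using y by (intro image_eqI[of _ _ y]) simp_all
  qed
qed

end

text \<open>Evaluation at \<open>[t]\<close> identifies the homology with invariants modulo norms. A
  homomorphism on the invariants whose kernel consists of the norms therefore induces an embedding
  with the same image.\<close>

lemma (in involution_module) H1_embedding: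
  assumes P: "comm_group P"
    and f_closed: "\<And>m. \<lbrakk>m \<in> carrier M; \<sigma> m = m\<rbrakk> \<Longrightarrow> f m \<in> carrier P"
    and f_mult: "\<And>m n. \<lbrakk>m \<in> carrier M; n \<in> carrier M; \<sigma> m = m; \<sigma> n = n\<rbrakk> \<Longrightarrow> f (m \<otimes>\<^bsub>M\<^esub> n) = f m \<otimes>\<^bsub>P\<^esub> f n"
    and f_ker: "\<And>m. \<lbrakk>m \<in> carrier M; \<sigma> m = m\<rbrakk> \<Longrightarrow> f m = \<one>\<^bsub>P\<^esub> \<longleftrightarrow> (\<exists>n\<in>carrier M. m = n \<otimes>\<^bsub>M\<^esub> \<sigma> n)"
    and \<sigma>\<sigma>: "\<And>m. m \<in> carrier M \<Longrightarrow> \<sigma> (\<sigma> m) = m"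
  shows "\<exists>\<theta>. group_hom (group_homology (Suc 0) C2 M act) P \<theta> \<and>
    inj_on \<theta> (carrier (group_homology (Suc 0) C2 M act)) \<and>
    \<theta> ` carrier (group_homology (Suc 0) C2 M act) = f ` {m \<in> carrier M. \<sigma> m = m}"
proof -
  interpret P: comm_group P by fact
  interpret \<sigma>: group_hom M M \<sigma>
    using hom M.is_group by (simp add: group_hom_def group_hom_axioms_def)
  interpret C1: comm_group "C (Suc 0)" by (rule C_comm_group)
  let ?Z = "bar_cycles C2 M act (Suc 0)" and ?B = "bar_boundaries C2 M act (Suc 0)"
  let ?g = "\<lambda>x. f (x [t])"
  have xM: "x [t] \<in> carrier M" if "x \<in> carrier (C (Suc 0))" for x
    using that by (auto simp: carrier_C basis_eq)
  have Z: "?Z = (C (Suc 0))\<lparr>carrier := carrier ?Z\<rparr>"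
    by (simp add: bar_cycles_def)
  have sub: "subgroup (carrier ?Z) (C (Suc 0))"
    unfolding cycles_1
  proof (rule C1.subgroupI)
    show "{x \<in> carrier (C (Suc 0)). \<sigma> (x [t]) = x [t]} \<noteq> {}"
      using C1.one_closed by (auto simp: basis_eq intro!: exI[of _ "\<one>\<^bsub>C (Suc 0)\<^esub>"])
    fix x assume x: "x \<in> {x \<in> carrier (C (Suc 0)). \<sigma> (x [t]) = x [t]}"
    have "(inv\<^bsub>C (Suc 0)\<^esub> x) [t] = inv\<^bsub>M\<^esub> (x [t])"
      using group_hom.hom_inv[OF eval_hom[of "[t]" "Suc 0"]] x by (simp add: basis_eq)
    then show "inv\<^bsub>C (Suc 0)\<^esub> x \<in> {x \<in> carrier (C (Suc 0)). \<sigma> (x [t]) = x [t]}"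
      using x xM by simp
  next
    fix x y assume "x \<in> {x \<in> carrier (C (Suc 0)). \<sigma> (x [t]) = x [t]}" "y \<in> {x \<in> carrier (C (Suc 0)). \<sigma> (x [t]) = x [t]}"
    then show "x \<otimes>\<^bsub>C (Suc 0)\<^esub> y \<in> {x \<in> carrier (C (Suc 0)). \<sigma> (x [t]) = x [t]}"
      using xM C1.m_closed[of x y] by (simp add: basis_eq)
  qed auto
  have grp: "group ?Z"
    using C1.subgroup_imp_group[OF sub] Z by simp
  interpret g: group_hom ?Z P ?g
  proof (intro group_hom.intro group_hom_axioms.intro grp P.is_group homI)
    fix x assume "x \<in> carrier ?Z"
    then show "?g x \<in> carrier P"
      using f_closed xM by (simp add: cycles_1)
  next
    fix x y assume xy: "x \<in> carrier ?Z" "y \<in> carrier ?Z"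
    have "(x \<otimes>\<^bsub>?Z\<^esub> y) [t] = x [t] \<otimes>\<^bsub>M\<^esub> y [t]"
      by (simp add: bar_cycles_def basis_eq)
    then show "?g (x \<otimes>\<^bsub>?Z\<^esub> y) = ?g x \<otimes>\<^bsub>P\<^esub> ?g y"
      using xy xM f_mult by (simp add: cycles_1)
  qed
  have ker: "kernel ?Z P ?g = ?B"
  proof -
    have "\<sigma> (x [t]) = x [t]" if "x \<in> carrier (C (Suc 0))" "m \<in> carrier M" "x [t] = m \<otimes>\<^bsub>M\<^esub> \<sigma> m" for x m
      using that \<sigma>\<sigma> by (simp add: M.m_comm)
    then show ?thesis
      unfolding kernel_def cycles_1 boundaries_1 using f_ker xM by blast
  qed
  have H: "group_homology (Suc 0) C2 M act = ?Z Mod kernel ?Z P ?g"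
    unfolding group_homology_def ker ..
  let ?\<theta> = "\<lambda>X. the_elem (?g ` X)"
  have "group_hom (?Z Mod kernel ?Z P ?g) P ?\<theta>"
    using g.FactGroup_hom normal.factorgroup_is_group[OF g.normal_kernel] P.is_group
    by (simp add: group_hom_def group_hom_axioms_def)
  moreover have "inj_on ?\<theta> (carrier (?Z Mod kernel ?Z P ?g))"
    by (rule g.FactGroup_inj_on)
  moreover have "?\<theta> ` carrier (?Z Mod kernel ?Z P ?g) = ?g ` carrier ?Z"
  proof -
    have "?\<theta> (kernel ?Z P ?g #>\<^bsub>?Z\<^esub> x) = ?g x" if x: "x \<in> carrier ?Z" for x
    proof -
      have "?g ` (kernel ?Z P ?g #>\<^bsub>?Z\<^esub> x) = {?g x}"
      proof -
        have "?g (k \<otimes>\<^bsub>?Z\<^esub> x) = ?g x" if "k \<in> kernel ?Z P ?g" for k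
          using that g.hom_mult[of k x] g.hom_closed[OF x] x by (simp add: kernel_def del: C_simps)
        moreover have "\<one>\<^bsub>?Z\<^esub> \<in> kernel ?Z P ?g"
          using g.hom_one g.G.one_closed by (simp add: kernel_def del: C_simps)
        ultimately show ?thesis
          unfolding r_coset_def image_UN image_insert image_empty by blast
      qed
      then show ?thesis
        by simp
    qed
    then show ?thesis
      unfolding carrier_FactGroup image_image by simp
  qed
  moreover have "?g ` carrier ?Z = f ` {m \<in> carrier M. \<sigma> m = m}"
  proof
    show "?g ` carrier ?Z \<subseteq> f ` {m \<in> carrier M. \<sigma> m = m}"
      using xM by (auto simp: cycles_1)
    show "f ` {m \<in> carrier M. \<sigma> m = m} \<subseteq> ?g ` carrier ?Z"
    proof clarify
      fix m assume m: "m \<in> carrier M" "\<sigma> m = m"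
      have "bar_single C2 M [t] m \<in> carrier (C (Suc 0))"
        by (rule single_closed) (use m in \<open>auto simp: basis_eq\<close>)
      moreover have "bar_single C2 M [t] m [t] = m"
        using single_eval[of "[t]" "Suc 0" "[t]"] by (simp add: basis_eq)
      ultimately show "f m \<in> ?g ` carrier ?Z"
        using m by (intro image_eqI[of _ _ "bar_single C2 M [t] m"]) (auto simp: cycles_1)
    qed
  qed
  ultimately show ?thesis
    unfolding H by (intro exI[of _ ?\<theta>] conjI) (simp_all only:)
qed

section \<open>Abelian extensions from symmetric cocycles\<close>

locale symmetric_cocycle = U: comm_group U + A: comm_group A
  for U :: "('u, 'k) monoid_scheme" and A :: "('a, 'm) monoid_scheme" +
  fixes c :: "'a \<Rightarrow> 'a \<Rightarrow> 'u"
  assumes c_closed [simp]: "\<lbrakk>a \<in> carrier A; b \<in> carrier A\<rbrakk> \<Longrightarrow> c a b \<in> carrier U"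
    and c_sym: "\<lbrakk>a \<in> carrier A; b \<in> carrier A\<rbrakk> \<Longrightarrow> c a b = c b a"
    and cocycle: "\<lbrakk>x \<in> carrier A; y \<in> carrier A; z \<in> carrier A\<rbrakk> \<Longrightarrow>
      c y z \<otimes>\<^bsub>U\<^esub> c x (y \<otimes>\<^bsub>A\<^esub> z) = c (x \<otimes>\<^bsub>A\<^esub> y) z \<otimes>\<^bsub>U\<^esub> c x y"
begin

text \<open>The cocycle is not normalised: its constant value at the neutral element shifts the
  unit, and likewise the embedding of \<open>U\<close> below.\<close>

definition E :: "('u \<times> 'a) monoid"
  where "E = \<lparr>carrier = carrier U \<times> carrier A,
    monoid.mult = (\<lambda>(u, a) (v, b). (u \<otimes>\<^bsub>U\<^esub> v \<otimes>\<^bsub>U\<^esub> c a b, a \<otimes>\<^bsub>A\<^esub> b)),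
    one = (inv\<^bsub>U\<^esub> c \<one>\<^bsub>A\<^esub> \<one>\<^bsub>A\<^esub>, \<one>\<^bsub>A\<^esub>)\<rparr>"

lemma E_simps [simp]: "carrier E = carrier U \<times> carrier A"
  "(u, a) \<otimes>\<^bsub>E\<^esub> (v, b) = (u \<otimes>\<^bsub>U\<^esub> v \<otimes>\<^bsub>U\<^esub> c a b, a \<otimes>\<^bsub>A\<^esub> b)"
  "\<one>\<^bsub>E\<^esub> = (inv\<^bsub>U\<^esub> c \<one>\<^bsub>A\<^esub> \<one>\<^bsub>A\<^esub>, \<one>\<^bsub>A\<^esub>)"
  by (simp_all add: E_def)

lemma c_one: "b \<in> carrier A \<Longrightarrow> c \<one>\<^bsub>A\<^esub> b = c \<one>\<^bsub>A\<^esub> \<one>\<^bsub>A\<^esub>"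
  using cocycle[of "\<one>\<^bsub>A\<^esub>" "\<one>\<^bsub>A\<^esub>" b] by simp

lemma E_comm_group: "comm_group E"
proof (rule comm_groupI)
  fix x y assume "x \<in> carrier E" "y \<in> carrier E"
  then show "x \<otimes>\<^bsub>E\<^esub> y \<in> carrier E"
    by auto
next
  show "\<one>\<^bsub>E\<^esub> \<in> carrier E"
    by simp
next
  fix x y z assume "x \<in> carrier E" "y \<in> carrier E" "z \<in> carrier E"
  then obtain u1 a1 u2 a2 u3 a3 where *: "x = (u1, a1)" "y = (u2, a2)" "z = (u3, a3)"
    "u1 \<in> carrier U" "u2 \<in> carrier U" "u3 \<in> carrier U" "a1 \<in> carrier A" "a2 \<in> carrier A" "a3 \<in> carrier A"
    by (cases x; cases y; cases z) auto
  have "u1 \<otimes>\<^bsub>U\<^esub> u2 \<otimes>\<^bsub>U\<^esub> c a1 a2 \<otimes>\<^bsub>U\<^esub> u3 \<otimes>\<^bsub>U\<^esub> c (a1 \<otimes>\<^bsub>A\<^esub> a2) a3 =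
      u1 \<otimes>\<^bsub>U\<^esub> u2 \<otimes>\<^bsub>U\<^esub> u3 \<otimes>\<^bsub>U\<^esub> (c (a1 \<otimes>\<^bsub>A\<^esub> a2) a3 \<otimes>\<^bsub>U\<^esub> c a1 a2)"
    using * by (simp add: U.m_ac)
  also have "\<dots> = u1 \<otimes>\<^bsub>U\<^esub> u2 \<otimes>\<^bsub>U\<^esub> u3 \<otimes>\<^bsub>U\<^esub> (c a2 a3 \<otimes>\<^bsub>U\<^esub> c a1 (a2 \<otimes>\<^bsub>A\<^esub> a3))"
    using * cocycle by simp
  also have "\<dots> = u1 \<otimes>\<^bsub>U\<^esub> (u2 \<otimes>\<^bsub>U\<^esub> u3 \<otimes>\<^bsub>U\<^esub> c a2 a3) \<otimes>\<^bsub>U\<^esub> c a1 (a2 \<otimes>\<^bsub>A\<^esub> a3)"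
    using * by (simp add: U.m_ac)
  finally show "x \<otimes>\<^bsub>E\<^esub> y \<otimes>\<^bsub>E\<^esub> z = x \<otimes>\<^bsub>E\<^esub> (y \<otimes>\<^bsub>E\<^esub> z)"
    using * by (simp add: A.m_assoc)
next
  fix x y assume "x \<in> carrier E" "y \<in> carrier E"
  then show "x \<otimes>\<^bsub>E\<^esub> y = y \<otimes>\<^bsub>E\<^esub> x"
    by (cases x; cases y) (auto simp: U.m_comm A.m_comm c_sym)
next
  fix x assume "x \<in> carrier E"
  then obtain u a where x: "x = (u, a)" "u \<in> carrier U" "a \<in> carrier A"
    by (cases x) auto
  then show "\<one>\<^bsub>E\<^esub> \<otimes>\<^bsub>E\<^esub> x = x"
    using c_one[OF x(3)] by (simp add: U.m_ac)
  show "\<exists>y\<in>carrier E. y \<otimes>\<^bsub>E\<^esub> x = \<one>\<^bsub>E\<^esub>"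
  proof
    let ?y = "(inv\<^bsub>U\<^esub> c \<one>\<^bsub>A\<^esub> \<one>\<^bsub>A\<^esub> \<otimes>\<^bsub>U\<^esub> inv\<^bsub>U\<^esub> (u \<otimes>\<^bsub>U\<^esub> c (inv\<^bsub>A\<^esub> a) a), inv\<^bsub>A\<^esub> a)"
    show "?y \<in> carrier E"
      using x by simp
    show "?y \<otimes>\<^bsub>E\<^esub> x = \<one>\<^bsub>E\<^esub>"
      using x by (simp add: U.m_assoc)
  qed
qed

lemma embedding_hom: "group_hom U E (\<lambda>u. (u \<otimes>\<^bsub>U\<^esub> inv\<^bsub>U\<^esub> c \<one>\<^bsub>A\<^esub> \<one>\<^bsub>A\<^esub>, \<one>\<^bsub>A\<^esub>))"
proof (intro group_hom.intro group_hom_axioms.intro homI)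
  fix u v assume uv: "u \<in> carrier U" "v \<in> carrier U"
  let ?c = "c \<one>\<^bsub>A\<^esub> \<one>\<^bsub>A\<^esub>"
  have "u \<otimes>\<^bsub>U\<^esub> inv\<^bsub>U\<^esub> ?c \<otimes>\<^bsub>U\<^esub> (v \<otimes>\<^bsub>U\<^esub> inv\<^bsub>U\<^esub> ?c) \<otimes>\<^bsub>U\<^esub> ?c = u \<otimes>\<^bsub>U\<^esub> v \<otimes>\<^bsub>U\<^esub> inv\<^bsub>U\<^esub> ?c"
    using uv by (simp add: U.m_assoc) (simp add: U.m_ac)
  then show "(u \<otimes>\<^bsub>U\<^esub> v \<otimes>\<^bsub>U\<^esub> inv\<^bsub>U\<^esub> ?c, \<one>\<^bsub>A\<^esub>) =
      (u \<otimes>\<^bsub>U\<^esub> inv\<^bsub>U\<^esub> ?c, \<one>\<^bsub>A\<^esub>) \<otimes>\<^bsub>E\<^esub> (v \<otimes>\<^bsub>U\<^esub> inv\<^bsub>U\<^esub> ?c, \<one>\<^bsub>A\<^esub>)"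
    by simp
qed (use E_comm_group in \<open>auto simp: comm_group_def\<close>)

end


section \<open>Second homology in terms of the bar resolution\<close>

context abelian_presentation
begin

abbreviation "bas n \<equiv> bar_basis A n"

text \<open>\<open>d1\<close> and \<open>d2\<close> are the bar differentials out of degrees 2 and
  3, on formal sums of lists in place of finitely supported functions.\<close>

definition d1 :: "('a list \<Rightarrow>\<^sub>0 int) \<Rightarrow> ('a list \<Rightarrow>\<^sub>0 int)"
  where "d1 = frag_extend (\<lambda>l. frag_of [l ! 1] - frag_of [l ! 0 \<otimes> l ! 1] + frag_of [l ! 0])"

definition d2 :: "('a list \<Rightarrow>\<^sub>0 int) \<Rightarrow> ('a list \<Rightarrow>\<^sub>0 int)"
  where "d2 = frag_extend (\<lambda>l. frag_of [l ! 1, l ! 2] - frag_of [l ! 0 \<otimes> l ! 1, l ! 2]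
    + frag_of [l ! 0, l ! 1 \<otimes> l ! 2] - frag_of [l ! 0, l ! 1])"

definition wedge :: "('a \<times> 'a \<Rightarrow>\<^sub>0 int) \<Rightarrow> ('a list \<Rightarrow>\<^sub>0 int)"
  where "wedge = frag_extend (\<lambda>(a, b). frag_of [a, b] - frag_of [b, a])"

definition B2 :: "('a list \<Rightarrow>\<^sub>0 int) set"
  where "B2 = d2 ` frags (bas 3)"

lemma bas_simps [simp]: "[a] \<in> bas (Suc 0) \<longleftrightarrow> a \<in> carrier A" "[a, b] \<in> bas 2 \<longleftrightarrow> a \<in> carrier A \<and> b \<in> carrier A"
  "[a, b, c] \<in> bas 3 \<longleftrightarrow> a \<in> carrier A \<and> b \<in> carrier A \<and> c \<in> carrier A"
  by (auto simp: bar_basis_def)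

lemma bas_1E: "l \<in> bas (Suc 0) \<Longrightarrow> (\<And>a. l = [a] \<Longrightarrow> a \<in> carrier A \<Longrightarrow> P) \<Longrightarrow> P"
  by (auto simp: bar_basis_def length_Suc_conv)

lemma bas_2E: "l \<in> bas 2 \<Longrightarrow> (\<And>a b. l = [a, b] \<Longrightarrow> a \<in> carrier A \<Longrightarrow> b \<in> carrier A \<Longrightarrow> P) \<Longrightarrow> P"
  by (auto simp: bar_basis_def length_Suc_conv numeral_2_eq_2)

lemma bas_3E: "l \<in> bas 3 \<Longrightarrow>
    (\<And>a b c. l = [a, b, c] \<Longrightarrow> a \<in> carrier A \<Longrightarrow> b \<in> carrier A \<Longrightarrow> c \<in> carrier A \<Longrightarrow> P) \<Longrightarrow> P"
  by (auto simp: bar_basis_def length_Suc_conv numeral_3_eq_3)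

lemma d1_diff: "d1 (z - z') = d1 z - d1 z'" and d1_0 [simp]: "d1 0 = 0"
  and d1_of [simp]: "d1 (frag_of [a, b]) = frag_of [b] - frag_of [a \<otimes> b] + frag_of [a]"
  by (simp_all add: d1_def frag_extend_diff)

lemma d2_diff: "d2 (z - z') = d2 z - d2 z'" and d2_0 [simp]: "d2 0 = 0"
  and d2_of [simp]: "d2 (frag_of [a, b, c]) =
    frag_of [b, c] - frag_of [a \<otimes> b, c] + frag_of [a, b \<otimes> c] - frag_of [a, b]"
  by (simp_all add: d2_def frag_extend_diff numeral_2_eq_2)

lemma wedge_diff: "wedge (z - z') = wedge z - wedge z'" and wedge_0 [simp]: "wedge 0 = 0"
  and wedge_of [simp]: "wedge (frag_of (a, b)) = frag_of [a, b] - frag_of [b, a]"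
  by (simp_all add: wedge_def frag_extend_diff)

lemma wedge_flip: "wedge (flip z) = - wedge z"
  by (induction z rule: frag_ext_induct) (auto simp: flip_diff wedge_diff)

lemma subspace_B2 [simp]: "frag.subspace B2"
  unfolding B2_def
proof (rule frag_subspaceI)
  show "0 \<in> d2 ` frags (bas 3)"
    by (intro image_eqI[of _ _ 0]) auto
  fix x y assume "x \<in> d2 ` frags (bas 3)" "y \<in> d2 ` frags (bas 3)"
  then show "x - y \<in> d2 ` frags (bas 3)"
    by (auto simp flip: d2_diff)
qed

lemma d1_in: "z \<in> frags (bas 2) \<Longrightarrow> d1 z \<in> frags (bas (Suc 0))"
  by (induction rule: frags_induct) (auto simp: d1_diff elim!: bas_2E)

lemma d2_in: "z \<in> frags (bas 3) \<Longrightarrow> d2 z \<in> frags (bas 2)"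
  by (induction rule: frags_induct) (auto simp: d2_diff elim!: bas_3E)

lemma wedge_in: "z \<in> frags (carrier A \<times> carrier A) \<Longrightarrow> wedge z \<in> frags (bas 2)"
  by (induction rule: frags_induct) (auto simp: wedge_diff)

lemma d1_d2: "z \<in> frags (bas 3) \<Longrightarrow> d1 (d2 z) = 0"
proof (induction rule: frags_induct)
  case (of l)
  then show ?case
    by (elim bas_3E) (simp add: d1_diff m_assoc, simp add: d1_def frag_extend_diff frag_extend_add m_assoc)
qed (auto simp: d2_diff d1_diff)

lemma d1_wedge: "z \<in> frags (carrier A \<times> carrier A) \<Longrightarrow> d1 (wedge z) = 0"
proof (induction rule: frags_induct)
  case (of p)
  then show ?case
    by (cases p) (auto simp: d1_diff m_comm)
qed (auto simp: wedge_diff d1_diff)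

text \<open>The shuffle of \<open>[a|a']\<close> with \<open>[b]\<close>.\<close>

lemma wedge_bilinear:
  assumes "a \<in> carrier A" "a' \<in> carrier A" "b \<in> carrier A"
  shows "wedge (frag_of (a \<otimes> a', b) - frag_of (a, b) - frag_of (a', b)) \<in> B2"
    and "wedge (frag_of (b, a \<otimes> a') - frag_of (b, a) - frag_of (b, a')) \<in> B2"
proof -
  let ?s = "frag_of [a, b, a'] - frag_of [a, a', b] - frag_of [b, a, a']"
  have "wedge (frag_of (a \<otimes> a', b) - frag_of (a, b) - frag_of (a', b)) = d2 ?s"
    using assms by (simp add: wedge_diff d2_diff m_comm)
  moreover have "?s \<in> frags (bas 3)"
    using assms by simp
  ultimately show 1: "wedge (frag_of (a \<otimes> a', b) - frag_of (a, b) - frag_of (a', b)) \<in> B2"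
    unfolding B2_def by blast
  have "wedge (frag_of (b, a \<otimes> a') - frag_of (b, a) - frag_of (b, a')) =
      - wedge (frag_of (a \<otimes> a', b) - frag_of (a, b) - frag_of (a', b))"
    unfolding wedge_flip[symmetric] by (simp add: flip_diff)
  then show "wedge (frag_of (b, a \<otimes> a') - frag_of (b, a) - frag_of (b, a')) \<in> B2"
    using frag.subspace_neg[OF subspace_B2 1] by simp
qed

text \<open>Symmetry of the cocycle makes \<open>E\<close> abelian, so a \<mapsto> (0, a) extends to
  a homomorphism on the free abelian group of 1-chains. This homomorphism recovers from
  \<open>d1 z\<close> the class of \<open>z\<close> modulo \<open>Q\<close>; hence a cycle has
  trivial class.\<close>

lemma cycle_homologous_wedge:
  assumes c: "c \<in> frags (bas 2)" "d1 c = 0"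
  shows "\<exists>z\<in>frags (carrier A \<times> carrier A). c - wedge z \<in> B2"
proof -
  define Q where "Q = {b + wedge z | b z. b \<in> B2 \<and> z \<in> frags (carrier A \<times> carrier A)}"
  have Qs: "frag.subspace Q"
    unfolding Q_def
  proof (rule frag_subspaceI; clarify)
    show "\<exists>b z. 0 = b + wedge z \<and> b \<in> B2 \<and> z \<in> frags (carrier A \<times> carrier A)"
      by (intro exI[of _ 0]) (auto simp: frag.subspace_0)
    fix b z b' z' assume *: "b \<in> B2" "z \<in> frags (carrier A \<times> carrier A)" "b' \<in> B2" "z' \<in> frags (carrier A \<times> carrier A)"
    show "\<exists>b'' z''. b + wedge z - (b' + wedge z') = b'' + wedge z'' \<and> b'' \<in> B2 \<and> z'' \<in> frags (carrier A \<times> carrier A)"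
      by (intro exI[of _ "b - b'"] exI[of _ "z - z'"]) (use * in \<open>auto simp: wedge_diff frag.subspace_diff\<close>)
  qed
  then have spQ: "frag.span Q = Q"
    by simp
  have BQ: "b \<in> B2 \<Longrightarrow> b \<in> Q" for b
    unfolding Q_def by (intro CollectI exI[of _ b] exI[of _ 0]) simp
  have wQ: "z \<in> frags (carrier A \<times> carrier A) \<Longrightarrow> wedge z \<in> Q" for z
    unfolding Q_def by (intro CollectI exI[of _ 0] exI[of _ z]) (simp add: frag.subspace_0)
  have Q: "Q \<subseteq> frags (bas 2)"
    unfolding Q_def B2_def using d2_in wedge_in by auto
  let ?U = "presented (bas 2) Q" and ?q = "pcl (bas 2) Q"
  have U: "comm_group ?U"
    by (rule presented_comm_group) (use Q in simp)
  interpret U: comm_group ?U by (rule U)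
  interpret q: group_hom "free_Abelian_group (bas 2)" ?U ?q
    by (rule pcl_hom[OF Q])
  have qadd: "?q (x + y) = ?q x \<otimes>\<^bsub>?U\<^esub> ?q y" if "x \<in> frags (bas 2)" "y \<in> frags (bas 2)" for x y
    using q.hom_mult[of x y] that by simp
  define u where "u = (\<lambda>a b. ?q (frag_of [a, b]))"
  interpret symmetric_cocycle ?U A u
  proof (intro symmetric_cocycle.intro symmetric_cocycle_axioms.intro U comm_group_A)
    fix a b assume ab: "a \<in> carrier A" "b \<in> carrier A"
    show "u a b \<in> carrier ?U"
      unfolding u_def using q.hom_closed[of "frag_of [a, b]"] ab by simp
    show "u a b = u b a"
      unfolding u_def using ab wQ[of "frag_of (a, b)"] by (subst pcl_eq_iff[OF Q]) (simp_all add: spQ)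
  next
    fix x y z assume xyz: "x \<in> carrier A" "y \<in> carrier A" "z \<in> carrier A"
    have "d2 (frag_of [x, y, z]) \<in> Q"
      using xyz by (intro BQ) (simp add: B2_def del: d2_of)
    then have "?q (frag_of [y, z] + frag_of [x, y \<otimes> z]) = ?q (frag_of [x \<otimes> y, z] + frag_of [x, y])"
      using xyz by (subst pcl_eq_iff[OF Q]) (simp_all add: spQ algebra_simps)
    then show "u y z \<otimes>\<^bsub>?U\<^esub> u x (y \<otimes> z) = u (x \<otimes> y) z \<otimes>\<^bsub>?U\<^esub> u x y"
      unfolding u_def using xyz by (simp add: qadd)
  qed
  interpret EE: comm_group E by (rule E_comm_group)
  let ?\<iota> = "\<lambda>v. (v \<otimes>\<^bsub>?U\<^esub> inv\<^bsub>?U\<^esub> u \<one> \<one>, \<one>)"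
  define f where "f = (\<lambda>l :: 'a list. (\<one>\<^bsub>?U\<^esub>, l ! 0))"
  let ?h = "free_lift E f"
  have f: "f \<in> bas (Suc 0) \<rightarrow> carrier E"
    by (auto simp: f_def elim!: bas_1E)
  have h: "group_hom (free_Abelian_group (bas (Suc 0))) E ?h"
    using free_lift_hom[OF E_comm_group f] EE.is_group by (simp add: group_hom_def group_hom_axioms_def)
  have h_of: "?h (frag_of [a]) = (\<one>\<^bsub>?U\<^esub>, a)" if "a \<in> carrier A" for a
    using free_lift_frag_of[OF E_comm_group, of f "[a]"] that by (simp add: f_def)
  \<comment> \<open>\<open>?\<iota>\<close> is injective, so this identity determines the class
    \<open>?q z\<close> from \<open>d1 z\<close>.\<close>
  have "?h (d1 z) = ?\<iota> (?q z)" if "z \<in> frags (bas 2)" for z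
    using that
  proof (induction rule: frags_induct)
    case zero
    then show ?case
      using free_hom_zero[OF h] free_hom_zero[OF q.group_hom_axioms] by simp
  next
    case (of l)
    then obtain a b where l: "l = [a, b]" and ab: "a \<in> carrier A" "b \<in> carrier A"
      by (rule bas_2E)
    have mem: "?h (frag_of [a]) \<in> carrier E" "?h (frag_of [b]) \<in> carrier E" "?h (frag_of [a \<otimes> b]) \<in> carrier E"
      using ab by (simp_all add: h_of)
    have "d1 (frag_of l) = frag_of [b] - (frag_of [a \<otimes> b] - frag_of [a])"
      by (simp add: l)
    then have "?h (d1 (frag_of l)) = ?h (frag_of [b]) \<otimes>\<^bsub>E\<^esub> inv\<^bsub>E\<^esub> (?h (frag_of [a \<otimes> b]) \<otimes>\<^bsub>E\<^esub> inv\<^bsub>E\<^esub> ?h (frag_of [a]))"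
      using ab by (simp add: free_hom_diff[OF h] del: E_simps)
    also have "\<dots> = ?h (frag_of [a]) \<otimes>\<^bsub>E\<^esub> ?h (frag_of [b]) \<otimes>\<^bsub>E\<^esub> inv\<^bsub>E\<^esub> ?h (frag_of [a \<otimes> b])"
      using mem by (simp add: EE.inv_mult EE.m_ac del: E_simps)
    \<comment> \<open>In \<open>E\<close> the failure of a \<mapsto> (0, a) to be additive is
      exactly the cocycle.\<close>
    also have "?h (frag_of [a]) \<otimes>\<^bsub>E\<^esub> ?h (frag_of [b]) = ?\<iota> (u a b) \<otimes>\<^bsub>E\<^esub> ?h (frag_of [a \<otimes> b])"
      using ab c_one[of "a \<otimes> b"] by (simp add: h_of U.m_assoc)
    also have "?\<iota> (u a b) \<otimes>\<^bsub>E\<^esub> ?h (frag_of [a \<otimes> b]) \<otimes>\<^bsub>E\<^esub> inv\<^bsub>E\<^esub> ?h (frag_of [a \<otimes> b]) = ?\<iota> (u a b)"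
    proof -
      have "?\<iota> (u a b) \<in> carrier E"
        using ab by simp
      then show ?thesis
        using mem(3) by (simp add: EE.m_assoc del: E_simps)
    qed
    finally show ?case
      by (simp add: l u_def)
  next
    case (diff x y)
    have "?\<iota> (?q (x - y)) = ?\<iota> (?q x) \<otimes>\<^bsub>E\<^esub> inv\<^bsub>E\<^esub> ?\<iota> (?q y)"
    proof -
      have "?q x \<in> carrier ?U" "?q y \<in> carrier ?U"
        using q.hom_closed diff by simp_all
      then show ?thesis
        using group_hom.hom_mult[OF embedding_hom, of "?q x" "inv\<^bsub>?U\<^esub> ?q y"]
          group_hom.hom_inv[OF embedding_hom, of "?q y"] free_hom_diff[OF q.group_hom_axioms diff(1,2)]
        by (simp del: E_simps)
    qed
    then show ?case
      using diff by (simp add: d1_diff free_hom_diff[OF h] d1_in del: E_simps)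
  qed
  then have "?\<iota> (?q c) = \<one>\<^bsub>E\<^esub>"
    using c free_hom_zero[OF h] by metis
  then have "?q c \<otimes>\<^bsub>?U\<^esub> inv\<^bsub>?U\<^esub> u \<one> \<one> = inv\<^bsub>?U\<^esub> u \<one> \<one>"
    by simp
  moreover have "?q c \<in> carrier ?U"
    using q.hom_closed c by simp
  ultimately have "?q c = \<one>\<^bsub>?U\<^esub>"
    by (simp add: U.r_cancel_one)
  then have "c \<in> Q"
    using pcl_eq_one_iff[OF Q c(1)] spQ by simp
  then obtain b z where "c = b + wedge z" "b \<in> B2" "z \<in> frags (carrier A \<times> carrier A)"
    unfolding Q_def by blast
  then show ?thesis
    by (intro bexI[of _ z]) simp_all
qed

text \<open>The kernel of the map from F \<otimes> F to the exterior square of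
  \<open>A\<close>.\<close>

definition L :: "('a \<times> 'a \<Rightarrow>\<^sub>0 int) set"
  where "L = frag.span (J \<union> {frag_of (a, a) | a. a \<in> carrier A})"

lemma subspace_L [simp]: "frag.subspace L"
  by (simp add: L_def)

lemma J_le_L: "z \<in> J \<Longrightarrow> z \<in> L"
  unfolding L_def by (rule frag.span_base) simp

lemmas L_diff = frag.subspace_diff[OF subspace_L]
lemmas L_add = frag.subspace_add[OF subspace_L]
lemmas L_neg = frag.subspace_neg[OF subspace_L]

text \<open>Replacing x by the basis element of its value changes the square by an element of
  \<open>J\<close>.\<close>

lemma square_in_L:
  assumes "x \<in> F"
  shows "tens x x \<in> L"
proof -
  let ?a = "frag_of (eps A x)"
  have "tens (x - ?a) x \<in> J" "tens ?a (x - ?a) \<in> J"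
    using RF_le_J FR_le_J tens_in_tspan[OF sub_frag_of_eps(1)[OF assms] assms]
      tens_in_tspan[of ?a F "x - ?a" "rels A"] sub_frag_of_eps(1)[OF assms] assms by auto
  then have "tens (x - ?a) x + tens ?a (x - ?a) \<in> L"
    by (intro L_add J_le_L)
  moreover have "frag_of (eps A x, eps A x) \<in> L"
    unfolding L_def using assms by (intro frag.span_base) auto
  ultimately have "tens (x - ?a) x + tens ?a (x - ?a) + frag_of (eps A x, eps A x) \<in> L"
    by (rule L_add)
  then show ?thesis
    by (simp add: tens_diff_left tens_diff_right)
qed

lemma symmetric_in_L:
  assumes "x \<in> F" "y \<in> F"
  shows "tens x y + tens y x \<in> L"
proof -
  have "tens (x + y) (x + y) - tens x x - tens y y \<in> L"
    using assms by (intro L_diff square_in_L) auto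
  then show ?thesis
    by (simp add: tens_add add.commute)
qed

text \<open>
  In coordinates \<open>f(a, b) = (\<Sum>i<j. a\<^sub>i b\<^sub>j (y\<^sub>i \<otimes> y\<^sub>j))\<close> is, modulo \<open>L\<close>, a bilinear cocycle with
  \<open>f(a, b) - f(b, a) = a \<otimes> b\<close>.
\<close>

lemma wedge_boundary_in_L:
  assumes z: "z \<in> frags (carrier A \<times> carrier A)" and B: "wedge z \<in> B2"
  shows "z \<in> L"
proof -
  obtain v where v: "v \<in> frags (bas 3)" "wedge z = d2 v"
    using B by (auto simp: B2_def)
  \<comment> \<open>The products are included so that all entries of the generators in
    \<open>d2 v\<close> stay in \<open>T\<close>.\<close>
  define T where "T = fst ` Poly_Mapping.keys z \<union> snd ` Poly_Mapping.keys z \<union>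
    (\<Union>l\<in>Poly_Mapping.keys v. {l ! 0, l ! 1, l ! 2, l ! 0 \<otimes> l ! 1, l ! 1 \<otimes> l ! 2})"
  have fT: "finite T"
    by (simp add: T_def)
  have kv: "\<exists>a b c. l = [a, b, c] \<and> {a, b, c} \<subseteq> carrier A" if "l \<in> Poly_Mapping.keys v" for l
    using that v(1) by (auto simp: frags_def elim!: bas_3E[OF subsetD])
  have TS: "T \<subseteq> carrier A"
  proof
    fix t assume "t \<in> T"
    then consider "t \<in> fst ` Poly_Mapping.keys z" | "t \<in> snd ` Poly_Mapping.keys z" |
      l where "l \<in> Poly_Mapping.keys v" "t \<in> {l ! 0, l ! 1, l ! 2, l ! 0 \<otimes> l ! 1, l ! 1 \<otimes> l ! 2}"
      by (auto simp: T_def)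
    then show "t \<in> carrier A"
    proof cases
      case 3
      then obtain a b c where "l = [a, b, c]" "{a, b, c} \<subseteq> carrier A"
        using kv by blast
      then show ?thesis
        using 3(2) by auto
    qed (use z in \<open>auto simp: frags_def\<close>)
  qed
  have zT: "z \<in> frags (T \<times> T)"
  proof -
    have "a \<in> T \<and> b \<in> T" if "(a, b) \<in> Poly_Mapping.keys z" for a b
      using imageI[OF that, of fst] imageI[OF that, of snd] by (simp add: T_def)
    then show ?thesis
      by (auto simp: frags_def)
  qed
  obtain y p e where y: "\<And>t. t \<in> T \<Longrightarrow> y t \<in> F" and ye: "\<And>t. t \<in> T \<Longrightarrow> frag_cmul (e t :: int) (y t) \<in> rels A"
    and p: "\<And>x. x \<in> frags T \<Longrightarrow> frag_extend p x \<in> frags T"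
    and "\<And>x. x \<in> frags T \<Longrightarrow> frag_extend y (frag_extend p x) = x"
    and e: "\<And>r t. \<lbrakk>r \<in> rels A \<inter> frags T; t \<in> T\<rbrakk> \<Longrightarrow> e t dvd Poly_Mapping.lookup (frag_extend p r) t"
    and pz: "\<And>z. z \<in> frags (T \<times> T) \<Longrightarrow> tmap p p z \<in> frags (T \<times> T)"
    and yp: "\<And>z. z \<in> frags (T \<times> T) \<Longrightarrow> tmap y y (tmap p p z) = z"
    by (rule local_coordinates[OF fT TS]) (rule that)
  define U where "U = frag_extend (\<lambda>(i, j). if i \<noteq> j \<and> precedes i j then tens (y i) (y j) else 0)"
  have U_diff: "U (s - t) = U s - U t" for s t
    by (simp add: U_def frag_extend_diff)
  have U_add: "U (s + t) = U s + U t" for s t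
    by (simp add: U_def frag_extend_add)
  \<comment> \<open>\<open>U\<close> keeps one of each two mirrored terms. What is missing is a
    square on the diagonal or a symmetric sum off it, and both lie in \<open>L\<close>.\<close>
  have U_alt: "U s - U (flip s) - tmap y y s \<in> L" if "s \<in> frags (T \<times> T)" for s
    using that
  proof (induction rule: frags_induct)
    case (of ij)
    obtain i j where ij: "ij = (i, j)" "i \<in> T" "j \<in> T"
      using of by auto
    show ?case
    proof (cases i j rule: precedes_cases)
      case eq
      then show ?thesis
        using L_neg[OF square_in_L[OF y[OF ij(2)]]] ij by (simp add: U_def)
    next
      case less
      then show ?thesis
        using ij by (simp add: U_def frag.subspace_0)
    next
      case greater
      then show ?thesis
        using L_neg[OF symmetric_in_L[OF y[OF ij(3)] y[OF ij(2)]]] ij by (simp add: U_def)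
    qed
  next
    case (diff s t)
    have "U (s - t) - U (flip (s - t)) - tmap y y (s - t) =
        (U s - U (flip s) - tmap y y s) - (U t - U (flip t) - tmap y y t)"
      by (simp add: U_diff flip_diff tmap_diff)
    then show ?case
      using L_diff[OF diff(3,4)] by simp
  qed (simp add: U_def frag.subspace_0)
  define f where "f a b = U (tens (p a) (p b))" for a b
  define \<phi> where "\<phi> = frag_extend (\<lambda>l. f (l ! 0) (l ! 1))"
  have \<phi>_diff: "\<phi> (s - t) = \<phi> s - \<phi> t" and \<phi>_add: "\<phi> (s + t) = \<phi> s + \<phi> t" for s t
    by (simp_all add: \<phi>_def frag_extend_diff frag_extend_add)
  have \<phi>_wedge: "\<phi> (wedge s) - s \<in> L" if "s \<in> frags (T \<times> T)" for s
    using that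
  proof (induction rule: frags_induct)
    case (of ab)
    obtain a b where ab: "ab = (a, b)" "a \<in> T" "b \<in> T"
      using of by auto
    then have ab': "frag_of (a, b) \<in> frags (T \<times> T)"
      by simp
    have "\<phi> (wedge (frag_of (a, b))) - frag_of (a, b) =
        U (tmap p p (frag_of (a, b))) - U (flip (tmap p p (frag_of (a, b)))) - tmap y y (tmap p p (frag_of (a, b)))"
      unfolding yp[OF ab'] by (simp add: \<phi>_diff \<phi>_def f_def frag_extend_diff)
    then show ?case
      using U_alt[OF pz[OF ab']] ab by simp
  next
    case (diff s t)
    have eq: "\<phi> (wedge (s - t)) - (s - t) = (\<phi> (wedge s) - s) - (\<phi> (wedge t) - t)"
      by (simp add: wedge_diff \<phi>_diff)
    show ?case
      unfolding eq by (rule L_diff[OF diff(3,4)])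
  qed (simp add: \<phi>_def frag.subspace_0)
  \<comment> \<open>Divisibility of the coordinates of a relation puts each term into
    \<open>J\<close>. Thus modulo \<open>L\<close> the values of \<open>f\<close> respect relations
    of \<open>A\<close> supported on \<open>T\<close>.\<close>
  have U_rel: "U (tens (frag_extend p r) x) \<in> L" "U (tens x (frag_extend p r)) \<in> L"
    if r: "r \<in> rels A" "r \<in> frags T" and x: "x \<in> frags T" for r x
  proof -
    have *: "frag_cmul (n * m) (tens (y i) (y j)) \<in> L"
      if "i \<in> T" "j \<in> T" "e i dvd n \<or> e j dvd m" for i j n m
    proof -
      have "e i dvd n * m \<or> e j dvd n * m"
        using that(3) by auto
      then have "frag_cmul (n * m) (tens (y i) (y j)) \<in> J"
        using cmul_tens_in(1,2)[OF y y ye ye, OF that(1,2) that(1,2)] RF_le_J FR_le_J by blast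
      then show ?thesis
        by (rule J_le_L)
    qed
    have er: "e t dvd Poly_Mapping.lookup (frag_extend p r) t" if "t \<in> T" for t
      using e[of r t] r that by simp
    have pr: "frag_extend p r \<in> frags T"
      using p r by simp
    show "U (tens (frag_extend p r) x) \<in> L"
      unfolding U_def
      by (rule frag_extend_Times_in[OF tens_in_frags[OF pr x] subspace_L])
        (use * er in \<open>auto simp: lookup_tens frag.subspace_0\<close>)
    show "U (tens x (frag_extend p r)) \<in> L"
      unfolding U_def
      by (rule frag_extend_Times_in[OF tens_in_frags[OF x pr] subspace_L])
        (use * er in \<open>auto simp: lookup_tens frag.subspace_0\<close>)
  qed
  have pT: "p t \<in> frags T" if "t \<in> T" for t
    using p[of "frag_of t"] that by simp
  have "\<phi> (d2 v) \<in> L"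
    unfolding d2_def \<phi>_def
  proof -
    have "frag_extend (\<lambda>l. f (l ! 0) (l ! 1)) (frag_of [l ! 1, l ! 2] - frag_of [l ! 0 \<otimes> l ! 1, l ! 2]
        + frag_of [l ! 0, l ! 1 \<otimes> l ! 2] - frag_of [l ! 0, l ! 1]) \<in> L" if l: "l \<in> Poly_Mapping.keys v" for l
    proof -
      obtain a b c where abc: "l = [a, b, c]"
        using kv[OF l] by blast
      have T: "a \<in> T" "b \<in> T" "c \<in> T" "a \<otimes> b \<in> T" "b \<otimes> c \<in> T"
        using l abc by (force simp: T_def)+
      define r where "r = frag_of (a \<otimes> b) - frag_of a - frag_of b"
      define r' where "r' = frag_of (b \<otimes> c) - frag_of b - frag_of c"
      have r: "r \<in> rels A" "r \<in> frags T" "r' \<in> rels A" "r' \<in> frags T"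
        unfolding r_def r'_def using T TS by (auto intro!: mult_rel)
      have "frag_extend (\<lambda>l. f (l ! 0) (l ! 1)) (frag_of [l ! 1, l ! 2] - frag_of [l ! 0 \<otimes> l ! 1, l ! 2]
          + frag_of [l ! 0, l ! 1 \<otimes> l ! 2] - frag_of [l ! 0, l ! 1]) =
          f b c - f (a \<otimes> b) c + f a (b \<otimes> c) - f a b"
        by (simp add: abc frag_extend_diff frag_extend_add)
      \<comment> \<open>The four terms are the defect of additivity of \<open>f\<close> in its
        second argument minus the one in its first.\<close>
      also have "\<dots> = U (tens (p a) (frag_extend p r')) - U (tens (frag_extend p r) (p c))"
        by (simp add: f_def r_def r'_def frag_extend_diff tens_diff_left tens_diff_right U_diff)
      also have "\<dots> \<in> L"
        using r T pT by (intro L_diff U_rel) auto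
      finally show ?thesis .
    qed
    then show "frag_extend (\<lambda>l. f (l ! 0) (l ! 1)) (frag_extend (\<lambda>l. frag_of [l ! 1, l ! 2] - frag_of [l ! 0 \<otimes> l ! 1, l ! 2]
        + frag_of [l ! 0, l ! 1 \<otimes> l ! 2] - frag_of [l ! 0, l ! 1]) v) \<in> L"
      unfolding frag_extend_def[of _ v] frag_extend_sum[OF finite_keys] o_def frag_extend_cmul
      by (intro frag.subspace_sum[OF subspace_L] frag.subspace_scale[OF subspace_L])
  qed
  \<comment> \<open>\<open>\<phi>\<close> kills the boundary modulo \<open>L\<close> but returns
    \<open>z\<close> from \<open>wedge z\<close>, and these two chains are equal.\<close>
  then have "\<phi> (d2 v) - (\<phi> (wedge z) - z) \<in> L"
    by (rule L_diff[OF _ \<phi>_wedge[OF zT]])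
  moreover have "\<phi> (d2 v) - (\<phi> (wedge z) - z) = z"
    unfolding v(2) by simp
  ultimately show ?thesis
    by (simp only:)
qed

end

lemma subspace_subgroup:
  assumes "frag.subspace V" "V \<subseteq> frags S"
  shows "subgroup V (free_Abelian_group S)"
proof (rule group.subgroupI[OF group_free_Abelian_group])
  show "V \<noteq> {}"
    using frag.subspace_0[OF assms(1)] by auto
  fix a assume "a \<in> V"
  moreover then have "Poly_Mapping.keys a \<subseteq> S"
    using assms(2) by (auto simp: frags_def)
  ultimately show "inv\<^bsub>free_Abelian_group S\<^esub> a \<in> V"
    using frag.subspace_neg[OF assms(1)] by simp
qed (use assms frag.subspace_add in auto)

lemma finprod_integer_group: "finite I \<Longrightarrow> finprod integer_group f I = sum f I"
proof -
  interpret comm_group integer_group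
    by (rule abelian_integer_group)
  show "finite I \<Longrightarrow> ?thesis"
    by (induction I rule: finite_induct) simp_all
qed

section \<open>The integral bar complex of \<open>A\<close> in terms of formal sums\<close>

context abelian_presentation
begin

abbreviation "triv \<equiv> (\<lambda>_ :: 'a. \<lambda>m :: int. m)"

sublocale bar: bar_complex A integer_group triv
  by (intro bar_complex.intro bar_complex_axioms.intro abelian_integer_group is_group) simp

text \<open>On \<open>frags (bas n)\<close> this is the isomorphism from formal sums to the
  extensional, finitely supported functions of \<open>bar_chain\<close>.\<close>

definition ch :: "nat \<Rightarrow> ('a list \<Rightarrow>\<^sub>0 int) \<Rightarrow> ('a list \<Rightarrow> int)"
  where "ch n z = (\<lambda>gs\<in>bas n. Poly_Mapping.lookup z gs)"

lemma ch_closed: "ch n z \<in> carrier (bar.C n)"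
proof -
  have "finite {gs \<in> bas n. ch n z gs \<noteq> 0}"
    by (rule finite_subset[of _ "Poly_Mapping.keys z"]) (auto simp: ch_def in_keys_iff)
  then show ?thesis
    by (auto simp: bar.carrier_C ch_def)
qed

lemma ch_hom: "group_hom (free_Abelian_group (bas n)) (bar.C n) (ch n)"
proof (intro group_hom.intro group_hom_axioms.intro homI)
  show "group (bar.C n)"
    using bar.C_comm_group by (simp add: comm_group_def)
  fix z w
  show "ch n (z \<otimes>\<^bsub>free_Abelian_group (bas n)\<^esub> w) = ch n z \<otimes>\<^bsub>bar.C n\<^esub> ch n w"
    by (auto simp: ch_def lookup_add intro!: restrict_ext)
qed (auto simp: ch_closed)

lemma ch_inj: "\<lbrakk>z \<in> frags (bas n); w \<in> frags (bas n); ch n z = ch n w\<rbrakk> \<Longrightarrow> z = w"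
proof (rule poly_mapping_eqI)
  fix k assume *: "z \<in> frags (bas n)" "w \<in> frags (bas n)" "ch n z = ch n w"
  show "Poly_Mapping.lookup z k = Poly_Mapping.lookup w k"
  proof (cases "k \<in> bas n")
    case True
    then show ?thesis
      using fun_cong[OF *(3), of k] by (simp add: ch_def)
  next
    case False
    then show ?thesis
      using frags_lookup * by metis
  qed
qed

lemma ch_surj: "carrier (bar.C n) = ch n ` frags (bas n)"
proof
  show "carrier (bar.C n) \<subseteq> ch n ` frags (bas n)"
  proof
    fix x assume x: "x \<in> carrier (bar.C n)"
    let ?K = "{gs \<in> bas n. x gs \<noteq> 0}"
    have K: "finite ?K"
      using x by (simp add: bar.carrier_C)
    define z where "z = (\<Sum>gs\<in>?K. frag_cmul (x gs) (frag_of gs))"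
    have look: "Poly_Mapping.lookup z gs = x gs" if "gs \<in> bas n" for gs
      using that K by (simp add: z_def lookup_sum if_distrib[of "(*) _"] sum.delta' cong: if_cong)
    have "z \<in> frags (bas n)"
      unfolding z_def by (rule frag.subspace_sum[OF subspace_frags]) simp
    moreover have "x = ch n z"
      using bar.C_extensional[OF x] look by (intro extensionalityI[of _ "bas n"]) (auto simp: ch_def)
    ultimately show "x \<in> ch n ` frags (bas n)"
      by blast
  qed
qed (use ch_closed in blast)

definition fc :: "nat \<Rightarrow> 'a list \<Rightarrow> ('a list \<Rightarrow>\<^sub>0 int)"
  where "fc i gs = frag_of (if i = 0 then tl gs
    else if i < length gs then take (i - 1) gs @ [gs ! (i - 1) \<otimes> gs ! i] @ drop (i + 1) gs
    else butlast gs)"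

lemma boundary_ch:
  assumes z: "z \<in> frags (bas (n + 1))"
  shows "bar_boundary A integer_group triv n (ch (n + 1) z) =
    ch n (frag_extend (\<lambda>gs. \<Sum>i\<in>{0..n + 1}. frag_cmul ((- 1) ^ i) (fc i gs)) z)" (is "?l = ch n ?r")
proof (rule extensionalityI[of _ "bas n"])
  show "ch n ?r \<in> extensional (bas n)"
    by (rule bar.C_extensional[OF ch_closed])
  show "?l \<in> extensional (bas n)"
    using bar.C_extensional[OF bar.boundary_closed[OF ch_closed]] .
  fix hs assume hs: "hs \<in> bas n"
  have face: "bar_face A integer_group triv i gs m hs = m * Poly_Mapping.lookup (fc i gs) hs"
    if "gs \<in> bas (n + 1)" for i gs m
  proof -
    have "length gs = n + 1"
      using that by (simp add: bar_basis_def)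
    then show ?thesis
      using hs by (auto simp: bar_face_def fc_def bar.single_eval[of hs n])
  qed
  have supp: "{gs \<in> bas (n + 1). ch (n + 1) z gs \<noteq> \<one>\<^bsub>integer_group\<^esub>} = Poly_Mapping.keys z"
    using z unfolding ch_def frags_def one_integer_group by (auto simp: lookup_not_eq_zero_eq_in_keys)
  have "?l hs = (\<Sum>gs\<in>Poly_Mapping.keys z. \<Sum>i\<in>{0..n + 1}.
      (- 1) ^ i * bar_face A integer_group triv i gs (ch (n + 1) z gs) hs)"
    unfolding bar.boundary_eval[OF ch_closed hs] supp by (simp add: finprod_integer_group)
  also have "\<dots> = (\<Sum>gs\<in>Poly_Mapping.keys z. \<Sum>i\<in>{0..n + 1}.
      (- 1) ^ i * (Poly_Mapping.lookup z gs * Poly_Mapping.lookup (fc i gs) hs))"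
    using z by (intro sum.cong refl) (auto simp: face ch_def frags_def)
  also have "\<dots> = ch n ?r hs"
    unfolding ch_def restrict_apply if_P[OF hs] frag_extend_def lookup_sum lookup_frag_cmul sum_distrib_left
    by (intro sum.cong refl mult.left_commute)
  finally show "?l hs = ch n ?r hs" .
qed

lemma boundary_1_ch:
  assumes z: "z \<in> frags (bas 2)"
  shows "bar_boundary A integer_group triv 1 (ch 2 z) = ch 1 (d1 z)"
proof -
  have "frag_extend (\<lambda>gs. \<Sum>i\<in>{0..1 + 1}. frag_cmul ((- 1) ^ i) (fc i gs)) z = d1 z"
    unfolding d1_def using z
  proof (rule frag_extend_cong)
    fix l assume "l \<in> bas 2"
    then obtain a b where "l = [a, b]"
      by (rule bas_2E)
    moreover have "{0..1 + 1::nat} = {0, Suc 0, Suc (Suc 0)}"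
      by auto
    ultimately show "(\<Sum>i\<in>{0..1 + 1}. frag_cmul ((- 1) ^ i) (fc i l)) =
        frag_of [l ! 1] - frag_of [l ! 0 \<otimes> l ! 1] + frag_of [l ! 0]"
      by (simp add: fc_def)
  qed
  moreover have "1 + 1 = (2 :: nat)"
    by simp
  ultimately show ?thesis
    using boundary_ch[of z 1] z by (simp only:)
qed

lemma boundary_2_ch:
  assumes z: "z \<in> frags (bas 3)"
  shows "bar_boundary A integer_group triv 2 (ch 3 z) = ch 2 (d2 z)"
proof -
  have "frag_extend (\<lambda>gs. \<Sum>i\<in>{0..2 + 1}. frag_cmul ((- 1) ^ i) (fc i gs)) z = d2 z"
    unfolding d2_def using z
  proof (rule frag_extend_cong)
    fix l assume "l \<in> bas 3"
    then obtain a b c where "l = [a, b, c]"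
      by (rule bas_3E)
    moreover have "{0..2 + 1::nat} = {0, Suc 0, Suc (Suc 0), Suc (Suc (Suc 0))}"
      by auto
    ultimately show "(\<Sum>i\<in>{0..2 + 1}. frag_cmul ((- 1) ^ i) (fc i l)) =
        frag_of [l ! 1, l ! 2] - frag_of [l ! 0 \<otimes> l ! 1, l ! 2] + frag_of [l ! 0, l ! 1 \<otimes> l ! 2] - frag_of [l ! 0, l ! 1]"
      by (simp add: fc_def)
  qed
  moreover have "2 + 1 = (3 :: nat)"
    by simp
  ultimately show ?thesis
    using boundary_ch[of z 2] z by (simp only:)
qed

definition Z2 :: "('a list \<Rightarrow>\<^sub>0 int) set"
  where "Z2 = {z \<in> frags (bas 2). d1 z = 0}"

abbreviation "ZG \<equiv> bar_cycles A integer_group triv 2"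
abbreviation "BG \<equiv> bar_boundaries A integer_group triv 2"
abbreviation "H2 \<equiv> integral_homology 2 A"

lemma subspace_Z2: "frag.subspace Z2"
  unfolding Z2_def by (rule frag_subspaceI) (auto simp: d1_diff)

lemma B2_le_Z2: "B2 \<subseteq> Z2"
  unfolding B2_def Z2_def using d2_in d1_d2 by auto

lemma ZG_eq: "ZG = (bar.C 2)\<lparr>carrier := ch 2 ` Z2\<rparr>"
proof -
  have zero: "\<one>\<^bsub>bar.C 1\<^esub> = ch 1 0"
    by (auto simp: ch_def bar.C_simps)
  have "bar_boundary A integer_group triv 1 (ch 2 z) = \<one>\<^bsub>bar.C 1\<^esub> \<longleftrightarrow> d1 z = 0" if "z \<in> frags (bas 2)" for z
    unfolding boundary_1_ch[OF that] zero using ch_inj[of "d1 z" 1 0] d1_in[OF that] by auto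
  then have "kernel (bar.C 2) (bar.C 1) (bar_boundary A integer_group triv 1) = ch 2 ` Z2"
    unfolding kernel_def ch_surj[of 2] Z2_def by auto
  then show ?thesis
    by (simp add: bar_cycles_def numeral_2_eq_2)
qed

lemma BG_eq: "BG = ch 2 ` B2"
proof -
  have "BG = bar_boundary A integer_group triv 2 ` ch 3 ` frags (bas 3)"
    by (simp add: bar_boundaries_def ch_surj)
  also have "\<dots> = ch 2 ` B2"
    unfolding B2_def image_image by (intro image_cong refl boundary_2_ch)
  finally show ?thesis .
qed

lemma ZG_comm_group: "comm_group ZG" and BG_subgroup: "subgroup BG ZG"
proof -
  interpret C2: comm_group "bar.C 2"
    by (rule bar.C_comm_group)
  have img: "subgroup (ch 2 ` V) (bar.C 2)" if "frag.subspace V" "V \<subseteq> frags (bas 2)" for V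
    by (rule group_hom.subgroup_img_is_subgroup[OF ch_hom subspace_subgroup[OF that]])
  have Z: "subgroup (ch 2 ` Z2) (bar.C 2)" and B: "subgroup (ch 2 ` B2) (bar.C 2)"
    using B2_le_Z2 by (auto intro!: img subspace_Z2 subspace_B2) (auto simp: Z2_def)
  have "group ZG"
    unfolding ZG_eq by (rule C2.subgroup_imp_group[OF Z])
  then show "comm_group ZG"
    by (rule group.group_comm_groupI) (auto simp: ZG_eq simp del: bar.C_simps intro!: C2.m_comm ch_closed)
  show "subgroup BG ZG"
    unfolding ZG_eq BG_eq using B2_le_Z2 by (intro C2.subgroup_incl[OF B Z]) auto
qed

lemma H2_comm_group: "comm_group H2"
  unfolding integral_homology_def group_homology_def
  by (rule comm_group.abelian_FactGroup[OF ZG_comm_group BG_subgroup])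

definition hc :: "('a list \<Rightarrow>\<^sub>0 int) \<Rightarrow> ('a list \<Rightarrow> int) set"
  where "hc z = BG #>\<^bsub>ZG\<^esub> ch 2 z"

lemma carrier_H2: "carrier H2 = hc ` Z2"
  unfolding integral_homology_def group_homology_def carrier_FactGroup hc_def by (auto simp: ZG_eq)

lemma hc_add: "\<lbrakk>z \<in> Z2; w \<in> Z2\<rbrakk> \<Longrightarrow> hc (z + w) = hc z \<otimes>\<^bsub>H2\<^esub> hc w"
proof -
  assume zw: "z \<in> Z2" "w \<in> Z2"
  have "normal BG ZG"
    by (rule comm_group.subgroup_imp_normal[OF ZG_comm_group BG_subgroup])
  then have "(\<lambda>x. BG #>\<^bsub>ZG\<^esub> x) \<in> hom ZG H2"
    unfolding integral_homology_def group_homology_def by (rule normal.r_coset_hom_Mod)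
  then have "BG #>\<^bsub>ZG\<^esub> (ch 2 z \<otimes>\<^bsub>ZG\<^esub> ch 2 w) = hc z \<otimes>\<^bsub>H2\<^esub> hc w"
    unfolding hc_def by (rule hom_mult) (use zw in \<open>simp_all add: ZG_eq\<close>)
  moreover have "ch 2 z \<otimes>\<^bsub>ZG\<^esub> ch 2 w = ch 2 (z + w)"
    using group_hom.hom_mult[OF ch_hom, of z 2 w] zw by (simp add: ZG_eq Z2_def)
  ultimately show ?thesis
    by (simp add: hc_def)
qed

lemma hc_eq_one_iff: "z \<in> Z2 \<Longrightarrow> hc z = \<one>\<^bsub>H2\<^esub> \<longleftrightarrow> z \<in> B2"
proof -
  assume z: "z \<in> Z2"
  interpret ZG: comm_group ZG
    by (rule ZG_comm_group)
  have c: "ch 2 z \<in> carrier ZG"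
    using z by (simp add: ZG_eq)
  have "hc z = \<one>\<^bsub>H2\<^esub> \<longleftrightarrow> BG #>\<^bsub>ZG\<^esub> ch 2 z = BG"
    by (simp add: hc_def integral_homology_def group_homology_def)
  also have "\<dots> \<longleftrightarrow> ch 2 z \<in> BG"
    using ZG.coset_join1[OF _ c BG_subgroup] ZG.coset_join2[OF c BG_subgroup] by blast
  also have "\<dots> \<longleftrightarrow> z \<in> B2"
    unfolding BG_eq using ch_inj[of z 2] z B2_le_Z2 by (auto simp: Z2_def)
  finally show ?thesis .
qed

lemma Z2_add: "\<lbrakk>z \<in> Z2; w \<in> Z2\<rbrakk> \<Longrightarrow> z + w \<in> Z2"
  and Z2_diff: "\<lbrakk>z \<in> Z2; w \<in> Z2\<rbrakk> \<Longrightarrow> z - w \<in> Z2"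
  by (rule frag.subspace_add[OF subspace_Z2] frag.subspace_diff[OF subspace_Z2]; assumption)+

lemma hc_closed: "z \<in> Z2 \<Longrightarrow> hc z \<in> carrier H2"
  by (simp add: carrier_H2)

lemma hc_eqI: "\<lbrakk>z \<in> Z2; w \<in> Z2; z - w \<in> B2\<rbrakk> \<Longrightarrow> hc z = hc w"
proof -
  interpret H2: comm_group H2
    by (rule H2_comm_group)
  assume *: "z \<in> Z2" "w \<in> Z2" "z - w \<in> B2"
  then have "hc (z - w) = \<one>\<^bsub>H2\<^esub>"
    using hc_eq_one_iff Z2_diff by blast
  then show ?thesis
    using hc_add[OF Z2_diff[OF *(1,2)] *(2)] hc_closed[OF *(2)] by simp
qed

lemma hc_diff: "\<lbrakk>z \<in> Z2; w \<in> Z2\<rbrakk> \<Longrightarrow> hc (z - w) = hc z \<otimes>\<^bsub>H2\<^esub> inv\<^bsub>H2\<^esub> hc w"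
proof -
  interpret H2: comm_group H2
    by (rule H2_comm_group)
  assume *: "z \<in> Z2" "w \<in> Z2"
  have "hc z = hc (z - w) \<otimes>\<^bsub>H2\<^esub> hc w"
    using hc_add[OF Z2_diff[OF *] *(2)] by simp
  then show ?thesis
    using hc_closed[OF Z2_diff[OF *]] hc_closed[OF *(2)] by (simp add: H2.m_assoc)
qed

lemma wedge_Z2: "z \<in> frags (carrier A \<times> carrier A) \<Longrightarrow> wedge z \<in> Z2"
  unfolding Z2_def using wedge_in d1_wedge by blast

lemma wedge_class_eq:
  assumes "a \<in> carrier A" "b \<in> carrier A"
  shows "wedge_class A a b = hc (wedge (frag_of (a, b)))"
proof -
  have single: "bar_single A integer_group [x, y] 1 = ch 2 (frag_of [x, y])" for x y
    by (auto simp: bar_single_def ch_def numeral_2_eq_2 intro!: restrict_ext)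
  have "ch 2 (frag_of [a, b]) \<otimes>\<^bsub>bar.C 2\<^esub> inv\<^bsub>bar.C 2\<^esub> ch 2 (frag_of [b, a]) = ch 2 (frag_of [a, b] - frag_of [b, a])"
    using free_hom_diff[OF ch_hom, of "frag_of [a, b]" 2 "frag_of [b, a]"] assms by simp
  then show ?thesis
    by (simp add: wedge_class_def single hc_def del: bar.C_simps)
qed

lemma bilinear_wedge_class: "bilinear_map A A H2 (wedge_class A)"
proof -
  have mult: "hc (wedge x) = hc (wedge y) \<otimes>\<^bsub>H2\<^esub> hc (wedge y')"
    if "wedge (x - y - y') \<in> B2" "x \<in> frags (carrier A \<times> carrier A)"
      "y \<in> frags (carrier A \<times> carrier A)" "y' \<in> frags (carrier A \<times> carrier A)" for x y y'
  proof -
    have "hc (wedge x) = hc (wedge y + wedge y')"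
      using that by (intro hc_eqI wedge_Z2 Z2_add) (simp_all add: wedge_diff flip: diff_diff_eq)
    then show ?thesis
      using that by (simp add: hc_add wedge_Z2)
  qed
  show ?thesis
    unfolding bilinear_map_def
    by (intro conjI ballI homI)
      (simp_all add: wedge_class_eq hc_closed wedge_Z2 mult wedge_bilinear del: wedge_of)
qed

lemma tensor_to_H2_hom: "group_hom (tensor A A) H2 (tensor_to_H2 A)"
  using tensor_lift_hom[OF comm_group_A comm_group_A H2_comm_group bilinear_wedge_class]
    tensor_comm_group[OF comm_group_A comm_group_A] H2_comm_group
  by (simp add: group_hom_def group_hom_axioms_def comm_group_def tensor_to_H2_def)

lemma carrier_tensor: "carrier (tensor A A) = tcl ` frags (carrier A \<times> carrier A)"
  unfolding tensor_def carrier_presented_pcl ..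

lemma tcl_closed: "z \<in> frags (carrier A \<times> carrier A) \<Longrightarrow> tcl z \<in> carrier (tensor A A)"
  by (simp add: carrier_tensor)

lemma tensor_to_H2_tcl:
  assumes "z \<in> frags (carrier A \<times> carrier A)"
  shows "tensor_to_H2 A (tcl z) = hc (wedge z)"
  using assms
proof (induction rule: frags_induct)
  case zero
  have "hc 0 = \<one>\<^bsub>H2\<^esub>"
    using hc_eq_one_iff[of 0] frag.subspace_0[OF subspace_Z2] frag.subspace_0[OF subspace_B2] by simp
  then show ?case
    using free_hom_zero[OF tcl_hom] group_hom.hom_one[OF tensor_to_H2_hom] by simp
next
  case (of p)
  then show ?case
    using tensor_lift_elem[OF comm_group_A comm_group_A H2_comm_group bilinear_wedge_class, of "fst p" "snd p"]
      tcl_of[of "fst p" "snd p"] wedge_class_eq[of "fst p" "snd p"] unfolding tensor_to_H2_def by auto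
next
  case (diff x y)
  interpret t: group_hom "tensor A A" H2 "tensor_to_H2 A"
    by (rule tensor_to_H2_hom)
  show ?case
    using diff by (simp add: free_hom_diff[OF tcl_hom] tcl_closed wedge_diff hc_diff wedge_Z2)
qed

lemma tensor_to_H2_surj: "tensor_to_H2 A ` carrier (tensor A A) = carrier H2"
proof
  show "tensor_to_H2 A ` carrier (tensor A A) \<subseteq> carrier H2"
    using group_hom.hom_closed[OF tensor_to_H2_hom] by auto
  show "carrier H2 \<subseteq> tensor_to_H2 A ` carrier (tensor A A)"
  proof
    fix t assume "t \<in> carrier H2"
    then obtain c where c: "c \<in> Z2" "t = hc c"
      by (auto simp: carrier_H2)
    then obtain z where z: "z \<in> frags (carrier A \<times> carrier A)" "c - wedge z \<in> B2"
      using cycle_homologous_wedge[of c] by (auto simp: Z2_def)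
    then have "t = tensor_to_H2 A (tcl z)"
      using c by (simp add: tensor_to_H2_tcl hc_eqI wedge_Z2)
    then show "t \<in> tensor_to_H2 A ` carrier (tensor A A)"
      using tcl_closed[OF z(1)] by blast
  qed
qed

section \<open>Exactness at the tensor square\<close>

abbreviation "gcl \<equiv> pcl (carrier A) (Gamma_rels A)"

lemma Gamma_rels_le: "Gamma_rels A \<subseteq> F"
  using Gamma_rels_subset[OF comm_group_A] by simp

lemma gcl_hom: "group_hom (free_Abelian_group (carrier A)) (Gamma A) gcl"
  unfolding Gamma_def by (rule pcl_hom[OF Gamma_rels_le])

lemma carrier_Gamma: "carrier (Gamma A) = gcl ` F"
  unfolding Gamma_def carrier_presented_pcl ..

lemma gcl_closed: "x \<in> F \<Longrightarrow> gcl x \<in> carrier (Gamma A)"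
  by (simp add: carrier_Gamma)

lemma gcl_eq_one_iff: "x \<in> F \<Longrightarrow> gcl x = \<one>\<^bsub>Gamma A\<^esub> \<longleftrightarrow> x \<in> Grel"
  unfolding Gamma_def Grel_def by (rule pcl_eq_one_iff[OF Gamma_rels_le])

lemma gcl_eq_iff: "\<lbrakk>x \<in> F; y \<in> F\<rbrakk> \<Longrightarrow> gcl x = gcl y \<longleftrightarrow> x - y \<in> Grel"
  unfolding Grel_def by (rule pcl_eq_iff[OF Gamma_rels_le])

lemma Psi_group_hom: "group_hom (Gamma A) (tensor A A) (Psi A)"
  using Psi_hom[OF comm_group_A] Gamma_comm_group[OF comm_group_A] tensor_comm_group[OF comm_group_A comm_group_A]
  by (simp add: group_hom_def group_hom_axioms_def comm_group_def)

lemma diag_in: "x \<in> F \<Longrightarrow> diag x \<in> frags (carrier A \<times> carrier A)"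
  by (induction rule: frags_induct) (auto simp: diag_diff)

lemma Psi_gcl:
  assumes "x \<in> F"
  shows "Psi A (gcl x) = tcl (diag x)"
  using assms
proof (induction rule: frags_induct)
  case zero
  then show ?case
    using free_hom_zero[OF tcl_hom] free_hom_zero[OF gcl_hom] group_hom.hom_one[OF Psi_group_hom] by simp
next
  case (of a)
  have "gcl (frag_of a) = gamma A a"
    by (simp add: gamma_def presented_gen_eq_pcl)
  then show ?case
    using Psi_gamma[OF comm_group_A of] by (simp add: tcl_of)
next
  case (diff x y)
  interpret p: group_hom "Gamma A" "tensor A A" "Psi A"
    by (rule Psi_group_hom)
  show ?case
    using diff by (simp add: free_hom_diff[OF gcl_hom] gcl_closed diag_diff free_hom_diff[OF tcl_hom] diag_in)
qed

lemma wedge_diag: "wedge (diag x) = 0"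
  by (induction x rule: frag_ext_induct) (auto simp: diag_diff wedge_diff)

lemma L_cases:
  assumes "z \<in> L"
  obtains u x where "u \<in> J" "x \<in> F" "z = u + diag x"
proof -
  have "frag.subspace {z. \<exists>u\<in>J. \<exists>x\<in>F. z = u + diag x}"
  proof (rule frag_subspaceI; clarify)
    show "\<exists>u\<in>J. \<exists>x\<in>F. 0 = u + diag x"
      by (intro bexI[of _ 0]) (auto simp: frag.subspace_0)
    fix u x u' x' assume "u \<in> J" "x \<in> F" "u' \<in> J" "x' \<in> F"
    then show "\<exists>u''\<in>J. \<exists>x''\<in>F. u + diag x - (u' + diag x') = u'' + diag x''"
      by (intro bexI[of _ "u - u'"] bexI[of _ "x - x'"]) (auto simp: diag_diff frag.subspace_diff)
  qed
  then have "z \<in> {z. \<exists>u\<in>J. \<exists>x\<in>F. z = u + diag x}"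
  proof (rule frag_span_minimal[OF assms[unfolded L_def]])
    fix w assume "w \<in> J \<union> {frag_of (a, a) |a. a \<in> carrier A}"
    then consider "w \<in> J" | a where "a \<in> carrier A" "w = frag_of (a, a)"
      by blast
    then show "w \<in> {z. \<exists>u\<in>J. \<exists>x\<in>F. z = u + diag x}"
    proof cases
      case 1
      then show ?thesis
        by (intro CollectI bexI[of _ w] bexI[of _ 0]) simp_all
    next
      case 2
      then show ?thesis
        by (intro CollectI bexI[of _ 0] bexI[of _ "frag_of a"]) (simp_all add: frag.subspace_0)
    qed
  qed
  then show ?thesis
    using that by blast
qed

text \<open>The wedge of a diagonal element vanishes already as a chain. Conversely, if
  \<open>wedge z\<close> is a boundary, then \<open>z\<close> lies in \<open>L\<close>, which is the
  sum of \<open>J\<close> and the diagonal elements, and \<open>J\<close> is trivial in the tensor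
  square.\<close>

lemma Psi_image: "Psi A ` carrier (Gamma A) = kernel (tensor A A) H2 (tensor_to_H2 A)"
proof
  show "Psi A ` carrier (Gamma A) \<subseteq> kernel (tensor A A) H2 (tensor_to_H2 A)"
  proof clarify
    fix g assume "g \<in> carrier (Gamma A)"
    then obtain x where x: "x \<in> F" "g = gcl x"
      by (auto simp: carrier_Gamma)
    have "hc 0 = \<one>\<^bsub>H2\<^esub>"
      using hc_eq_one_iff[of 0] frag.subspace_0[OF subspace_Z2] frag.subspace_0[OF subspace_B2] by simp
    then show "Psi A g \<in> kernel (tensor A A) H2 (tensor_to_H2 A)"
      unfolding kernel_def using x by (simp add: Psi_gcl tcl_closed diag_in tensor_to_H2_tcl wedge_diag)
  qed
  show "kernel (tensor A A) H2 (tensor_to_H2 A) \<subseteq> Psi A ` carrier (Gamma A)"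
  proof
    fix t assume "t \<in> kernel (tensor A A) H2 (tensor_to_H2 A)"
    then obtain z where z: "z \<in> frags (carrier A \<times> carrier A)" "t = tcl z" "hc (wedge z) = \<one>\<^bsub>H2\<^esub>"
      by (auto simp: kernel_def carrier_tensor tensor_to_H2_tcl)
    then have "wedge z \<in> B2"
      using hc_eq_one_iff wedge_Z2 by blast
    then have "z \<in> L"
      by (rule wedge_boundary_in_L[OF z(1)])
    then obtain u x where u: "u \<in> J" "x \<in> F" "z = u + diag x"
      by (rule L_cases)
    then have "tcl z = tcl (diag x)"
      using z(1) diag_in by (subst pcl_eq_iff[OF tensor_rels_le]) (auto simp: span_tensor_rels)
    then have "t = Psi A (gcl x)"
      using u z by (simp add: Psi_gcl)
    then show "t \<in> Psi A ` carrier (Gamma A)"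
      using gcl_closed[OF u(2)] by blast
  qed
qed

end

section \<open>The kernel of \<Psi> as the first homology\<close>

context primary_part
begin

lemma sigma_hom: "sigma_eps B \<in> hom B.Tor B.Tor"
proof (rule homI)
  fix x y assume "x \<in> carrier B.Tor" "y \<in> carrier B.Tor"
  then obtain k l where kl: "k \<in> B.K" "l \<in> B.K" "x = B.TR.Lam k" "y = B.TR.Lam l"
    by (auto simp: B.carrier_Tor)
  show "sigma_eps B x \<in> carrier B.Tor"
    using kl by (simp add: B.sigma_eps_Lam B.Lam_Tor_closed B.flip_K)
  show "sigma_eps B (x \<otimes>\<^bsub>B.Tor\<^esub> y) = sigma_eps B x \<otimes>\<^bsub>B.Tor\<^esub> sigma_eps B y"
    using kl by (simp add: B.sigma_eps_Lam B.K_add B.flip_K flip_add del: B.Tor_simps flip: B.Lam_Tor_add)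
qed

lemma invariant_representative:
  assumes "m \<in> carrier B.Tor" "sigma_eps B m = m"
  shows "\<exists>k. k \<in> B.K \<and> flip k = k \<and> B.TR.Lam k = m"
proof -
  obtain k where k: "k \<in> B.K" "m = B.TR.Lam k"
    using assms(1) by (auto simp: B.carrier_Tor)
  then have "flip k - k \<in> B.RR"
    using assms(2) B.Lam_eq_iff[OF B.flip_K k(1)] by (simp add: B.sigma_eps_Lam)
  then obtain k' where "k' \<in> B.K" "flip k' = k'" "k' - k \<in> B.RR"
    using B.symmetric_representative[OF k(1)] by blast
  then show ?thesis
    using B.Lam_eq_iff k by blast
qed

text \<open>On an invariant class the chosen symmetric representative exists by
  \<open>invariant_representative\<close>, and the value does not depend on it by
  \<open>theta_Lam\<close>.\<close>

definition theta :: "(('a \<Rightarrow>\<^sub>0 int) \<times> 'a \<Rightarrow>\<^sub>0 int) set \<Rightarrow> ('a \<Rightarrow>\<^sub>0 int) set"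
  where "theta m = gcl (mu (SOME k. k \<in> B.K \<and> flip k = k \<and> B.TR.Lam k = m))"

lemma K_B_in: "k \<in> B.K \<Longrightarrow> k \<in> frags (carrier A \<times> carrier A)"
  using K_B_le RF_le by (auto simp: K_def)

lemma symmetric_RR_B_le_N:
  assumes "k \<in> B.K" "flip k = k" "k \<in> B.RR"
  shows "k \<in> N"
  using norm_class_in_N[OF assms(1,2), of 0] assms(3) by (simp add: B.K_0)

text \<open>Two symmetric representatives differ by a symmetric element of \<open>B.RR\<close>. It
  lies in \<open>N\<close>, which \<open>mu\<close> sends to relations of \<Gamma>.\<close>

lemma theta_Lam:
  assumes k: "k \<in> B.K" "flip k = k"
  shows "theta (B.TR.Lam k) = gcl (mu k)"
proof -
  define l where "l = (SOME l. l \<in> B.K \<and> flip l = l \<and> B.TR.Lam l = B.TR.Lam k)"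
  have l: "l \<in> B.K" "flip l = l" "B.TR.Lam l = B.TR.Lam k"
    using someI[of "\<lambda>l. l \<in> B.K \<and> flip l = l \<and> B.TR.Lam l = B.TR.Lam k" k] k unfolding l_def by auto
  then have "l - k \<in> B.RR"
    using B.Lam_eq_iff[OF l(1) k(1)] by simp
  then have "l - k \<in> N"
    using k l by (intro symmetric_RR_B_le_N) (auto simp: B.K_diff flip_diff)
  then have "mu l - mu k \<in> Grel"
    using mu_N[of "l - k"] by (simp add: mu_diff)
  then have "gcl (mu l) = gcl (mu k)"
    using l k by (subst gcl_eq_iff) (simp_all add: mu_in_F K_B_in)
  then show ?thesis
    by (simp add: theta_def l_def)
qed

text \<open>For symmetric \<open>k\<close> the elements \<open>diag (mu k)\<close> and
  \<open>k\<close> agree modulo \<open>N\<close>, and \<open>diag\<close> sends \<open>Grel\<close>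
  into \<open>N\<close>.\<close>

lemma mu_in_Grel_iff:
  assumes "k \<in> B.K" "flip k = k"
  shows "mu k \<in> Grel \<longleftrightarrow> k \<in> N"
proof
  assume "mu k \<in> Grel"
  then have "diag (mu k) - (diag (mu k) - k) \<in> N"
    by (intro frag.subspace_diff[OF subspace_N] diag_Grel diag_mu_sym K_B_in assms)
  moreover have "diag (mu k) - (diag (mu k) - k) = k"
    by simp
  ultimately show "k \<in> N"
    by (simp only:)
qed (rule mu_N)

text \<open>\<open>k\<close> lies in \<open>J\<close>, so \<open>diag (mu k)\<close> is trivial in
  the tensor square. Surjectivity is where \<open>diag_in_J_representative\<close> replaces
  representatives over \<open>A\<close> by 2-primary ones.\<close>

lemma theta_image:
  "theta ` {m \<in> carrier B.Tor. sigma_eps B m = m} = kernel (Gamma A) (tensor A A) (Psi A)"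
proof
  show "theta ` {m \<in> carrier B.Tor. sigma_eps B m = m} \<subseteq> kernel (Gamma A) (tensor A A) (Psi A)"
  proof clarify
    fix m assume m: "m \<in> carrier B.Tor" "sigma_eps B m = m"
    obtain k where k: "k \<in> B.K" "flip k = k" "B.TR.Lam k = m"
      using invariant_representative[OF m] by blast
    have "diag (mu k) - k \<in> J"
      using diag_mu_sym[OF K_B_in[OF k(1)] k(2)] N_le_J by blast
    moreover have "k \<in> J"
      using k(1) K_B_le RF_le_J by (auto simp: K_def)
    ultimately have "diag (mu k) - k + k \<in> J"
      by (rule frag.subspace_add[OF subspace_J])
    then have "tcl (diag (mu k)) = \<one>\<^bsub>tensor A A\<^esub>"
      using k K_B_in by (subst tcl_eq_one_iff) (auto simp: diag_in mu_in_F)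
    then show "theta m \<in> kernel (Gamma A) (tensor A A) (Psi A)"
      using k K_B_in theta_Lam[OF k(1,2)] by (auto simp: kernel_def gcl_closed mu_in_F Psi_gcl)
  qed
  show "kernel (Gamma A) (tensor A A) (Psi A) \<subseteq> theta ` {m \<in> carrier B.Tor. sigma_eps B m = m}"
  proof
    fix g assume "g \<in> kernel (Gamma A) (tensor A A) (Psi A)"
    then obtain x where x: "x \<in> F" "g = gcl x" "tcl (diag x) = \<one>\<^bsub>tensor A A\<^esub>"
      by (auto simp: kernel_def carrier_Gamma Psi_gcl)
    then have "diag x \<in> J"
      using tcl_eq_one_iff[OF diag_in] by blast
    then obtain k where k: "k \<in> B.K" "flip k = k" "x - mu k \<in> Grel"
      using diag_in_J_representative x(1) by blast
    then have "g = theta (B.TR.Lam k)"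
      using x gcl_eq_iff[OF x(1), of "mu k"] by (simp add: theta_Lam mu_in_F K_B_in)
    moreover have "B.TR.Lam k \<in> carrier B.Tor" "sigma_eps B (B.TR.Lam k) = B.TR.Lam k"
      using k by (simp_all add: B.Lam_Tor_closed B.sigma_eps_Lam)
    ultimately show "g \<in> theta ` {m \<in> carrier B.Tor. sigma_eps B m = m}"
      by blast
  qed
qed

text \<open>Triviality means that a symmetric representative lies in the lattice \<open>N\<close> of
  \<open>A\<close>, and the retraction behind \<open>N_cap_K_B\<close> turns this into a norm
  condition inside \<open>B\<close>.\<close>

lemma theta_eq_one_iff:
  assumes m: "m \<in> carrier B.Tor" "sigma_eps B m = m"
  shows "theta m = \<one>\<^bsub>Gamma A\<^esub> \<longleftrightarrow> (\<exists>n\<in>carrier B.Tor. m = n \<otimes>\<^bsub>B.Tor\<^esub> sigma_eps B n)"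
proof -
  obtain k where k: "k \<in> B.K" "flip k = k" "B.TR.Lam k = m"
    using invariant_representative[OF m] by blast
  have "theta m = gcl (mu k)"
    using theta_Lam[OF k(1,2)] k(3) by simp
  then have "theta m = \<one>\<^bsub>Gamma A\<^esub> \<longleftrightarrow> k \<in> N"
    using gcl_eq_one_iff[of "mu k"] mu_in_Grel_iff[OF k(1,2)] k(1) by (simp add: mu_in_F K_B_in)
  also have "\<dots> \<longleftrightarrow> (\<exists>k1\<in>B.K. k - (k1 + flip k1) \<in> B.RR)"
    using N_cap_K_B norm_class_in_N k by blast
  also have "\<dots> \<longleftrightarrow> (\<exists>k1\<in>B.K. m = B.TR.Lam k1 \<otimes>\<^bsub>B.Tor\<^esub> sigma_eps B (B.TR.Lam k1))"
  proof (rule bex_cong[OF refl])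
    fix k1 assume k1: "k1 \<in> B.K"
    have "B.TR.Lam k1 \<otimes>\<^bsub>B.Tor\<^esub> sigma_eps B (B.TR.Lam k1) = B.TR.Lam (k1 + flip k1)"
      using k1 B.Lam_Tor_add[OF k1 B.flip_K[OF k1]] B.sigma_eps_Lam[OF k1] by simp
    then show "k - (k1 + flip k1) \<in> B.RR \<longleftrightarrow> m = B.TR.Lam k1 \<otimes>\<^bsub>B.Tor\<^esub> sigma_eps B (B.TR.Lam k1)"
      using B.Lam_eq_iff[OF k(1), of "k1 + flip k1"] k(3) k1 by (simp add: B.K_add B.flip_K del: B.Tor_simps)
  qed
  also have "\<dots> \<longleftrightarrow> (\<exists>n\<in>carrier B.Tor. m = n \<otimes>\<^bsub>B.Tor\<^esub> sigma_eps B n)"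
    unfolding B.carrier_Tor by blast
  finally show ?thesis .
qed

lemma kernel_Psi:
  "\<exists>\<theta>. group_hom (group_homology 1 (sym_group 2) B.Tor (Sigma2_eps B)) (Gamma A) \<theta> \<and>
    inj_on \<theta> (carrier (group_homology 1 (sym_group 2) B.Tor (Sigma2_eps B))) \<and>
    \<theta> ` carrier (group_homology 1 (sym_group 2) B.Tor (Sigma2_eps B)) = kernel (Gamma A) (tensor A A) (Psi A)"
proof -
  interpret inv: involution_module B.Tor "sigma_eps B"
    by (intro involution_module.intro involution_module_axioms.intro B.Tor_comm_group sigma_hom)
  have act: "inv.act = Sigma2_eps B"
    by (intro ext) (simp add: inv.act_def Sigma2_eps_def)
  have "\<exists>\<theta>. group_hom (group_homology (Suc 0) (sym_group 2) B.Tor inv.act) (Gamma A) \<theta> \<and>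
    inj_on \<theta> (carrier (group_homology (Suc 0) (sym_group 2) B.Tor inv.act)) \<and>
    \<theta> ` carrier (group_homology (Suc 0) (sym_group 2) B.Tor inv.act) = theta ` {m \<in> carrier B.Tor. sigma_eps B m = m}"
  proof (rule inv.H1_embedding[OF Gamma_comm_group[OF comm_group_A]])
    fix m assume m: "m \<in> carrier B.Tor" "sigma_eps B m = m"
    then show "theta m \<in> carrier (Gamma A)"
      using theta_image by (auto simp: kernel_def)
    show "theta m = \<one>\<^bsub>Gamma A\<^esub> \<longleftrightarrow> (\<exists>n\<in>carrier B.Tor. m = n \<otimes>\<^bsub>B.Tor\<^esub> sigma_eps B n)"
      by (rule theta_eq_one_iff[OF m])
    fix n assume n: "n \<in> carrier B.Tor" "sigma_eps B n = n"
    obtain k where k: "k \<in> B.K" "flip k = k" "m = B.TR.Lam k"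
      using invariant_representative[OF m] by blast
    obtain l where l: "l \<in> B.K" "flip l = l" "n = B.TR.Lam l"
      using invariant_representative[OF n] by blast
    have "theta (m \<otimes>\<^bsub>B.Tor\<^esub> n) = theta (B.TR.Lam (k + l))"
      using B.Lam_Tor_add[OF k(1) l(1)] k l by simp
    also have "\<dots> = gcl (mu k + mu l)"
      using k l by (simp add: theta_Lam B.K_add flip_add mu_add)
    also have "\<dots> = gcl (mu k) \<otimes>\<^bsub>Gamma A\<^esub> gcl (mu l)"
      using group_hom.hom_mult[OF gcl_hom, of "mu k" "mu l"] k l by (simp add: mu_in_F K_B_in)
    finally show "theta (m \<otimes>\<^bsub>B.Tor\<^esub> n) = theta m \<otimes>\<^bsub>Gamma A\<^esub> theta n"
      using k l by (simp add: theta_Lam)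
  next
    fix m assume "m \<in> carrier B.Tor"
    then show "sigma_eps B (sigma_eps B m) = m"
      by (auto simp: B.carrier_Tor B.sigma_eps_Lam B.flip_K)
  qed
  then show ?thesis
    unfolding act theta_image One_nat_def .
qed

end

theorem theorem3p1:
  fixes A :: "('a, 'm) monoid_scheme"
  assumes "comm_group A"
  shows "let B = two_primary A;
             H1 = group_homology 1 (sym_group 2) (Tor1 B B) (Sigma2_eps B);
             H2 = integral_homology 2 A
         in \<exists>\<theta>.
           group_hom H1 (Gamma A) \<theta> \<and>
           group_hom (Gamma A) (tensor A A) (Psi A) \<and>
           group_hom (tensor A A) H2 (tensor_to_H2 A) \<and>
           inj_on \<theta> (carrier H1) \<and>
           \<theta> ` carrier H1 = kernel (Gamma A) (tensor A A) (Psi A) \<and>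
           Psi A ` carrier (Gamma A) = kernel (tensor A A) H2 (tensor_to_H2 A) \<and>
           tensor_to_H2 A ` carrier (tensor A A) = carrier H2"
proof -
  have "comm_group (two_primary A)"
    by (rule comm_group.two_primary_comm_group[OF assms])
  then interpret primary_part A "two_primary A"
    using assms by (simp add: primary_part_def abelian_presentation_def primary_part_axioms_def)
  show ?thesis
    unfolding Let_def using kernel_Psi Psi_group_hom tensor_to_H2_hom Psi_image tensor_to_H2_surj by blast
qed

end
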